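(* Let $F$ and $G$ be finite groups such that $F/F'$ is a direct product of a cyclic group and a group with cube-free exponent. Then the number $|\mathrm{Hom}(F,G)|$ of group homomorphisms $F\to G$ is divisible by $\gcd(|G|,\,|F:F'|)$.
   Context: $F'$ denotes the commutator subgroup of $F$, and $|F:F'|$ its index in $F$. An integer is cube-free if it is not divisible by the cube of any prime. *)

theory Defs
  imports
    "HOL-Algebra.Elementary_Groups"
    "HOL-Algebra.Generated_Groups"
    "HOL-Computational_Algebra.Primes"
begin

text \<open>
  An element of \<^term>\<open>hom F G\<close> is unconstrained outside \<^term>\<open>carrier F\<close>, so \<^term>\<open>hom F G\<close> may
  contain many functions representing the same homomorphism. Restricting to extensional
  functions picks exactly one representative of each.
\<close>

definition Homs :: "('a, 'm) monoid_scheme \<Rightarrow> ('b, 'n) monoid_scheme \<Rightarrow> ('a \<Rightarrow> 'b) set" where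
  "Homs F G = hom F G \<inter> extensional (carrier F)"

text \<open>
  The value 0 stands for infinite exponent; it is not cube-free.
\<close>

definition group_exponent :: "('a, 'm) monoid_scheme \<Rightarrow> nat" where
  "group_exponent G =
     (if \<exists>n::nat. n > 0 \<and> (\<forall>x\<in>carrier G. x [^]\<^bsub>G\<^esub> n = \<one>\<^bsub>G\<^esub>)
      then LEAST n::nat. n > 0 \<and> (\<forall>x\<in>carrier G. x [^]\<^bsub>G\<^esub> n = \<one>\<^bsub>G\<^esub>)
      else 0)"

definition cube_free :: "nat \<Rightarrow> bool" where
  "cube_free n \<longleftrightarrow> (\<forall>p. prime p \<longrightarrow> \<not> p ^ 3 dvd n)"

end

theory Submission
  imports Defs "HOL-Algebra.Sylow" "HOL-Number_Theory.Number_Theory"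
begin

text \<open>
  Fix a prime \<open>p\<close> and let \<open>B\<close> be the \<open>p\<close>-part of \<open>F/F'\<close>, so that \<open>B = D \<times> E\<close> with \<open>D\<close> cyclic
  and \<open>E\<close> of exponent dividing \<open>p\<^sup>2\<close>. Sort the homomorphisms by their restriction \<open>\<rho>\<close> to the kernel \<open>K\<close>
  of \<open>F \<rightarrow> B\<close>. Conjugation by \<open>G\<close> permutes the fibres and the stabilizer of \<open>\<rho>\<close> is the
  centralizer \<open>L\<close> of \<open>\<rho>(K)\<close>, so it suffices that \<open>gcd(|B|, |L|)\<close> divides the size of each
  fibre. Once an extension \<open>\<phi>\<^sub>0\<close> of \<open>\<rho>\<close> is chosen, the other ones correspond to the sections of the
  extension of \<open>B\<close> by \<open>L\<close> given by the twisted affine maps \<open>x \<mapsto> \<phi>\<^sub>0(f) l x \<phi>\<^sub>0(f)\<^sup>-\<^sup>1\<close> of \<open>L\<close>.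

  One can pass from \<open>L\<close> to its \<open>p\<close>-subgroups \<open>H\<close> by counting fixed points of sections on the subsets of \<open>L\<close>
  whose size is the \<open>p\<close>-part of \<open>|L|\<close>. Their number is prime to \<open>p\<close>, so each section has a
  number of fixed points prime to \<open>p\<close>; raising it to the power \<open>totient (p\<^sup>j)\<close>, that is, counting tuples of subsets,
  makes every section contribute 1 modulo \<open>p\<^sup>j\<close>.

  For a \<open>p\<close>-group \<open>H\<close>, a section over \<open>S \<times> \<langle>b\<rangle>\<close> with \<open>b\<close> of order \<open>q\<close> is a  over \<open>S\<close>
  together with an element \<open>y\<close> of a coset of \<open>H\<close> that commutes with \<open>\<psi>\<close> and satisfies \<open>q y = 0\<close>. The number of pairs
  \<open>(\<psi>, y)\<close>, summed over all values \<open>d = q y\<close>, is divisible by \<open>|H|\<close>, and induction on \<open>|H|\<close> handles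
  the noncentral \<open>d\<close>. Two central values differ by an element of the subgroup \<open>Z\<^sub>0\<close> of \<open>H\<close> of
  elements central for everything in sight. If \<open>q\<close> divides \<open>|Z\<^sub>0|\<close>, translate \<open>y\<close> by elements of \<open>Z\<^sub>0\<close>;
  if \<open>Z\<^sub>0\<close> is trivial, there is only one central \<open>d\<close>. In the remaining case \<open>q = p\<^sup>2\<close> and \<open>|Z\<^sub>0| = p\<close>, and
  the pairs with noncentral \<open>e = p y\<close> are harmless, whereas the central \<open>e\<close> differ by elements killed by \<open>p\<close>, so only
  one \<open>d = p e\<close> can fail to be divisible as claimed. This is where the exponent has to be cube-free.
  For the cyclic factor \<open>D\<close>, of arbitrary order \<open>p\<^sup>n\<close>, one uses that \<open>p\<^sup>n (x + k) = p\<^sup>n x\<close> for \<open>k\<close> in the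
  \<open>n\<close>-th term of the upper \<open>p\<close>-central series of \<open>H\<close>.
\<close>

section \<open>Orbit counting\<close>

text \<open>\<open>act\<close> is a plain function constrained only on \<open>X\<close>, so that
  left translation, conjugation and images of cosets can serve as actions directly.\<close>

definition acts_on :: "('g, 'm) monoid_scheme \<Rightarrow> ('g \<Rightarrow> 'x \<Rightarrow> 'x) \<Rightarrow> 'x set \<Rightarrow> bool" where
  "acts_on G act X \<longleftrightarrow>
     (\<forall>x\<in>X. act \<one>\<^bsub>G\<^esub> x = x) \<and> (\<forall>g\<in>carrier G. \<forall>x\<in>X. act g x \<in> X) \<and>
     (\<forall>g\<in>carrier G. \<forall>h\<in>carrier G. \<forall>x\<in>X. act (g \<otimes>\<^bsub>G\<^esub> h) x = act g (act h x))"

lemma acts_onI: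
  assumes "\<And>x. x \<in> X \<Longrightarrow> act \<one>\<^bsub>G\<^esub> x = x"
    and "\<And>g x. g \<in> carrier G \<Longrightarrow> x \<in> X \<Longrightarrow> act g x \<in> X"
    and "\<And>g h x. g \<in> carrier G \<Longrightarrow> h \<in> carrier G \<Longrightarrow> x \<in> X \<Longrightarrow> act (g \<otimes>\<^bsub>G\<^esub> h) x = act g (act h x)"
  shows "acts_on G act X"
  using assms unfolding acts_on_def by blast

lemma card_Diff_plus: "finite X \<Longrightarrow> card X = card (X - {x \<in> X. P x}) + card {x \<in> X. P x}"
  using card_Diff_subset[of "{x \<in> X. P x}" X] card_mono[of X "{x \<in> X. P x}"] by auto

context group
begin

lemma acts_on_inv:
  assumes "acts_on G act X" "g \<in> carrier G" "x \<in> X"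
  shows "act (inv g) (act g x) = x" "act g (act (inv g) x) = x"
  using assms unfolding acts_on_def by (metis inv_closed l_inv r_inv)+

lemma acts_on_eq_iff:
  assumes "acts_on G act X" "g \<in> carrier G" "h \<in> carrier G" "x \<in> X"
  shows "act g x = act h x \<longleftrightarrow> act (inv h \<otimes> g) x = x"
proof -
  have "act (inv h \<otimes> g) x = act (inv h) (act g x)" and m: "act g x \<in> X" "act h x \<in> X"
    using assms unfolding acts_on_def by auto
  then show ?thesis
    using acts_on_inv[OF assms(1,3,4)] acts_on_inv(2)[OF assms(1,3) m(1)] by metis
qed

text \<open>All fibres of the orbit map are translates of the stabilizer, so the group splits into
  equally large pieces, one for each point of the orbit.\<close>

lemma orbit_stabilizer:
  assumes fin: "finite (carrier G)" and A: "acts_on G act X" and x: "x \<in> X"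
  shows "card ((\<lambda>g. act g x) ` carrier G) * card {g \<in> carrier G. act g x = x} = order G"
proof -
  let ?S = "{g \<in> carrier G. act g x = x}"
  have fibre: "card {g \<in> carrier G. act g x = y} = card ?S" if "y \<in> (\<lambda>g. act g x) ` carrier G" for y
  proof -
    from that obtain h where h: "h \<in> carrier G" "y = act h x" by blast
    have "bij_betw (\<lambda>g. inv h \<otimes> g) {g \<in> carrier G. act g x = y} ?S"
    proof (rule bij_betwI[where g = "\<lambda>g. h \<otimes> g"])
      show "(\<lambda>g. inv h \<otimes> g) \<in> {g \<in> carrier G. act g x = y} \<rightarrow> ?S"
        using h x acts_on_eq_iff[OF A _ h(1) x] by auto
      show "(\<lambda>g. h \<otimes> g) \<in> ?S \<rightarrow> {g \<in> carrier G. act g x = y}"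
        using h x A unfolding acts_on_def by auto
    qed (use h in \<open>auto simp: m_assoc[symmetric]\<close>)
    then show ?thesis by (rule bij_betw_same_card)
  qed
  have "order G = card (\<Union>y\<in>(\<lambda>g. act g x) ` carrier G. {g \<in> carrier G. act g x = y})"
    unfolding order_def by (rule arg_cong[where f = card]) auto
  also have "\<dots> = (\<Sum>y\<in>(\<lambda>g. act g x) ` carrier G. card {g \<in> carrier G. act g x = y})"
    by (rule card_UN_disjoint) (use fin in auto)
  also have "\<dots> = card ((\<lambda>g. act g x) ` carrier G) * card ?S"
    using fibre by simp
  finally show ?thesis by simp
qed

lemma orbit_eq:
  assumes A: "acts_on G act X" and x: "x \<in> X" and h: "h \<in> carrier G"
  shows "(\<lambda>g. act g (act h x)) ` carrier G = (\<lambda>g. act g x) ` carrier G"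
proof safe
  fix g assume g: "g \<in> carrier G"
  show "act g (act h x) \<in> (\<lambda>g. act g x) ` carrier G"
    using A x g h unfolding acts_on_def by (metis (no_types, lifting) image_eqI m_closed)
  have "act g x = act (g \<otimes> inv h) (act h x)"
    using A x g h acts_on_inv[OF A h x] unfolding acts_on_def by (metis inv_closed)
  then show "act g x \<in> (\<lambda>g. act g (act h x)) ` carrier G"
    using g h by blast
qed

text \<open>An invariant weight is constant on orbits, so an orbit contributes its length times one
  value. Most divisibilities below come from this: the weight makes up for the part of
  \<open>d\<close> that the orbit length lacks.\<close>

lemma dvd_sum_orbits:
  fixes f :: "'x \<Rightarrow> nat"
  assumes A: "acts_on G act X" and finX: "finite X"
    and inv: "\<And>g x. g \<in> carrier G \<Longrightarrow> x \<in> X \<Longrightarrow> f (act g x) = f x"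
    and d: "\<And>x. x \<in> X \<Longrightarrow> d dvd card ((\<lambda>g. act g x) ` carrier G) * f x"
  shows "d dvd (\<Sum>x\<in>X. f x)"
proof -
  let ?o = "\<lambda>x. (\<lambda>g. act g x) ` carrier G"
  have self: "x \<in> ?o x" if "x \<in> X" for x
    using A that unfolding acts_on_def by (metis (no_types, lifting) image_eqI one_closed)
  have fib: "{x \<in> X. ?o x = ?o y} = ?o y" if "y \<in> X" for y
  proof (intro equalityI subsetI)
    fix x assume "x \<in> ?o y"
    then obtain h where "h \<in> carrier G" "x = act h y" by blast
    then show "x \<in> {x \<in> X. ?o x = ?o y}"
      using orbit_eq[OF A that] A that unfolding acts_on_def by auto
  next
    fix x assume "x \<in> {x \<in> X. ?o x = ?o y}"
    then show "x \<in> ?o y" using self[of x] by simp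
  qed
  have "(\<Sum>x\<in>X. f x) = (\<Sum>B\<in>?o ` X. \<Sum>x\<in>{x \<in> X. ?o x = B}. f x)"
    by (rule sum.image_gen[OF finX])
  moreover have "d dvd (\<Sum>x\<in>{x \<in> X. ?o x = B}. f x)" if B: "B \<in> ?o ` X" for B
  proof -
    from B obtain y where y: "y \<in> X" "B = ?o y" by blast
    have "(\<Sum>x\<in>{x \<in> X. ?o x = B}. f x) = (\<Sum>x\<in>?o y. f x)"
      using fib[OF y(1)] y(2) by simp
    also have "\<dots> = (\<Sum>x\<in>?o y. f y)"
      by (rule sum.cong) (use inv y in auto)
    finally show ?thesis using d[OF y(1)] by simp
  qed
  ultimately show ?thesis by (simp add: dvd_sum)
qed

lemma dvd_card_free:
  assumes A: "acts_on G act X" and finX: "finite X"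
    and inj: "\<And>x. x \<in> X \<Longrightarrow> inj_on (\<lambda>g. act g x) (carrier G)"
  shows "order G dvd card X"
proof -
  have "order G dvd (\<Sum>x\<in>X. 1)"
    by (rule dvd_sum_orbits[OF A finX]) (auto simp: card_image[OF inj] order_def)
  then show ?thesis by simp
qed

text \<open>A nontrivial orbit of a \<open>p\<close>-group has length a power of \<open>p\<close>
  other than 1, so only the fixed points count modulo \<open>p\<close>.\<close>

lemma card_fixed_points_cong:
  assumes p: "prime p" and ord: "order G = p ^ k" and A: "acts_on G act X" and finX: "finite X"
  shows "[card X = card {x \<in> X. \<forall>g\<in>carrier G. act g x = x}] (mod p)"
proof -
  let ?F = "{x \<in> X. \<forall>g\<in>carrier G. act g x = x}"
  have fin: "finite (carrier G)"
    using ord p by (metis card.infinite not_prime_0 order_def power_eq_0_iff)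
  have A': "acts_on G act (X - ?F)"
  proof (rule acts_onI)
    fix g x assume g: "g \<in> carrier G" and x: "x \<in> X - ?F"
    show "act g x \<in> X - ?F"
    proof -
      have "act g x \<in> X" using A g x unfolding acts_on_def by blast
      moreover have False if "\<forall>h\<in>carrier G. act h (act g x) = act g x"
      proof -
        have gx: "act g x = x"
          using bspec[OF that inv_closed[OF g]] acts_on_inv(1)[OF A g, of x] x by simp
        show False using that x unfolding gx by blast
      qed
      ultimately show ?thesis by blast
    qed
  qed (use A in \<open>auto simp: acts_on_def\<close>)
  have "p dvd (\<Sum>x\<in>X - ?F. 1)"
  proof (rule dvd_sum_orbits[OF A'])
    fix x assume x: "x \<in> X - ?F"
    let ?o = "card ((\<lambda>g. act g x) ` carrier G)"
    have "?o dvd p ^ k"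
      unfolding ord[symmetric] orbit_stabilizer[OF fin A' x, symmetric] by (rule dvd_triv_left)
    then obtain i where i: "?o = p ^ i" using p by (metis divides_primepow_nat)
    have "?o \<noteq> 1"
    proof
      assume "?o = 1"
      then obtain y where y: "(\<lambda>g. act g x) ` carrier G = {y}" by (auto simp: card_1_singleton_iff)
      have "act \<one> x = x" using A x unfolding acts_on_def by blast
      moreover have "act g x = y" if "g \<in> carrier G" for g using y that by blast
      ultimately have "\<forall>g\<in>carrier G. act g x = x" by (metis one_closed)
      then show False using x by blast
    qed
    then have "i \<noteq> 0" using i by auto
    then show "p dvd ?o * 1" using i by simp
  qed (use finX in auto)
  then have "p dvd card (X - ?F)" by simp
  moreover have "card X = card (X - ?F) + card ?F"
    by (rule card_Diff_plus[OF finX])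
  ultimately show ?thesis by (auto simp: cong_def elim!: dvdE)
qed

end

text \<open>Used with \<open>i\<close> the index of a stabilizer of order \<open>c\<close> in a
  group of order \<open>h\<close>: a count divisible by \<open>gcd a c\<close> at one point of an
  orbit becomes divisible by \<open>gcd a h\<close> when summed over the orbit.\<close>

lemma gcd_dvd_index_mult_gcd:
  fixes a h i c :: nat
  assumes "i * c = h" shows "gcd a h dvd i * gcd a c"
proof -
  have "i * gcd a c = gcd (i * a) h" using assms by (simp add: gcd_mult_distrib_nat)
  then show ?thesis by (simp add: gcd_dvdI1 gcd_dvdI2)
qed

section \<open>Sections with values in an additively written group\<close>

text \<open>
  Extensions are embedded in a type of class \<^class>\<open>group_add\<close>, whose addition need not be commutative: subgroups
  of one type are easier to vary in an induction than group records.
\<close>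

primrec nmul :: "nat \<Rightarrow> 'e::group_add \<Rightarrow> 'e" where
  "nmul 0 x = 0"
| "nmul (Suc n) x = x + nmul n x"

definition conjg :: "'e::group_add \<Rightarrow> 'e \<Rightarrow> 'e" where
  "conjg h y = h + y - h"

lemmas conjg_unfold = conjg_def add.assoc diff_conv_add_uminus minus_add

definition commutes :: "'e::group_add \<Rightarrow> 'e \<Rightarrow> bool" where
  "commutes x y \<longleftrightarrow> x + y = y + x"

lemma conjg_simps [simp]: "conjg 0 y = y" "conjg h 0 = 0" "conjg h (x + y) = conjg h x + conjg h y"
  "conjg h (- x) = - conjg h x" "conjg (- h) (conjg h y) = y" "conjg h (conjg (- h) y) = y"
  by (simp_all add: conjg_unfold del: add_uminus_conv_diff)

lemma conjg_add: "conjg (a + b) y = conjg a (conjg b y)"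
  by (simp add: conjg_unfold del: add_uminus_conv_diff)

lemma conjg_inject [simp]: "conjg h x = conjg h y \<longleftrightarrow> x = y"
proof
  assume "conjg h x = conjg h y"
  then have "conjg (- h) (conjg h x) = conjg (- h) (conjg h y)" by (rule arg_cong)
  then show "x = y" by simp
qed simp

lemma conjg_nmul: "conjg h (nmul n x) = nmul n (conjg h x)"
  by (induction n) auto

lemma conjg_eq_self_iff: "conjg h y = y \<longleftrightarrow> commutes h y"
  by (simp add: conjg_def commutes_def diff_eq_eq)

lemma commutes_conjg_iff [simp]: "commutes (conjg h x) (conjg h y) \<longleftrightarrow> commutes x y"
  unfolding commutes_def conjg_simps(3)[symmetric] conjg_inject by (rule refl)

lemma commutes_sym: "commutes x y \<Longrightarrow> commutes y x"
  by (simp add: commutes_def)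

lemma commutes_self [simp]: "commutes x x"
  by (simp add: commutes_def)

lemma commutes_zero [simp]: "commutes x 0" "commutes 0 x"
  by (simp_all add: commutes_def)

lemma commutes_add: "commutes x y \<Longrightarrow> commutes x z \<Longrightarrow> commutes x (y + z)"
  unfolding commutes_def by (metis add.assoc)

lemma commutes_add_left: "commutes y x \<Longrightarrow> commutes z x \<Longrightarrow> commutes (y + z) x"
  using commutes_add commutes_sym by blast

lemma commutes_minus [simp]: "commutes x (- y) \<longleftrightarrow> commutes x y"
proof -
  have "commutes x (- y)" if "commutes x y" for y
  proof -
    from that have "- y + (x + y) - y = - y + (y + x) - y" by (simp add: commutes_def)
    then show ?thesis by (simp add: commutes_def add.assoc diff_conv_add_uminus del: add_uminus_conv_diff)
  qed
  from this[of y] this[of "- y"] show ?thesis by auto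
qed

lemma commutes_minus_left [simp]: "commutes (- x) y \<longleftrightarrow> commutes x y"
  using commutes_minus commutes_sym by blast

lemma commutes_nmul: "commutes x y \<Longrightarrow> commutes x (nmul n y)"
  by (induction n) (auto intro: commutes_add)

lemma nmul_add: "nmul (m + n) x = nmul m x + nmul n x"
  by (induction m) (auto simp: add.assoc)

lemma nmul_mult: "nmul (m * n) x = nmul m (nmul n x)"
  by (induction m) (auto simp: nmul_add)

lemma nmul_zero [simp]: "nmul n 0 = 0"
  by (induction n) auto

lemma nmul_1 [simp]: "nmul 1 x = x" "nmul (Suc 0) x = x"
  by simp_all

lemma nmul_add_commutes:
  assumes "commutes x y" shows "nmul n (x + y) = nmul n x + nmul n y"
proof (induction n)
  case (Suc n)
  have "commutes y (nmul n x)" using assms commutes_nmul commutes_sym by blast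
  then have "y + (nmul n x + nmul n y) = nmul n x + (y + nmul n y)"
    unfolding commutes_def add.assoc[symmetric] by (rule arg_cong)
  then show ?case using Suc by (simp add: add.assoc)
qed auto

lemma commutes_nmul_left: "commutes x y \<Longrightarrow> commutes (nmul n x) y"
  using commutes_nmul commutes_sym by blast

section \<open>Subgroups, centralizers and cosets in an additive group\<close>

definition add_subgroup :: "'e::group_add set \<Rightarrow> bool" where
  "add_subgroup H \<longleftrightarrow> 0 \<in> H \<and> (\<forall>x\<in>H. \<forall>y\<in>H. x + y \<in> H) \<and> (\<forall>x\<in>H. - x \<in> H)"

text \<open>Turns a subset into a group record, so that orbit counting and the Sylow theorem can be
  applied to it; it is a group only when \<open>H\<close> is a subgroup.\<close>

definition group_on :: "'e::group_add set \<Rightarrow> 'e monoid" where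
  "group_on H = \<lparr>carrier = H, monoid.mult = (+), one = 0\<rparr>"

lemma group_on_simps [simp]:
  "carrier (group_on H) = H" "x \<otimes>\<^bsub>group_on H\<^esub> y = x + y" "\<one>\<^bsub>group_on H\<^esub> = 0"
  by (simp_all add: group_on_def)

lemma order_group_on [simp]: "order (group_on H) = card H"
  by (simp add: order_def)

lemma add_subgroupD:
  assumes "add_subgroup H"
  shows "0 \<in> H" "x \<in> H \<Longrightarrow> y \<in> H \<Longrightarrow> x + y \<in> H" "x \<in> H \<Longrightarrow> - x \<in> H"
    "x \<in> H \<Longrightarrow> y \<in> H \<Longrightarrow> x - y \<in> H"
  using assms by (simp_all add: add_subgroup_def diff_conv_add_uminus del: add_uminus_conv_diff)

lemma group_group_on: "add_subgroup H \<Longrightarrow> group (group_on H)"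
  by (rule groupI) (auto simp: add_subgroup_def add.assoc intro: left_minus)

lemma nmul_mem: "add_subgroup H \<Longrightarrow> x \<in> H \<Longrightarrow> nmul n x \<in> H"
  by (induction n) (auto simp: add_subgroupD)

lemma add_subgroup_card_dvd:
  assumes "add_subgroup K" "add_subgroup H" "K \<subseteq> H" "finite H"
  shows "card K dvd card H"
proof -
  interpret K: group "group_on K" by (rule group_group_on) (rule assms(1))
  have "order (group_on K) dvd card H"
    by (rule K.dvd_card_free[where act = "(+)"])
      (use assms in \<open>auto simp: acts_on_def add_subgroup_def add.assoc inj_on_def\<close>)
  then show ?thesis by simp
qed

lemma nmul_card_eq_0:
  assumes "add_subgroup H" "finite H" "x \<in> H" shows "nmul (card H) x = 0"
proof -
  interpret group "group_on H" by (rule group_group_on) (rule assms(1))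
  have pow: "x [^]\<^bsub>group_on H\<^esub> n = nmul n x" for n :: nat
  proof (induction n)
    case (Suc n)
    have "commutes (nmul n x) x" by (simp add: commutes_nmul_left)
    then show ?case using Suc by (simp add: commutes_def)
  qed simp
  show ?thesis
    using pow_order_eq_1[of x] assms(3) pow[of "card H"] by simp
qed

lemma exists_subgroup_of_prime_power_order:
  assumes "add_subgroup H" "finite H" "prime p" "p ^ a dvd card H"
  shows "\<exists>M. add_subgroup M \<and> M \<subseteq> H \<and> card M = p ^ a"
proof -
  interpret G: group "group_on H" by (rule group_group_on) (rule assms(1))
  obtain m where "card H = p ^ a * m" using assms(4) by (elim dvdE)
  then have "order (group_on H) = p ^ a * m" by simp
  then have "\<exists>M. subgroup M (group_on H) \<and> card M = p ^ a"
    by (rule sylow_thm[OF assms(3) G.is_group]) (simp add: assms(2))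
  then obtain M where M: "subgroup M (group_on H)" "card M = p ^ a" by blast
  have inv: "inv\<^bsub>group_on H\<^esub> x = - x" if "x \<in> H" for x
    using that assms(1) by (intro G.inv_equality) (auto simp: add_subgroup_def)
  have "add_subgroup M"
    using subgroup.subset[OF M(1)] subgroup.m_closed[OF M(1)] subgroup.one_closed[OF M(1)]
      subgroup.m_inv_closed[OF M(1)] inv
    unfolding add_subgroup_def by (auto simp: subset_iff)
  moreover have "M \<subseteq> H" using subgroup.subset[OF M(1)] by simp
  ultimately show ?thesis using M(2) by blast
qed

definition centralizer :: "'e::group_add set \<Rightarrow> 'e \<Rightarrow> 'e set" where
  "centralizer H y = {h \<in> H. commutes h y}"

lemma add_subgroup_centralizer: "add_subgroup H \<Longrightarrow> add_subgroup (centralizer H y)"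
  by (auto simp: add_subgroup_def centralizer_def intro: commutes_add_left)

lemma centralizer_subset: "centralizer H y \<subseteq> H"
  by (auto simp: centralizer_def)

lemma acts_on_conjg:
  assumes "add_subgroup H" "\<And>h x. h \<in> H \<Longrightarrow> x \<in> X \<Longrightarrow> conjg h x \<in> X"
  shows "acts_on (group_on H) conjg X"
  using assms by (auto intro!: acts_onI simp: conjg_add)

lemma conjg_orbit_stabilizer:
  assumes "add_subgroup H" "finite H"
  shows "card ((\<lambda>h. conjg h y) ` H) * card (centralizer H y) = card H"
proof -
  interpret G: group "group_on H" by (rule group_group_on) (rule assms(1))
  have "acts_on (group_on H) conjg UNIV" using assms(1) by (auto intro: acts_on_conjg)
  from G.orbit_stabilizer[OF _ this, of y] show ?thesis
    using assms by (simp add: centralizer_def conjg_eq_self_iff)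
qed

text \<open>Both inclusions are demanded, since for an infinite \<open>H\<close> one does not imply
  the other.\<close>

definition normalizes :: "'e::group_add \<Rightarrow> 'e set \<Rightarrow> bool" where
  "normalizes x H \<longleftrightarrow> (\<forall>h\<in>H. conjg x h \<in> H \<and> conjg (- x) h \<in> H)"

lemma normalizesD: "normalizes x H \<Longrightarrow> h \<in> H \<Longrightarrow> conjg x h \<in> H" "normalizes x H \<Longrightarrow> h \<in> H \<Longrightarrow> conjg (- x) h \<in> H"
  by (auto simp: normalizes_def)

lemma normalizes_mem: "add_subgroup H \<Longrightarrow> x \<in> H \<Longrightarrow> normalizes x H"
  by (auto simp: normalizes_def conjg_def add_subgroupD diff_conv_add_uminus simp del: add_uminus_conv_diff)

lemma normalizes_add: "normalizes x H \<Longrightarrow> normalizes y H \<Longrightarrow> normalizes (x + y) H"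
  by (auto simp: normalizes_def conjg_add minus_add simp del: add_uminus_conv_diff)

lemma normalizes_coset:
  assumes "add_subgroup H" "normalizes g H" "- g + y \<in> H" shows "normalizes y H"
proof -
  have "normalizes (g + (- g + y)) H" by (intro normalizes_add normalizes_mem assms)
  then show ?thesis by simp
qed

lemma normalizes_nmul: "normalizes x H \<Longrightarrow> normalizes (nmul n x) H"
  by (induction n) (auto simp: normalizes_add, simp add: normalizes_def)

text \<open>Conjugation by \<open>x\<close> fixes \<open>y\<close>, hence permutes the elements that
  commute with \<open>y\<close>.\<close>

lemma normalizes_centralizer:
  assumes "normalizes x H" "commutes x y" shows "normalizes x (centralizer H y)"
proof -
  have "conjg x y = y" "conjg (- x) y = y" using assms(2) by (simp_all add: conjg_eq_self_iff)
  then have "commutes (conjg x h) y \<longleftrightarrow> commutes h y" "commutes (conjg (-x) h) y \<longleftrightarrow> commutes h y" for h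
    by (metis commutes_conjg_iff)+
  then show ?thesis using assms(1) by (auto simp: normalizes_def centralizer_def)
qed

text \<open>Membership \<open>- g + y \<in> H\<close> says that \<open>y\<close> lies in the coset
  \<open>g + H\<close>. Cosets of a normalized subgroup can be added, so the multiples of
  \<open>y\<close> follow those of \<open>g\<close>; the induction step moves one difference
  \<open>- g + y\<close> past \<open>nmul n g\<close> by conjugation.\<close>

lemma coset_nmul:
  assumes H: "add_subgroup H" and g: "normalizes g H" and y: "- g + y \<in> H"
  shows "- nmul n g + nmul n y \<in> H"
proof (induction n)
  case (Suc n)
  have "- nmul (Suc n) g + nmul (Suc n) y = conjg (- nmul n g) (- g + y) + (- nmul n g + nmul n y)"
    by (simp add: conjg_unfold del: add_uminus_conv_diff)
  moreover have "conjg (- nmul n g) (- g + y) \<in> H"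
    using normalizes_nmul[OF g] y by (simp add: normalizes_def del: conjg_simps)
  ultimately show ?case using Suc H by (simp add: add_subgroupD)
qed (use H in \<open>simp add: add_subgroupD\<close>)

definition p_subgroup :: "nat \<Rightarrow> 'e::group_add set \<Rightarrow> bool" where
  "p_subgroup p H \<longleftrightarrow> add_subgroup H \<and> finite H \<and> (\<exists>k. card H = p ^ k)"

lemma p_subgroupD:
  assumes "p_subgroup p H" shows "add_subgroup H" "finite H" "\<exists>k. card H = p ^ k"
  using assms by (simp_all add: p_subgroup_def)

lemma p_subgroup_subset:
  assumes "p_subgroup p H" "prime p" "add_subgroup K" "K \<subseteq> H" shows "p_subgroup p K"
proof -
  have "card K dvd card H" by (intro add_subgroup_card_dvd assms p_subgroupD[OF assms(1)])
  then show ?thesis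
    using assms p_subgroupD[OF assms(1)] unfolding p_subgroup_def
    by (metis divides_primepow_nat finite_subset)
qed

lemma p_subgroup_centralizer: "p_subgroup p H \<Longrightarrow> prime p \<Longrightarrow> p_subgroup p (centralizer H y)"
  by (meson add_subgroup_centralizer centralizer_subset p_subgroupD(1) p_subgroup_subset)

text \<open>
  Vanishing outside the carrier makes representatives unique and, unlike extensionality, is preserved by pointwise conjugation.
\<close>

definition homs0 :: "('s, 'm) monoid_scheme \<Rightarrow> ('s \<Rightarrow> 'e::group_add) set" where
  "homs0 S = {f. (\<forall>s. s \<notin> carrier S \<longrightarrow> f s = 0) \<and>
     (\<forall>s\<in>carrier S. \<forall>t\<in>carrier S. f (s \<otimes>\<^bsub>S\<^esub> t) = f s + f t)}"

text \<open>
  If \<open>f0\<close> normalizes \<open>H\<close>, these are the sections of the extension of \<open>S\<close> by \<open>H\<close> that \<open>f0\<close> splits.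
\<close>

definition sections :: "('s, 'm) monoid_scheme \<Rightarrow> 'e::group_add set \<Rightarrow> ('s \<Rightarrow> 'e) \<Rightarrow> ('s \<Rightarrow> 'e) set" where
  "sections S H f0 = {f \<in> homs0 S. \<forall>s\<in>carrier S. - f0 s + f s \<in> H}"

lemma finite_sections:
  assumes "finite (carrier S)" "finite H" shows "finite (sections S H f0)"
proof (rule finite_subset)
  let ?B = "\<Union>s\<in>carrier S. (\<lambda>h. f0 s + h) ` H"
  show "finite {f. \<forall>s. (s \<in> carrier S \<longrightarrow> f s \<in> ?B) \<and> (s \<notin> carrier S \<longrightarrow> f s = 0)}"
    by (rule finite_set_of_finite_funs) (use assms in auto)
  show "sections S H f0 \<subseteq> {f. \<forall>s. (s \<in> carrier S \<longrightarrow> f s \<in> ?B) \<and> (s \<notin> carrier S \<longrightarrow> f s = 0)}"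
  proof safe
    fix f s assume "f \<in> sections S H f0" "s \<in> carrier S"
    moreover have "f s = f0 s + (- f0 s + f s)" by simp
    ultimately show "f s \<in> ?B" unfolding sections_def by blast
  qed (auto simp: sections_def homs0_def)
qed

lemma conjg_homs0: "f \<in> homs0 S \<Longrightarrow> (\<lambda>s. conjg h (f s)) \<in> homs0 S"
  by (auto simp: homs0_def)

text \<open>Conjugation adds \<open>h\<close> on the left and \<open>- h\<close> on the right; since
  \<open>g\<close> normalizes \<open>H\<close>, the left summand stays in \<open>H\<close> when it
  is moved past \<open>g\<close>.\<close>

lemma conjg_coset:
  assumes H: "add_subgroup H" and g: "normalizes g H" and h: "h \<in> H" and y: "- g + y \<in> H"
  shows "- g + conjg h y \<in> H"
proof -
  have "- g + conjg h y = conjg (- g) h + (- g + y) + (- h)"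
    by (simp add: conjg_unfold del: add_uminus_conv_diff)
  then show ?thesis using assms by (simp add: add_subgroupD normalizesD del: add_uminus_conv_diff)
qed

lemma sections_conjg:
  assumes "add_subgroup H" "\<And>s. s \<in> carrier S \<Longrightarrow> normalizes (f0 s) H" "h \<in> H" "f \<in> sections S H f0"
  shows "(\<lambda>s. conjg h (f s)) \<in> sections S H f0"
  using assms conjg_homs0 conjg_coset[OF assms(1,2)] by (auto simp: sections_def)

lemma coset_diff:
  assumes "add_subgroup H" "- a + b \<in> H" "- a + c \<in> H" shows "- b + c \<in> H"
proof -
  have "- b + c = - (- a + b) + (- a + c)" by (simp add: minus_add add.assoc)
  then show ?thesis using assms by (simp add: add_subgroupD del: minus_add)
qed

lemma coset_trans:
  assumes "add_subgroup H" "- a + b \<in> H" "- b + c \<in> H" shows "- a + c \<in> H"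
proof -
  have "- a + c = (- a + b) + (- b + c)" by (simp add: add.assoc)
  then show ?thesis using assms by (simp add: add_subgroupD del: minus_add)
qed

text \<open>The type argument fixes the ambient group in which the extensions live. All
  \<open>p\<close>-subgroups \<open>H\<close> are quantified at once, so that the property can be
  applied to centralizers and stabilizers. In the applications \<open>Q\<close> is the order of
  \<open>S\<close>.\<close>

definition good :: "'e::group_add itself \<Rightarrow> nat \<Rightarrow> ('s, 'm) monoid_scheme \<Rightarrow> nat \<Rightarrow> bool" where
  "good _ p S Q \<longleftrightarrow> (\<forall>(H :: 'e set) f0. p_subgroup p H \<longrightarrow> f0 \<in> homs0 S \<longrightarrow>
     (\<forall>s\<in>carrier S. normalizes (f0 s) H) \<longrightarrow> gcd Q (card H) dvd card (sections S H f0))"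

section \<open>Counting pairs of a section and a commuting root\<close>

definition fixing :: "('s, 'm) monoid_scheme \<Rightarrow> 'e::group_add set \<Rightarrow> ('s \<Rightarrow> 'e) \<Rightarrow> 'e \<Rightarrow> ('s \<Rightarrow> 'e) set" where
  "fixing S H f0 y = {f \<in> sections S H f0. \<forall>s\<in>carrier S. commutes (f s) y}"

definition roots :: "'e::group_add set \<Rightarrow> 'e \<Rightarrow> nat \<Rightarrow> 'e \<Rightarrow> 'e set" where
  "roots H g q d = {y. - g + y \<in> H \<and> nmul q y = d}"

text \<open>For \<open>d = 0\<close> these pairs are the sections over the product of
  \<open>S\<close> with a cyclic group of order \<open>q\<close> (\<open>card_sections_GT\<close>),
  \<open>y\<close> being the image of a generator. Other values \<open>d\<close> enter because
  double counting only controls the sum over all of them.\<close>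

definition pair_count :: "('s, 'm) monoid_scheme \<Rightarrow> 'e::group_add set \<Rightarrow> ('s \<Rightarrow> 'e) \<Rightarrow> 'e \<Rightarrow> nat \<Rightarrow> 'e \<Rightarrow> nat" where
  "pair_count S H f0 g q d = (\<Sum>y\<in>roots H g q d. card (fixing S H f0 y))"

text \<open>Two sections that commute with \<open>y\<close> differ by elements commuting with
  \<open>y\<close>. So any one of them serves as base point for the others, with the centralizer of
  \<open>y\<close> in place of \<open>H\<close>, and \<open>good\<close> becomes applicable.\<close>

lemma fixing_eq_sections:
  assumes H: "add_subgroup H" and f1: "f1 \<in> fixing S H f0 y"
  shows "fixing S H f0 y = sections S (centralizer H y) f1"
proof (intro equalityI subsetI)
  fix f assume f: "f \<in> fixing S H f0 y"
  have "- f1 s + f s \<in> H" if "s \<in> carrier S" for s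
    by (rule coset_diff[OF H, of "f0 s"]) (use that f f1 in \<open>auto simp: fixing_def sections_def\<close>)
  then show "f \<in> sections S (centralizer H y) f1"
    using f f1 by (auto simp: fixing_def sections_def centralizer_def intro!: commutes_add_left)
next
  fix f assume f: "f \<in> sections S (centralizer H y) f1"
  have "commutes (f s) y" if "s \<in> carrier S" for s
  proof -
    have "commutes (f1 s + (- f1 s + f s)) y"
      by (rule commutes_add_left) (use that f f1 in \<open>auto simp: fixing_def sections_def centralizer_def\<close>)
    then show ?thesis by simp
  qed
  moreover have "- f0 s + f s \<in> H" if "s \<in> carrier S" for s
    by (rule coset_trans[OF H, of _ "f1 s"]) (use that f f1 in \<open>auto simp: fixing_def sections_def centralizer_def\<close>)
  ultimately show "f \<in> fixing S H f0 y"
    using f by (auto simp: fixing_def sections_def)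
qed

lemma sum_split:
  assumes "finite A"
  shows "(\<Sum>x\<in>A. f x) = (\<Sum>x\<in>{x \<in> A. P x}. f x) + (\<Sum>x\<in>{x \<in> A. \<not> P x}. f x)"
proof -
  have "A = {x \<in> A. P x} \<union> {x \<in> A. \<not> P x}" by blast
  also have "(\<Sum>x\<in>\<dots>. f x) = (\<Sum>x\<in>{x \<in> A. P x}. f x) + (\<Sum>x\<in>{x \<in> A. \<not> P x}. f x)"
    by (rule sum.union_disjoint) (use assms in auto)
  finally show ?thesis .
qed

text \<open>\<open>f0\<close> and \<open>g\<close> commute, so together they twist \<open>H\<close>
  by the product of \<open>S\<close> with one further cyclic factor, whose generator is to be mapped
  into the coset \<open>g + H\<close>.\<close>

locale twisted = group S for S :: "('s, 'm) monoid_scheme" (structure) +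
  fixes p :: nat and H :: "'e::group_add set" and f0 :: "'s \<Rightarrow> 'e" and g :: 'e
  assumes finite_S: "finite (carrier S)" and prime: "prime p" and p_sub: "p_subgroup p H"
    and hom: "f0 \<in> homs0 S"
    and norm: "\<And>s. s \<in> carrier S \<Longrightarrow> normalizes (f0 s) H"
    and norm_g: "normalizes g H"
    and comm: "\<And>s. s \<in> carrier S \<Longrightarrow> commutes (f0 s) g"
begin

abbreviation "Sections \<equiv> sections S H f0"
abbreviation "Fixing \<equiv> fixing S H f0"
abbreviation "Pairs \<equiv> pair_count S H f0 g"

lemma subH: "add_subgroup H" and finite_H: "finite H"
  using p_sub p_subgroupD by auto

lemma finite_coset: "finite {y. - a + y \<in> H}"
proof -
  have "{y. - a + y \<in> H} \<subseteq> (\<lambda>h. a + h) ` H"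
  proof
    fix y assume "y \<in> {y. - a + y \<in> H}"
    moreover have "y = a + (- a + y)" by simp
    ultimately show "y \<in> (\<lambda>h. a + h) ` H" by blast
  qed
  then show ?thesis using finite_H finite_surj by blast
qed

lemma finite_roots: "finite (roots H g q d)"
  by (rule finite_subset[OF _ finite_coset[of g]]) (auto simp: roots_def)

lemma finite_sec: "finite (Sections)"
  using finite_sections[OF finite_S finite_H] .

lemma conjg_sections: "h \<in> H \<Longrightarrow> f \<in> Sections \<Longrightarrow> (\<lambda>s. conjg h (f s)) \<in> Sections"
  by (rule sections_conjg[OF subH norm])

lemma gcd_dvd_fixing:
  assumes "good TYPE('e) p S Q"
  shows "gcd Q (card (centralizer H y)) dvd card (Fixing y)"
proof (cases "Fixing y = {}")
  case False
  then obtain f1 where f1: "f1 \<in> Fixing y" by blast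
  have "normalizes (f1 s) (centralizer H y)" if "s \<in> carrier S" for s
    using f1 that
    by (intro normalizes_centralizer normalizes_coset[OF subH norm[OF that]]) (auto simp: fixing_def sections_def)
  moreover have "f1 \<in> homs0 S" using f1 by (auto simp: fixing_def sections_def)
  ultimately show ?thesis
    using assms p_subgroup_centralizer[OF p_sub prime]
    unfolding good_def fixing_eq_sections[OF subH f1] by blast
qed simp

lemma card_fixing_conjg:
  assumes h: "h \<in> H"
  shows "card (Fixing (conjg h y)) = card (Fixing y)"
proof -
  have "bij_betw (\<lambda>f s. conjg h (f s)) (Fixing y) (Fixing (conjg h y))"
  proof (rule bij_betwI[where g = "\<lambda>f s. conjg (- h) (f s)"])
    show "(\<lambda>f s. conjg (- h) (f s)) \<in> Fixing (conjg h y) \<rightarrow> Fixing y"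
    proof
      fix f assume f: "f \<in> Fixing (conjg h y)"
      have "commutes (conjg (- h) (f s)) y" if "s \<in> carrier S" for s
      proof -
        have "commutes (f s) (conjg h y)" using f that by (simp add: fixing_def)
        then have "commutes (conjg (- h) (f s)) (conjg (- h) (conjg h y))"
          by (simp del: conjg_simps)
        then show ?thesis by simp
      qed
      then show "(\<lambda>s. conjg (- h) (f s)) \<in> Fixing y"
        using conjg_sections[of "- h"] h f subH by (simp add: fixing_def add_subgroupD)
    qed
  qed (use h conjg_sections in \<open>auto simp: fixing_def\<close>)
  then show ?thesis by (simp add: bij_betw_same_card)
qed

text \<open>Double counting of commuting pairs. For fixed \<open>f\<close> the admissible
  \<open>y\<close>, if there are any, form a coset of the centralizer of \<open>f\<close> in
  \<open>H\<close>, while the number of \<open>H\<close>-conjugates of \<open>f\<close> is the index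
  of that centralizer. So each class of sections contributes \<open>card H\<close> or 0.\<close>

lemma card_dvd_sum_fixing: "card H dvd (\<Sum>y | - g + y \<in> H. card (Fixing y))"
proof -
  let ?Y = "{y. - g + y \<in> H}" and ?P = "\<lambda>f y. \<forall>s\<in>carrier S. commutes (f s) y"
  have filt: "card {x \<in> X. R x} = (\<Sum>x\<in>X. if R x then 1 else 0)" if "finite X" for X :: "'z set" and R
    using that by (simp add: sum.If_cases Int_def)
  have "(\<Sum>y\<in>?Y. card (Fixing y)) = (\<Sum>y\<in>?Y. \<Sum>f\<in>Sections. if ?P f y then 1 else 0)"
    unfolding fixing_def using finite_sec by (simp add: sum.If_cases Int_def)
  also have "\<dots> = (\<Sum>f\<in>Sections. \<Sum>y\<in>?Y. if ?P f y then 1 else 0)"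
    by (rule sum.swap)
  also have "\<dots> = (\<Sum>f\<in>Sections. card {y \<in> ?Y. ?P f y})"
    using finite_coset[of g] by (simp add: sum.If_cases Int_def)
  finally have eq: "(\<Sum>y\<in>?Y. card (Fixing y)) = (\<Sum>f\<in>Sections. card {y \<in> ?Y. ?P f y})" .
  interpret G: group "group_on H" by (rule group_group_on) (rule subH)
  have A: "acts_on (group_on H) (\<lambda>h f s. conjg h (f s)) (Sections)"
    using conjg_sections by (auto intro!: acts_onI simp: conjg_add)
  have "card H dvd (\<Sum>f\<in>Sections. card {y \<in> ?Y. ?P f y})"
  proof (rule G.dvd_sum_orbits[OF A finite_sec])
    fix h f assume h: "h \<in> carrier (group_on H)" and f: "f \<in> Sections"
    have "bij_betw (conjg h) {y \<in> ?Y. ?P f y} {y \<in> ?Y. ?P (\<lambda>s. conjg h (f s)) y}"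
    proof (rule bij_betwI[where g = "conjg (- h)"])
      show "conjg (- h) \<in> {y \<in> ?Y. ?P (\<lambda>s. conjg h (f s)) y} \<rightarrow> {y \<in> ?Y. ?P f y}"
      proof
        fix y assume y: "y \<in> {y \<in> ?Y. ?P (\<lambda>s. conjg h (f s)) y}"
        have "commutes (f s) (conjg (- h) y)" if "s \<in> carrier S" for s
        proof -
          have "commutes (conjg (- h) (conjg h (f s))) (conjg (- h) y)"
            using y that by (simp del: conjg_simps)
          then show ?thesis by simp
        qed
        then show "conjg (- h) y \<in> {y \<in> ?Y. ?P f y}"
          using conjg_coset[OF subH norm_g, of "- h" y] y h subH by (simp add: add_subgroupD)
      qed
    qed (use h conjg_coset[OF subH norm_g] in auto)
    then show "card {y \<in> ?Y. ?P (\<lambda>s. conjg h (f s)) y} = card {y \<in> ?Y. ?P f y}"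
      by (simp add: bij_betw_same_card)
  next
    fix f assume f: "f \<in> Sections"
    let ?C = "{h \<in> H. \<forall>s\<in>carrier S. commutes h (f s)}"
    have zero: "f s = 0" if "s \<notin> carrier S" for s
      using f that by (auto simp: sections_def homs0_def)
    have stab: "{h \<in> carrier (group_on H). (\<lambda>s. conjg h (f s)) = f} = ?C"
    proof -
      have "(\<lambda>s. conjg h (f s)) = f \<longleftrightarrow> (\<forall>s\<in>carrier S. commutes h (f s))" for h
        unfolding fun_eq_iff conjg_eq_self_iff using zero commutes_zero(1) by metis
      then show ?thesis by simp
    qed
    have o: "card ((\<lambda>h. (\<lambda>s. conjg h (f s))) ` carrier (group_on H)) * card ?C = card H"
      using G.orbit_stabilizer[OF _ A f] stab finite_H by simp
    show "card H dvd card ((\<lambda>h. (\<lambda>s. conjg h (f s))) ` carrier (group_on H)) * card {y \<in> ?Y. ?P f y}"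
    proof (cases "{y \<in> ?Y. ?P f y} = {}")
      case False
      then obtain y1 where y1: "- g + y1 \<in> H" "?P f y1" by blast
      have "bij_betw (\<lambda>h. y1 + h) ?C {y \<in> ?Y. ?P f y}"
      proof (rule bij_betwI[where g = "\<lambda>y. - y1 + y"])
        show "(\<lambda>h. y1 + h) \<in> ?C \<rightarrow> {y \<in> ?Y. ?P f y}"
        proof
          fix h assume h: "h \<in> ?C"
          have "- g + (y1 + h) \<in> H"
            by (rule coset_trans[OF subH y1(1)]) (use h in simp)
          moreover have "?P f (y1 + h)"
            using h y1(2) by (auto intro!: commutes_add intro: commutes_sym)
          ultimately show "y1 + h \<in> {y \<in> ?Y. ?P f y}" by simp
        qed
        show "(\<lambda>y. - y1 + y) \<in> {y \<in> ?Y. ?P f y} \<rightarrow> ?C"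
        proof
          fix y assume y: "y \<in> {y \<in> ?Y. ?P f y}"
          have "commutes (- y1 + y) (f s)" if "s \<in> carrier S" for s
            by (rule commutes_add_left) (use y y1(2) that in \<open>auto intro: commutes_sym\<close>)
          then show "- y1 + y \<in> ?C" using coset_diff[OF subH y1(1), of y] y by simp
        qed
      qed auto
      from bij_betw_same_card[OF this] show ?thesis using o by simp
    qed (simp only: card.empty mult_0_right dvd_0_right)
  qed
  then show ?thesis using eq by simp
qed

lemma sum_fixing_eq_sum_pair_count:
  "(\<Sum>y | - g + y \<in> H. card (Fixing y)) = (\<Sum>d | - nmul q g + d \<in> H. Pairs q d)"
proof -
  have "(\<Sum>d\<in>{d. - nmul q g + d \<in> H}. \<Sum>y\<in>{y \<in> {y. - g + y \<in> H}. nmul q y = d}. card (Fixing y))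
      = (\<Sum>y\<in>{y. - g + y \<in> H}. card (Fixing y))"
    by (rule sum.group) (use finite_coset coset_nmul[OF subH norm_g] in auto)
  then show ?thesis by (simp add: pair_count_def roots_def)
qed

text \<open>Each \<open>y\<close> with \<open>nmul (q * r) y = d\<close> is sorted by its multiple
  \<open>e = nmul r y\<close>.\<close>

lemma pair_count_mult:
  "Pairs (q * r) d = (\<Sum>e | - nmul r g + e \<in> H \<and> nmul q e = d. Pairs r e)"
proof -
  have "(\<Sum>e\<in>{e. - nmul r g + e \<in> H \<and> nmul q e = d}. \<Sum>y\<in>{y \<in> roots H g (q * r) d. nmul r y = e}. card (Fixing y))
      = (\<Sum>y\<in>roots H g (q * r) d. card (Fixing y))"
    by (rule sum.group)
      (use finite_roots[of "q * r" d] finite_subset[OF _ finite_coset[of "nmul r g"]] coset_nmul[OF subH norm_g]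
        in \<open>auto simp: roots_def nmul_mult\<close>)
  moreover have "{y \<in> roots H g (q * r) d. nmul r y = e} = roots H g r e" if "nmul q e = d" for e
    using that by (auto simp: roots_def nmul_mult)
  ultimately show ?thesis by (simp add: pair_count_def)
qed

lemma pair_count_conjg:
  assumes h: "h \<in> H"
  shows "Pairs q (conjg h d) = Pairs q d"
proof -
  have "roots H g q (conjg h d) = conjg h ` roots H g q d"
  proof (intro equalityI subsetI)
    fix y assume y: "y \<in> roots H g q (conjg h d)"
    have "conjg (- h) y \<in> roots H g q d"
      using y conjg_coset[OF subH norm_g, of "- h" y] h subH
      by (auto simp: roots_def add_subgroupD simp flip: conjg_nmul)
    then show "y \<in> conjg h ` roots H g q d" by (intro image_eqI[of _ _ "conjg (- h) y"]) auto
  next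
    fix y assume "y \<in> conjg h ` roots H g q d"
    then show "y \<in> roots H g q (conjg h d)"
      using conjg_coset[OF subH norm_g h] by (auto simp: roots_def simp flip: conjg_nmul)
  qed
  moreover have "inj_on (conjg h) (roots H g q d)" by (simp add: inj_on_def)
  ultimately show ?thesis
    unfolding pair_count_def by (simp add: sum.reindex card_fixing_conjg[OF h])
qed

text \<open>If \<open>nmul q y = d\<close>, whatever commutes with \<open>y\<close> commutes with
  \<open>d\<close>. So all pairs with value \<open>d\<close> live over the centralizer of
  \<open>d\<close>, and one of them can replace \<open>f0\<close> and \<open>g\<close>. For
  noncentral \<open>d\<close> this is the descent to a smaller group, all of whose elements commute
  with \<open>d\<close>.\<close>

lemma twisted_centralizer:
  assumes y1: "y1 \<in> roots H g q d" and f1: "f1 \<in> Fixing y1"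
  shows "twisted S p (centralizer H d) f1 y1"
    and "Pairs q d = pair_count S (centralizer H d) f1 y1 q d"
proof -
  have d: "d = nmul q y1" using y1 by (simp add: roots_def)
  have c1: "commutes y1 d" unfolding d by (rule commutes_nmul) simp
  have c2: "commutes (f1 s) d" if "s \<in> carrier S" for s
    unfolding d using f1 that by (auto intro!: commutes_nmul simp: fixing_def)
  have n1: "normalizes (f1 s) H" if "s \<in> carrier S" for s
    using normalizes_coset[OF subH norm[OF that]] f1 that by (auto simp: fixing_def sections_def)
  have n2: "normalizes y1 H"
    using normalizes_coset[OF subH norm_g] y1 by (auto simp: roots_def)
  show "twisted S p (centralizer H d) f1 y1"
    using finite_S prime p_subgroup_centralizer[OF p_sub prime] f1 normalizes_centralizer n1 n2 c1 c2
    by unfold_locales (auto simp: fixing_def sections_def)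
  have r: "roots H g q d = roots (centralizer H d) y1 q d"
  proof (intro equalityI subsetI)
    fix y assume y: "y \<in> roots H g q d"
    then have "commutes y d" by (auto simp: roots_def intro!: commutes_nmul)
    then show "y \<in> roots (centralizer H d) y1 q d"
      using y y1 c1 coset_diff[OF subH, of g y1 y]
      by (auto simp: roots_def centralizer_def intro!: commutes_add_left)
  next
    fix y assume "y \<in> roots (centralizer H d) y1 q d"
    then show "y \<in> roots H g q d"
      using y1 coset_trans[OF subH, of g y1 y] by (auto simp: roots_def centralizer_def)
  qed
  have f: "Fixing y = fixing S (centralizer H d) f1 y" if y: "y \<in> roots H g q d" for y
  proof (intro equalityI subsetI)
    fix f assume f: "f \<in> Fixing y"
    have "commutes (f s) d" if "s \<in> carrier S" for s
      using f y that by (auto simp: fixing_def roots_def intro!: commutes_nmul)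
    moreover have "- f1 s + f s \<in> H" if "s \<in> carrier S" for s
      by (rule coset_diff[OF subH, of "f0 s"]) (use that f f1 in \<open>auto simp: fixing_def sections_def\<close>)
    ultimately show "f \<in> fixing S (centralizer H d) f1 y"
      using f f1 c2 by (auto simp: fixing_def sections_def centralizer_def intro!: commutes_add_left)
  next
    fix f assume f: "f \<in> fixing S (centralizer H d) f1 y"
    have "- f0 s + f s \<in> H" if "s \<in> carrier S" for s
      by (rule coset_trans[OF subH, of _ "f1 s"])
        (use that f f1 in \<open>auto simp: fixing_def sections_def centralizer_def\<close>)
    then show "f \<in> Fixing y"
      using f by (auto simp: fixing_def sections_def)
  qed
  show "Pairs q d = pair_count S (centralizer H d) f1 y1 q d"
    unfolding pair_count_def using f r by simp
qed

section \<open>Central and noncentral values of \<open>nmul q y\<close>\<close>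

lemma pair_count_nonzero:
  assumes "Pairs q d \<noteq> 0"
  obtains y f where "y \<in> roots H g q d" "f \<in> Fixing y"
proof -
  from assms obtain y where y: "y \<in> roots H g q d" "card (Fixing y) \<noteq> 0"
    unfolding pair_count_def by (meson sum.neutral)
  then obtain f where "f \<in> Fixing y" by (metis card.empty ex_in_conv)
  then show ?thesis using that y by blast
qed

text \<open>The part of the centre of \<open>H\<close> that the twist leaves fixed. Adding such an
  element to \<open>y\<close> changes neither the sections that commute with \<open>y\<close> nor
  the centralizer of \<open>y\<close> in \<open>H\<close>.\<close>

definition "Z0 = {u \<in> H. (\<forall>h\<in>H. commutes u h) \<and> commutes u g \<and> (\<forall>s\<in>carrier S. commutes u (f0 s))}"

lemma subgroup_Z0: "add_subgroup Z0"
  using subH by (auto simp: Z0_def add_subgroup_def intro: commutes_add_left)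

lemma centralizer_eq_iff: "centralizer H d = H \<longleftrightarrow> (\<forall>h\<in>H. commutes d h)"
  by (auto simp: centralizer_def intro: commutes_sym)

text \<open>A pair with value \<open>d\<close> forces \<open>d\<close> to commute with
  \<open>y\<close> and with all \<open>f s\<close>. Since \<open>d\<close> also commutes with
  \<open>H\<close>, it commutes with their whole cosets, in particular with \<open>g\<close> and
  \<open>f0 s\<close>.\<close>

lemma central_root_commutes:
  assumes c: "centralizer H d = H" and nz: "Pairs q d \<noteq> 0"
  shows "commutes d g" and "s \<in> carrier S \<Longrightarrow> commutes d (f0 s)"
proof -
  obtain y f where y: "y \<in> roots H g q d" and f: "f \<in> Fixing y"
    using nz by (rule pair_count_nonzero)
  have dH: "commutes d h" if "h \<in> H" for h using c that centralizer_eq_iff by blast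
  have dy: "commutes d y" using y by (auto simp: roots_def intro!: commutes_nmul_left)
  have "commutes d (y + - (- g + y))"
    using y dH dy by (intro commutes_add) (auto simp: roots_def simp del: minus_add)
  then show "commutes d g" by (simp add: minus_add add.assoc)
  assume s: "s \<in> carrier S"
  have "commutes d (f s)"
    using s f y by (auto simp: fixing_def roots_def intro!: commutes_nmul_left intro: commutes_sym)
  then have "commutes d (f s + - (- f0 s + f s))"
    using f s dH by (intro commutes_add) (auto simp: fixing_def sections_def simp del: minus_add)
  then show "commutes d (f0 s)" by (simp add: minus_add add.assoc)
qed

lemma dvd_sum_noncentral:
  assumes D: "finite D" "\<And>h d. h \<in> H \<Longrightarrow> d \<in> D \<Longrightarrow> conjg h d \<in> D"
    and dvd: "\<And>d. d \<in> D \<Longrightarrow> a dvd card ((\<lambda>h. conjg h d) ` H) * Pairs q d"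
  shows "a dvd (\<Sum>d\<in>D. Pairs q d)"
proof -
  interpret G: group "group_on H" by (rule group_group_on) (rule subH)
  show ?thesis
    by (rule G.dvd_sum_orbits[OF acts_on_conjg[OF subH D(2)] D(1)])
      (use pair_count_conjg dvd in auto)
qed

lemma centralizer_add_central:
  assumes "\<And>h. h \<in> H \<Longrightarrow> commutes u h"
  shows "centralizer H (u + y) = centralizer H y"
proof -
  have "commutes h (u + y) \<longleftrightarrow> commutes h y" if "h \<in> H" for h
  proof
    assume "commutes h (u + y)"
    then have "commutes h (- u + (u + y))"
      by - (rule commutes_add, use assms[OF that] in \<open>auto intro: commutes_sym\<close>)
    then show "commutes h y" by simp
  qed (use assms[OF that] in \<open>auto intro: commutes_add commutes_sym\<close>)
  then show ?thesis by (auto simp: centralizer_def)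
qed

lemma Z0_commutes_coset:
  assumes "u \<in> Z0" "- g + y \<in> H" shows "commutes u y"
proof -
  have "commutes u (g + (- g + y))"
    by (rule commutes_add) (use assms in \<open>auto simp: Z0_def\<close>)
  then show ?thesis by simp
qed

lemma Z0_commutes_sections:
  assumes "u \<in> Z0" "f \<in> Sections" "s \<in> carrier S" shows "commutes u (f s)"
proof -
  have "commutes u (f0 s + (- f0 s + f s))"
    by (rule commutes_add) (use assms in \<open>auto simp: Z0_def sections_def\<close>)
  then show ?thesis by simp
qed

lemma fixing_add_Z0:
  assumes "u \<in> Z0" shows "Fixing (u + y) = Fixing y"
proof -
  have "commutes (f s) (u + y) \<longleftrightarrow> commutes (f s) y" if "f \<in> Sections" "s \<in> carrier S" for f s
  proof -
    have u: "commutes (f s) u" using Z0_commutes_sections[OF assms that] by (rule commutes_sym)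
    show ?thesis
    proof
      assume "commutes (f s) (u + y)"
      then have "commutes (f s) (- u + (u + y))" by - (rule commutes_add, use u in auto)
      then show "commutes (f s) y" by simp
    qed (use u commutes_add in blast)
  qed
  then show ?thesis by (auto simp: fixing_def)
qed

text \<open>Two actions treat two kinds of roots: translation by a subgroup \<open>M\<close> of
  order \<open>q\<close> in \<open>Z0\<close>, and conjugation by \<open>H\<close>, which preserves
  the roots because \<open>d\<close> commutes with \<open>H\<close>.\<close>

lemma dvd_pair_count_large_Z0:
  assumes good: "good TYPE('e) p S Q" and Q: "Q = p ^ \<kappa>" and q: "q = p ^ a" "q dvd card Z0"
    and d: "d = nmul q g" "\<And>h. h \<in> H \<Longrightarrow> commutes h d"
  shows "gcd (q * Q) (card H) dvd Pairs q d"
proof -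
  have finZ: "finite Z0" using finite_H by (simp add: Z0_def)
  obtain M where M: "add_subgroup M" "M \<subseteq> Z0" "card M = q"
    using exists_subgroup_of_prime_power_order[OF subgroup_Z0 finZ prime] q by metis
  have MH: "M \<subseteq> H" using M(2) by (auto simp: Z0_def)
  have finM: "finite M" using M(2) finZ finite_subset by blast
  interpret M: group "group_on M" by (rule group_group_on) (rule M(1))
  interpret G: group "group_on H" by (rule group_group_on) (rule subH)
  let ?R = "roots H g q d" and ?c = "\<lambda>y. card (centralizer H y)" and ?f = "\<lambda>y. card (Fixing y)"
  \<comment> \<open>The roots are sorted by whether their centralizer is large enough for
    \<open>good\<close> to give the full factor \<open>Q\<close>.\<close>
  define Y1 where "Y1 = {y \<in> ?R. Q dvd ?c y}"
  define Y2 where "Y2 = {y \<in> ?R. \<not> Q dvd ?c y}"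
  have shift: "u + y \<in> ?R" if "u \<in> M" "y \<in> ?R" for u y
  proof -
    have c: "commutes u y" using that M(2) Z0_commutes_coset by (auto simp: roots_def)
    have "nmul q u = 0" using nmul_card_eq_0[OF M(1) finM that(1)] M(3) by simp
    moreover have "- g + (u + y) \<in> H"
    proof -
      have "- g + (u + y) = (- g + y) + u" using c by (simp add: commutes_def add.assoc)
      then show ?thesis using that MH subH by (auto simp: roots_def add_subgroupD)
    qed
    ultimately show ?thesis using that(2) nmul_add_commutes[OF c, of q] by (simp add: roots_def)
  qed
  have cent: "centralizer H (u + y) = centralizer H y" if "u \<in> M" for u y
    using that M(2) by (intro centralizer_add_central) (auto simp: Z0_def)
  \<comment> \<open>Elements of \<open>M\<close> are killed by \<open>q\<close>, so adding them
    permutes the roots freely and supplies the factor \<open>q\<close> on top of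
    \<open>Q\<close>.\<close>
  have "q * Q dvd (\<Sum>y\<in>Y1. ?f y)"
  proof (rule M.dvd_sum_orbits[where act = "(+)"])
    show "acts_on (group_on M) (+) Y1"
      using shift cent by (intro acts_onI) (auto simp: Y1_def add.assoc)
    show "finite Y1" using finite_roots by (simp add: Y1_def)
    show "?f (u + y) = ?f y" if "u \<in> carrier (group_on M)" for u y
      using that M(2) fixing_add_Z0[of u y] by (simp add: subset_iff)
    fix y assume y: "y \<in> Y1"
    have "card ((\<lambda>u. u + y) ` carrier (group_on M)) = q"
      using M(3) by (simp add: card_image inj_on_def)
    moreover have "Q dvd ?f y"
      using gcd_dvd_fixing[OF good, of y] y by (simp add: Y1_def gcd_nat.absorb1)
    ultimately show "q * Q dvd card ((\<lambda>u. u + y) ` carrier (group_on M)) * ?f y" by simp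
  qed
  \<comment> \<open>Here the order of the centralizer of \<open>y\<close> divides \<open>Q\<close>,
    hence divides the weight of \<open>y\<close>; multiplied by the length of the conjugacy class it
    gives all of \<open>card H\<close>.\<close>
  moreover have "card H dvd (\<Sum>y\<in>Y2. ?f y)"
  proof (rule G.dvd_sum_orbits)
    have cH: "?c (conjg h y) = ?c y" if "h \<in> H" for h y
    proof -
      have "(\<lambda>k. conjg k (conjg h y)) ` H = (\<lambda>k. conjg k y) ` H"
        using G.orbit_eq[of conjg UNIV y h] that acts_on_conjg[OF subH] by simp
      then show ?thesis
        using conjg_orbit_stabilizer[OF subH finite_H, of y] conjg_orbit_stabilizer[OF subH finite_H, of "conjg h y"]
          finite_H subH by (metis add_subgroupD(1) card_gt_0_iff empty_iff less_not_refl mult_left_cancel mult_0)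
    qed
    show "acts_on (group_on H) conjg Y2"
    proof (rule acts_on_conjg[OF subH])
      fix h y assume h: "h \<in> H" and y: "y \<in> Y2"
      have "conjg h d = d" using d(2)[OF h] by (simp add: conjg_eq_self_iff)
      then show "conjg h y \<in> Y2"
        using h y conjg_coset[OF subH norm_g h] cH[OF h] by (auto simp: Y2_def roots_def simp flip: conjg_nmul)
    qed
    show "finite Y2" using finite_roots by (simp add: Y2_def)
    show "?f (conjg h y) = ?f y" if "h \<in> carrier (group_on H)" for h y
      using that card_fixing_conjg by simp
    fix y assume y: "y \<in> Y2"
    obtain k where k: "?c y = p ^ k" using p_subgroup_centralizer[OF p_sub prime] p_subgroupD(3) by blast
    have "?c y dvd Q"
    proof (cases "k \<le> \<kappa>")
      case False
      then have "Q dvd ?c y" unfolding Q k by (intro le_imp_power_dvd) simp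
      then show ?thesis using y by (simp add: Y2_def)
    qed (simp add: Q k le_imp_power_dvd)
    then have "?c y dvd ?f y"
      using gcd_dvd_fixing[OF good, of y] by (simp add: gcd_nat.absorb2)
    then show "card H dvd card ((\<lambda>h. conjg h y) ` carrier (group_on H)) * ?f y"
      unfolding conjg_orbit_stabilizer[OF subH finite_H, of y, symmetric] by (simp add: mult_dvd_mono)
  qed
  moreover have "Pairs q d = (\<Sum>y\<in>Y1. ?f y) + (\<Sum>y\<in>Y2. ?f y)"
    unfolding pair_count_def Y1_def Y2_def by (rule sum_split[OF finite_roots])
  ultimately show ?thesis using dvd_add dvd_trans[OF gcd_dvd1] dvd_trans[OF gcd_dvd2] by metis
qed

lemma dvd_sum_pair_count:
  "card H dvd (\<Sum>d | - nmul q g + d \<in> H. Pairs q d)"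
  using card_dvd_sum_fixing sum_fixing_eq_sum_pair_count by metis

text \<open>The induction hypothesis covers only values that commute with the whole subgroup;
  passing to the centralizer of \<open>d\<close> brings about this situation. The class length is
  kept as a factor on both sides, since \<open>dvd_pair_count_Z0_prime_order\<close> exploits that
  it is divisible by \<open>p\<close>.\<close>

lemma dvd_orbit_pair_count:
  assumes IH: "\<And>(H' :: 'e set) f1 g1. twisted S p H' f1 g1 \<Longrightarrow> card H' < card H \<Longrightarrow>
      (\<And>h. h \<in> H' \<Longrightarrow> commutes h (nmul q g1)) \<Longrightarrow> gcd a (card H') dvd pair_count S H' f1 g1 q (nmul q g1)"
    and d: "centralizer H d \<noteq> H"
  shows "card ((\<lambda>h. conjg h d) ` H) * gcd a (card (centralizer H d)) dvd
     card ((\<lambda>h. conjg h d) ` H) * Pairs q d"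
proof (cases "Pairs q d = 0")
  case False
  then obtain y f where y: "y \<in> roots H g q d" "f \<in> Fixing y" by (rule pair_count_nonzero)
  have lt: "card (centralizer H d) < card H"
    by (rule psubset_card_mono[OF finite_H]) (use d centralizer_subset in blast)
  have dy: "nmul q y = d" using y by (simp add: roots_def)
  have "gcd a (card (centralizer H d)) dvd pair_count S (centralizer H d) f y q (nmul q y)"
    by (rule IH[OF twisted_centralizer(1)[OF y] lt]) (simp add: dy centralizer_def)
  then show ?thesis unfolding twisted_centralizer(2)[OF y] dy by (rule mult_dvd_mono[OF dvd_refl])
qed simp

lemma conjg_coset_nmul:
  "h \<in> H \<Longrightarrow> - nmul q g + d \<in> H \<Longrightarrow> - nmul q g + conjg h d \<in> H"
  using conjg_coset[OF subH normalizes_nmul[OF norm_g]] .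

lemma centralizer_conjg_eq_iff:
  assumes "h \<in> H" shows "centralizer H (conjg h d) = H \<longleftrightarrow> centralizer H d = H"
proof -
  have *: "\<forall>k\<in>H. commutes (conjg h d) k" if "h \<in> H" "\<forall>k\<in>H. commutes d k" for h d
  proof -
    have "conjg h d = d" using that by (auto simp: conjg_eq_self_iff intro: commutes_sym)
    then show ?thesis using that by simp
  qed
  show ?thesis
    using *[OF assms, of d] *[of "- h" "conjg h d"] assms subH
    unfolding centralizer_eq_iff by (auto simp: add_subgroupD)
qed

text \<open>The sum over all \<open>d\<close> is divisible by \<open>card H\<close> and the
  noncentral classes are covered by the induction hypothesis, so the sum over the central
  \<open>d\<close> is what remains.\<close>

lemma dvd_sum_central:
  assumes IH: "\<And>(H' :: 'e set) f1 g1. twisted S p H' f1 g1 \<Longrightarrow> card H' < card H \<Longrightarrow>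
      (\<And>h. h \<in> H' \<Longrightarrow> commutes h (nmul q g1)) \<Longrightarrow> gcd a (card H') dvd pair_count S H' f1 g1 q (nmul q g1)"
  shows "gcd a (card H) dvd (\<Sum>d | - nmul q g + d \<in> H \<and> centralizer H d = H. Pairs q d)"
proof -
  let ?D = "{d. - nmul q g + d \<in> H}"
  have "gcd a (card H) dvd (\<Sum>d\<in>{d \<in> ?D. centralizer H d \<noteq> H}. Pairs q d)"
  proof (rule dvd_sum_noncentral)
    fix d assume d: "d \<in> {d \<in> ?D. centralizer H d \<noteq> H}"
    show "gcd a (card H) dvd card ((\<lambda>h. conjg h d) ` H) * Pairs q d"
      by (rule dvd_trans[OF gcd_dvd_index_mult_gcd[OF conjg_orbit_stabilizer[OF subH finite_H, of d]]
            dvd_orbit_pair_count[OF IH]]) (use d in auto)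
  qed (use finite_coset[of "nmul q g"] conjg_coset_nmul[of _ q] centralizer_conjg_eq_iff in auto)
  moreover have "gcd a (card H) dvd (\<Sum>d\<in>?D. Pairs q d)"
    by (rule dvd_trans[OF gcd_dvd2 dvd_sum_pair_count])
  ultimately have "gcd a (card H) dvd (\<Sum>d\<in>{d \<in> ?D. \<not> centralizer H d \<noteq> H}. Pairs q d)"
    unfolding sum_split[OF finite_coset, of _ _ "\<lambda>d. centralizer H d \<noteq> H"] by (simp only: dvd_add_right_iff)
  then show ?thesis by simp
qed

lemma central_diff_in_Z0:
  assumes d: "- a + d \<in> H" "centralizer H d = H" "commutes d g" "\<And>s. s \<in> carrier S \<Longrightarrow> commutes d (f0 s)"
    and e: "- a + e \<in> H" "centralizer H e = H" "commutes e g" "\<And>s. s \<in> carrier S \<Longrightarrow> commutes e (f0 s)"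
  shows "- d + e \<in> Z0"
  using d e coset_diff[OF subH d(1) e(1)] unfolding Z0_def centralizer_eq_iff
  by (auto intro!: commutes_add_left)

text \<open>A central value with a nonzero count differs from \<open>nmul q g\<close> by an element
  of \<open>Z0\<close>, hence equals it. The sum over the central values thus has only one
  term.\<close>

lemma dvd_pair_count_trivial_Z0:
  assumes IH: "\<And>(H' :: 'e set) f1 g1. twisted S p H' f1 g1 \<Longrightarrow> card H' < card H \<Longrightarrow>
      (\<And>h. h \<in> H' \<Longrightarrow> commutes h (nmul q g1)) \<Longrightarrow> gcd a (card H') dvd pair_count S H' f1 g1 q (nmul q g1)"
    and d: "\<And>h. h \<in> H \<Longrightarrow> commutes h (nmul q g)" and Z0: "Z0 = {0}"
  shows "gcd a (card H) dvd Pairs q (nmul q g)"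
proof -
  let ?d = "nmul q g" and ?C = "{d. - nmul q g + d \<in> H \<and> centralizer H d = H}"
  have cd: "centralizer H ?d = H" using d by (auto simp: centralizer_def)
  have dC: "?d \<in> ?C" using cd subH by (simp add: add_subgroupD)
  have "Pairs q e = 0" if e: "e \<in> ?C - {?d}" for e
  proof (rule ccontr)
    assume nz: "Pairs q e \<noteq> 0"
    have "- ?d + e \<in> Z0"
      by (rule central_diff_in_Z0[of ?d])
        (use e cd dC central_root_commutes[OF _ nz] comm in \<open>auto intro!: commutes_nmul_left intro: commutes_sym\<close>)
    then have "?d = e" using Z0 by (simp add: neg_eq_iff_add_eq_0[symmetric])
    then show False using e by simp
  qed
  moreover have "finite ?C" using finite_subset[OF _ finite_coset[of ?d]] by auto
  ultimately have "(\<Sum>d\<in>?C. Pairs q d) = Pairs q ?d"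
    using dC by (simp add: sum.remove[of ?C ?d])
  moreover have "gcd a (card H) dvd (\<Sum>d\<in>?C. Pairs q d)"
    by (rule dvd_sum_central) (blast intro: IH)
  ultimately show ?thesis by simp
qed

text \<open>Translation by \<open>Z0\<close> would give only a factor \<open>p\<close>. Instead, at
  most one central \<open>d\<close> can violate the divisibility; as the sum over all central
  \<open>d\<close> satisfies it, none does.\<close>

lemma dvd_pair_count_Z0_prime_order:
  assumes q: "q = p * p" and Q: "Q = p ^ \<kappa>"
    and IH: "\<And>(H' :: 'e set) f1 g1. twisted S p H' f1 g1 \<Longrightarrow> card H' < card H \<Longrightarrow>
      (\<And>h. h \<in> H' \<Longrightarrow> commutes h (nmul q g1)) \<Longrightarrow> gcd (q * Q) (card H') dvd pair_count S H' f1 g1 q (nmul q g1)"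
    and step: "\<And>(H' :: 'e set) f1 g1. twisted S p H' f1 g1 \<Longrightarrow>
      (\<And>h. h \<in> H' \<Longrightarrow> commutes h (nmul p g1)) \<Longrightarrow> gcd (p * Q) (card H') dvd pair_count S H' f1 g1 p (nmul p g1)"
    and d: "\<And>h. h \<in> H \<Longrightarrow> commutes h (nmul q g)" and Z0: "card Z0 = p"
  shows "gcd (q * Q) (card H) dvd Pairs q (nmul q g)"
proof -
  let ?a = "gcd (q * Q) (card H)" and ?n = "Pairs q"
  let ?C = "{d. - nmul q g + d \<in> H \<and> centralizer H d = H}"
  let ?E = "\<lambda>d. {e. - nmul p g + e \<in> H \<and> nmul p e = d}"
  have finZ: "finite Z0" using finite_H by (simp add: Z0_def)
  have finE: "finite (?E d)" for d using finite_subset[OF _ finite_coset[of "nmul p g"]] by auto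
  \<comment> \<open>A noncentral \<open>e\<close> has a class of length divisible by
    \<open>p\<close>, which raises the factor \<open>p * Q\<close> of \<open>step\<close> to
    \<open>q * Q\<close>.\<close>
  have noncentral: "?a dvd (\<Sum>e\<in>{e \<in> ?E d. centralizer H e \<noteq> H}. Pairs p e)" if d: "d \<in> ?C" for d
  proof (rule dvd_sum_noncentral)
    show "finite {e \<in> ?E d. centralizer H e \<noteq> H}" by (rule finite_subset[OF _ finE[of d]]) auto
    fix h e assume h: "h \<in> H" and e: "e \<in> {e \<in> ?E d. centralizer H e \<noteq> H}"
    have "conjg h d = d" using d h by (auto simp: conjg_eq_self_iff centralizer_def)
    then show "conjg h e \<in> {e \<in> ?E d. centralizer H e \<noteq> H}"
      using e h conjg_coset_nmul centralizer_conjg_eq_iff[OF h] by (auto simp flip: conjg_nmul)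
  next
    fix e assume e: "e \<in> {e \<in> ?E d. centralizer H e \<noteq> H}"
    let ?o = "card ((\<lambda>h. conjg h e) ` H)" and ?c = "card (centralizer H e)"
    have oc: "?o * ?c = card H" by (rule conjg_orbit_stabilizer[OF subH finite_H])
    obtain k where "card H = p ^ k" using p_subgroupD(3)[OF p_sub] by blast
    then obtain i where i: "?o = p ^ i"
      using oc prime by (metis divides_primepow_nat dvd_triv_left)
    have "?o \<noteq> 1"
    proof
      assume "?o = 1"
      then have "centralizer H e = H"
        using oc card_subset_eq[OF finite_H centralizer_subset] by simp
      then show False using e by simp
    qed
    then have po: "p dvd ?o" using i by (cases i) auto
    have "?o * gcd (p * Q) ?c dvd ?o * Pairs p e"
      by (rule dvd_orbit_pair_count) (use step e in auto)
    moreover have "?a dvd ?o * gcd (p * Q) ?c"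
    proof -
      have "?o * gcd (p * Q) ?c = gcd (?o * (p * Q)) (card H)" using oc by (simp add: gcd_mult_distrib_nat)
      moreover have "q * Q dvd ?o * (p * Q)" using po unfolding q mult.assoc by (intro mult_dvd_mono) auto
      ultimately show ?thesis by (metis dvd_refl gcd_mono)
    qed
    ultimately show "?a dvd ?o * Pairs p e" by (rule dvd_trans[rotated])
  qed
  \<comment> \<open>A central \<open>d\<close> that violates the divisibility must be the
    \<open>p\<close>-fold multiple of a central \<open>e\<close> that carries at least one
    pair.\<close>
  have central: "\<exists>e. e \<in> ?E d \<and> centralizer H e = H \<and> Pairs p e \<noteq> 0"
    if d: "d \<in> ?C" and nd: "\<not> ?a dvd ?n d" for d
  proof (rule ccontr)
    assume "\<not> ?thesis"
    then have z: "(\<Sum>e\<in>{e \<in> ?E d. \<not> centralizer H e \<noteq> H}. Pairs p e) = 0" by auto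
    have "?n d = (\<Sum>e\<in>?E d. Pairs p e)" unfolding q by (rule pair_count_mult)
    also have "\<dots> = (\<Sum>e\<in>{e \<in> ?E d. centralizer H e \<noteq> H}. Pairs p e)"
      unfolding sum_split[OF finE[of d], of _ "\<lambda>e. centralizer H e \<noteq> H"] z by simp
    finally show False using noncentral[OF d] nd by simp
  qed
  \<comment> \<open>Two such \<open>e\<close> differ by an element of \<open>Z0\<close>, which is
    killed by \<open>p\<close> because \<open>Z0\<close> has order \<open>p\<close>; so their
    \<open>p\<close>-fold multiples agree.\<close>
  have unique: "d1 = d2" if d1: "d1 \<in> ?C" "\<not> ?a dvd ?n d1" and d2: "d2 \<in> ?C" "\<not> ?a dvd ?n d2" for d1 d2
  proof -
    from central[OF d1] obtain e1 where e1: "e1 \<in> ?E d1" "centralizer H e1 = H" "Pairs p e1 \<noteq> 0" by blast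
    from central[OF d2] obtain e2 where e2: "e2 \<in> ?E d2" "centralizer H e2 = H" "Pairs p e2 \<noteq> 0" by blast
    have z: "- e1 + e2 \<in> Z0"
      by (rule central_diff_in_Z0[of "nmul p g"])
        (use e1 e2 central_root_commutes[OF e1(2,3)] central_root_commutes[OF e2(2,3)] in auto)
    have "commutes e1 (- e1 + e2)" using e1(2) z unfolding centralizer_eq_iff by (simp add: Z0_def)
    then have "nmul p (e1 + (- e1 + e2)) = nmul p e1 + nmul p (- e1 + e2)" by (rule nmul_add_commutes)
    moreover have "nmul p (- e1 + e2) = 0" using nmul_card_eq_0[OF subgroup_Z0 finZ z] Z0 by simp
    ultimately show ?thesis using e1(1) e2(1) by simp
  qed
  show ?thesis
  proof (rule ccontr)
    let ?d = "nmul q g"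
    assume nd: "\<not> ?a dvd ?n ?d"
    have dC: "?d \<in> ?C" using d subH by (auto simp: centralizer_def add_subgroupD)
    have finC: "finite ?C" using finite_subset[OF _ finite_coset[of ?d]] by auto
    have "?a dvd (\<Sum>e\<in>?C - {?d}. ?n e)"
      by (rule dvd_sum) (use unique[OF dC nd] in blast)
    moreover have "?a dvd (\<Sum>e\<in>?C. ?n e)"
      by (rule dvd_sum_central) (blast intro: IH)
    ultimately show False using nd unfolding sum.remove[OF finC dC, of ?n] by (simp only: dvd_add_left_iff)
  qed
qed

end

text \<open>Induction on \<open>card H\<close>, first for \<open>p\<close> and then for
  \<open>p * p\<close>, where the first result serves as \<open>step\<close>. The cases are given by
  the order of \<open>Z0\<close>: trivial, divisible by \<open>q\<close>, or equal to
  \<open>p\<close> when \<open>q = p * p\<close>.\<close>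

theorem dvd_pair_count:
  assumes "twisted S p H f0 g" and good: "good TYPE('e::group_add) p S Q" and Q: "Q = p ^ \<kappa>"
    and q: "q = p \<or> q = p * p" and "\<And>h. h \<in> (H :: 'e set) \<Longrightarrow> commutes h (nmul q g)"
  shows "gcd (q * Q) (card H) dvd pair_count S H f0 g q (nmul q g)"
proof -
  have "prime p" using assms(1) by (simp add: twisted_def twisted_axioms_def)
  have p: "gcd (p * Q) (card H) dvd pair_count S H f0 g p (nmul p g)"
    if "twisted S p H f0 g" "\<And>h. h \<in> H \<Longrightarrow> commutes h (nmul p g)" for H f0 and g :: 'e
    using that
  proof (induction "card H" arbitrary: H f0 g rule: less_induct)
    case less
    interpret twisted S p H f0 g by (rule less.prems(1))
    have IH: "gcd (p * Q) (card H') dvd pair_count S H' f1 g1 p (nmul p g1)"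
      if "twisted S p H' f1 g1" "card H' < card H" "\<And>h. h \<in> H' \<Longrightarrow> commutes h (nmul p g1)" for H' f1 and g1 :: 'e
      using less.hyps[OF that(2,1)] that(3) by blast
    obtain k where k: "card Z0 = p ^ k"
      using p_subgroupD(3)[OF p_subgroup_subset[OF p_sub prime subgroup_Z0]] by (auto simp: Z0_def)
    show ?case
    proof (cases "k = 0")
      case True
      then have "Z0 = {0}" using k add_subgroupD(1)[OF subgroup_Z0] by (auto simp: card_1_singleton_iff)
      from dvd_pair_count_trivial_Z0[OF IH less.prems(2) this] show ?thesis by blast
    next
      case False
      show ?thesis
        by (rule dvd_pair_count_large_Z0[OF good Q, where a = 1]) (use k False less.prems(2) in auto)
    qed
  qed
  have pp: "gcd (p * p * Q) (card H) dvd pair_count S H f0 g (p * p) (nmul (p * p) g)"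
    if "twisted S p H f0 g" "\<And>h. h \<in> H \<Longrightarrow> commutes h (nmul (p * p) g)" for H f0 and g :: 'e
    using that
  proof (induction "card H" arbitrary: H f0 g rule: less_induct)
    case less
    interpret twisted S p H f0 g by (rule less.prems(1))
    have IH: "gcd (p * p * Q) (card H') dvd pair_count S H' f1 g1 (p * p) (nmul (p * p) g1)"
      if "twisted S p H' f1 g1" "card H' < card H" "\<And>h. h \<in> H' \<Longrightarrow> commutes h (nmul (p * p) g1)" for H' f1 and g1 :: 'e
      using less.hyps[OF that(2,1)] that(3) by blast
    obtain k where k: "card Z0 = p ^ k"
      using p_subgroupD(3)[OF p_subgroup_subset[OF p_sub prime subgroup_Z0]] by (auto simp: Z0_def)
    consider "k = 0" | "k = 1" | "2 \<le> k" by linarith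
    then show ?case
    proof cases
      case 1
      then have "Z0 = {0}" using k add_subgroupD(1)[OF subgroup_Z0] by (auto simp: card_1_singleton_iff)
      from dvd_pair_count_trivial_Z0[OF IH less.prems(2) this] show ?thesis by blast
    next
      case 2
      show ?thesis
        by (rule dvd_pair_count_Z0_prime_order[OF refl Q IH p less.prems(2)]) (use k 2 in auto)
    next
      case 3
      then have "p * p dvd card Z0" using k by (metis le_imp_power_dvd power2_eq_square)
      then show ?thesis
        by (intro dvd_pair_count_large_Z0[OF good Q, where a = 2]) (use less.prems(2) in \<open>auto simp: power2_eq_square\<close>)
    qed
  qed
  show ?thesis
    using q
  proof
    assume "q = p" with p[OF assms(1)] assms(5) show ?thesis by simp
  next
    assume "q = p * p" with pp[OF assms(1)] assms(5) show ?thesis by simp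
  qed
qed

section \<open>The upper $p$-central series\<close>

definition coset_rel :: "'e::group_add set \<Rightarrow> 'e \<Rightarrow> 'e \<Rightarrow> bool" where
  "coset_rel K x y \<longleftrightarrow> - x + y \<in> K"

lemma nmul_minus: "nmul n (- x) = - nmul n x"
proof (induction n)
  case (Suc n)
  have "commutes x (nmul n x)" by (simp add: commutes_nmul)
  then have "- (x + nmul n x) = - (nmul n x + x)" by (simp add: commutes_def)
  then show ?case using Suc by (simp add: minus_add del: add_uminus_conv_diff)
qed simp

text \<open>Calculation modulo \<open>K\<close> on elements of \<open>R\<close>, where
  \<open>coset_rel\<close> is a congruence, without forming a quotient.\<close>

locale normal_pair =
  fixes R K :: "'e::group_add set"
  assumes R: "add_subgroup R" and K: "add_subgroup K"
    and norm: "\<And>r k. r \<in> R \<Longrightarrow> k \<in> K \<Longrightarrow> conjg r k \<in> K"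
begin

lemma coset_rel_refl [simp]: "coset_rel K x x"
  using K by (simp add: coset_rel_def add_subgroupD)

lemma coset_rel_sym: "coset_rel K x y \<Longrightarrow> coset_rel K y x"
  using K coset_diff[OF K, of x y x] by (simp add: coset_rel_def add_subgroupD)

lemma coset_rel_trans: "coset_rel K x y \<Longrightarrow> coset_rel K y z \<Longrightarrow> coset_rel K x z"
  unfolding coset_rel_def by (rule coset_trans[OF K])

lemma coset_rel_add:
  assumes "coset_rel K x x'" "coset_rel K y y'" "y \<in> R"
  shows "coset_rel K (x + y) (x' + y')"
proof -
  have "- (x + y) + (x' + y') = conjg (- y) (- x + x') + (- y + y')"
    by (simp add: conjg_unfold del: add_uminus_conv_diff)
  then show ?thesis
    using assms norm R K unfolding coset_rel_def by (metis add_subgroupD(2,3))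
qed

lemma coset_rel_minus:
  assumes "coset_rel K x y" "y \<in> R" shows "coset_rel K (- x) (- y)"
proof -
  have "- (- x) + - y = conjg y (- (- x + y))"
    by (simp add: conjg_unfold del: add_uminus_conv_diff)
  then show ?thesis
    using assms norm R K unfolding coset_rel_def by (metis add_subgroupD(3))
qed

lemma coset_rel_mem_iff: "coset_rel K x y \<Longrightarrow> x \<in> K \<longleftrightarrow> y \<in> K"
proof -
  assume r: "coset_rel K x y"
  have "y = x + (- x + y)" "x = y + - (- x + y)" by (simp_all add: minus_add add.assoc)
  then show ?thesis using r K unfolding coset_rel_def by (metis add_subgroupD(2,3))
qed

lemma coset_rel_nmul_add:
  assumes x: "x \<in> R" and y: "y \<in> R" and c: "coset_rel K (x + y) (y + x)"
  shows "coset_rel K (nmul n (x + y)) (nmul n x + nmul n y)"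
proof (induction n)
  case (Suc n)
  \<comment> \<open>Modulo \<open>K\<close>, \<open>y\<close> commutes with every multiple of
    \<open>x\<close> and not only with \<open>x\<close>.\<close>
  have com: "coset_rel K (y + nmul m x) (nmul m x + y)" for m
  proof (induction m)
    case (Suc m)
    have m: "nmul m x \<in> R" using R x nmul_mem by blast
    have "coset_rel K (y + x + nmul m x) (x + y + nmul m x)"
      by (rule coset_rel_add) (use coset_rel_sym[OF c] m in auto)
    moreover have "coset_rel K (x + (y + nmul m x)) (x + (nmul m x + y))"
      by (rule coset_rel_add) (use Suc m y R in \<open>auto simp: add_subgroupD\<close>)
    ultimately have "coset_rel K (y + (x + nmul m x)) (x + (nmul m x + y))"
      unfolding add.assoc by (rule coset_rel_trans)
    then show ?case by (simp add: add.assoc)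
  qed simp
  have n: "nmul n x \<in> R" "nmul n y \<in> R" "nmul n (x + y) \<in> R"
    using R x y nmul_mem add_subgroupD(2) by blast+
  have "coset_rel K ((x + y) + nmul n (x + y)) ((x + y) + (nmul n x + nmul n y))"
    by (rule coset_rel_add) (use Suc n in auto)
  moreover have "coset_rel K (x + ((y + nmul n x) + nmul n y)) (x + ((nmul n x + y) + nmul n y))"
    by (intro coset_rel_add com coset_rel_refl) (use n y R in \<open>auto simp: add_subgroupD\<close>)
  ultimately have "coset_rel K (x + (y + nmul n (x + y))) (x + (nmul n x + (y + nmul n y)))"
    unfolding add.assoc by (rule coset_rel_trans)
  then show ?case by (simp add: add.assoc)
qed simp

lemma conjg_image: "r \<in> R \<Longrightarrow> conjg r ` K = K"
proof
  assume r: "r \<in> R"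
  show "conjg r ` K \<subseteq> K" using norm r by blast
  show "K \<subseteq> conjg r ` K"
  proof
    fix k assume "k \<in> K"
    then have "conjg (- r) k \<in> K" using norm R r by (simp add: add_subgroupD)
    then show "k \<in> conjg r ` K" by (intro image_eqI[of _ _ "conjg (- r) k"]) auto
  qed
qed

end

text \<open>Modulo one term, the next consists of the elements killed by \<open>p\<close> and
  centralized by all of \<open>R\<close>. Demanding this for \<open>R\<close> and not just for
  \<open>H\<close> is what allows arbitrary \<open>x \<in> R\<close> in
  \<open>nmul_shift\<close>.\<close>

primrec p_series :: "nat \<Rightarrow> 'e::group_add set \<Rightarrow> 'e set \<Rightarrow> nat \<Rightarrow> 'e set" where
  "p_series p R H 0 = {0}"
| "p_series p R H (Suc i) =
     {x \<in> H. nmul p x \<in> p_series p R H i \<and> (\<forall>r\<in>R. coset_rel (p_series p R H i) x (conjg r x))}"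

locale p_normal =
  fixes p :: nat and R H :: "'e::group_add set"
  assumes R: "add_subgroup R" and H: "add_subgroup H" and HR: "H \<subseteq> R"
    and norm_H: "\<And>r h. r \<in> R \<Longrightarrow> h \<in> H \<Longrightarrow> conjg r h \<in> H"
begin

abbreviation "series \<equiv> p_series p R H"

text \<open>Proved together, because invariance of the next term under conjugation uses that it
  contains the current one. For closure under addition: as \<open>H\<close> lies in
  \<open>R\<close>, elements of the next term commute modulo the current one, so
  \<open>nmul p\<close> is additive on them modulo it.\<close>

lemma p_series_normal:
  shows "normal_pair R (series i)" and "series i \<subseteq> H" and "series i \<subseteq> series (Suc i)"
proof (induction i)
  case 0
  case 1 show ?case using R by unfold_locales (auto simp: add_subgroup_def)
  case 2 show ?case using H by (simp add: add_subgroupD)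
  case 3 show ?case using H by (simp add: add_subgroupD coset_rel_def)
next
  case (Suc i)
  let ?K = "series i" and ?L = "series (Suc i)"
  interpret normal_pair R ?K by (rule Suc.IH(1))
  case 2 show ?case by auto
  have sub: "add_subgroup ?L"
    unfolding add_subgroup_def
  proof (intro conjI ballI)
    show "0 \<in> ?L" using H K by (simp add: add_subgroupD)
    fix x assume x: "x \<in> ?L"
    have xR: "x \<in> R" using x HR by auto
    have cR: "conjg r x \<in> R" if "r \<in> R" for r
      using x norm_H[OF that] HR by auto
    show "- x \<in> ?L"
      using x H K coset_rel_minus[OF _ cR] by (auto simp: add_subgroupD nmul_minus)
    fix y assume y: "y \<in> ?L"
    have yR: "y \<in> R" using y HR by auto
    have "coset_rel ?K x (conjg y x)" using x yR by auto
    then have "coset_rel ?K (x + y) (conjg y x + y)" by (rule coset_rel_add) (use yR in auto)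
    then have "coset_rel ?K (x + y) (y + x)"
      by (simp add: conjg_def add.assoc)
    then have "coset_rel ?K (nmul p (x + y)) (nmul p x + nmul p y)"
      by (rule coset_rel_nmul_add[OF xR yR])
    moreover have "nmul p x + nmul p y \<in> ?K" using x y K by (auto simp: add_subgroupD)
    ultimately have "nmul p (x + y) \<in> ?K" using coset_rel_mem_iff by blast
    moreover have "coset_rel ?K (x + y) (conjg r (x + y))" if "r \<in> R" for r
      unfolding conjg_simps by (rule coset_rel_add) (use x y that yR in auto)
    ultimately show "x + y \<in> ?L" using x y H by (auto simp: add_subgroupD)
  qed
  case 1 show ?case
  proof
    fix r x assume r: "r \<in> R" and x: "x \<in> ?L"
    have "- x + conjg r x \<in> ?L" using x r Suc.IH(3) by (auto simp: coset_rel_def)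
    then have "x + (- x + conjg r x) \<in> ?L" using x sub add_subgroupD(2) by blast
    then show "conjg r x \<in> ?L" by (simp only: add_minus_cancel)
  qed (use R sub in auto)
  case 3
  show ?case
  proof
    fix x assume x: "x \<in> ?L"
    then have "x \<in> H" "nmul p x \<in> ?L" "\<forall>r\<in>R. coset_rel ?L x (conjg r x)"
      using Suc.IH(3) by (auto simp: coset_rel_def)
    then show "x \<in> series (Suc (Suc i))" by (subst p_series.simps) blast
  qed
qed

text \<open>Multiplication by \<open>p\<close> pushes the perturbation \<open>k\<close> one term
  down: \<open>nmul p (x + k)\<close> and \<open>nmul p x\<close> differ by an element of the
  preceding term. After \<open>i\<close> steps the perturbation has disappeared.\<close>

lemma nmul_shift:
  assumes "x \<in> R" "k \<in> series i" shows "nmul (p ^ i) (x + k) = nmul (p ^ i) x"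
  using assms
proof (induction i arbitrary: x k)
  case (Suc i)
  let ?K = "series i"
  interpret normal_pair R ?K by (rule p_series_normal(1))
  have k: "k \<in> R" "nmul p k \<in> ?K" "coset_rel ?K k (conjg x k)"
    using Suc.prems(2) HR Suc.prems(1) unfolding p_series.simps by blast+
  have "coset_rel ?K (k + x) (conjg x k + x)"
    by (rule coset_rel_add) (use k Suc.prems in auto)
  then have "coset_rel ?K (k + x) (x + k)" by (simp add: conjg_def add.assoc)
  then have "coset_rel ?K (x + k) (k + x)" by (rule coset_rel_sym)
  then have "coset_rel ?K (nmul p (x + k)) (nmul p x + nmul p k)"
    by (rule coset_rel_nmul_add[OF Suc.prems(1) k(1)])
  moreover have "coset_rel ?K (nmul p x + nmul p k) (nmul p x)"
  proof -
    have "- (nmul p x + nmul p k) + nmul p x = - nmul p k"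
      by (simp add: minus_add add.assoc diff_conv_add_uminus del: add_uminus_conv_diff)
    then show ?thesis using k(2) K unfolding coset_rel_def by (simp only: add_subgroupD)
  qed
  ultimately have "coset_rel ?K (nmul p x) (nmul p (x + k))"
    by (rule coset_rel_sym[OF coset_rel_trans])
  then have m: "- nmul p x + nmul p (x + k) \<in> ?K" by (simp add: coset_rel_def)
  have "nmul p x \<in> R" using R Suc.prems(1) nmul_mem by blast
  from Suc.IH[OF this m] have "nmul (p ^ i) (nmul p (x + k)) = nmul (p ^ i) (nmul p x)" by simp
  then show ?case by (simp add: nmul_mult mult.commute[of p])
qed simp

end

section \<open>Growth of the series and roots in a coset\<close>

lemma homs0_add: "f \<in> homs0 S \<Longrightarrow> s \<in> carrier S \<Longrightarrow> t \<in> carrier S \<Longrightarrow> f (s \<otimes>\<^bsub>S\<^esub> t) = f s + f t"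
  by (simp add: homs0_def)

lemma (in group) homs0_one: "f \<in> homs0 G \<Longrightarrow> f \<one> = 0"
  by (metis add.right_neutral add_left_cancel homs0_add l_one one_closed)

lemma (in group) homs0_inv: "f \<in> homs0 G \<Longrightarrow> s \<in> carrier G \<Longrightarrow> f (inv s) = - f s"
  using homs0_add[of f G "inv s" s] homs0_one[of f] by (simp add: eq_neg_iff_add_eq_0)

lemma exists_other: "a \<in> A \<Longrightarrow> A \<noteq> {a} \<Longrightarrow> \<exists>c\<in>A. c \<noteq> a"
  by blast

lemma coset_self: "add_subgroup K \<Longrightarrow> h \<in> K \<Longrightarrow> (+) h ` K = K"
proof safe
  fix k assume K: "add_subgroup K" "h \<in> K" "k \<in> K"
  then show "h + k \<in> K" by (simp add: add_subgroupD)
  have "- h + k \<in> K" using K by (simp add: add_subgroupD)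
  moreover have "k = h + (- h + k)" by simp
  ultimately show "k \<in> (+) h ` K" by blast
qed

lemma card_cosets:
  assumes K: "add_subgroup K" and H: "add_subgroup H" "finite H" and KH: "K \<subseteq> H"
  shows "card ((\<lambda>h. (+) h ` K) ` H) * card K = card H"
proof -
  interpret group "group_on H" by (rule group_group_on) (rule H(1))
  have A: "acts_on (group_on H) (\<lambda>h C. (+) h ` C) UNIV"
    by (rule acts_onI) (auto simp: image_image add.assoc)
  have "h \<in> K" if "(+) h ` K = K" for h
  proof -
    have "h + 0 \<in> (+) h ` K" using add_subgroupD(1)[OF K] by blast
    then show ?thesis using that by simp
  qed
  then have "{h \<in> H. (+) h ` K = K} = K" using coset_self[OF K] KH by blast
  then show ?thesis using orbit_stabilizer[OF _ A, of K] H by simp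
qed

context twisted
begin

text \<open>The subgroup generated by \<open>H\<close> and the values of \<open>f0\<close>; it
  contains the values of all sections.\<close>

definition "R0 = {r. \<exists>s\<in>carrier S. - f0 s + r \<in> H}"

lemma p_normal_R0: "p_normal R0 H"
proof
  show HR: "H \<subseteq> R0" using homs0_one[OF hom] by (auto simp: R0_def intro!: bexI[of _ \<one>])
  show "add_subgroup H" by (rule subH)
  show "add_subgroup R0"
    unfolding add_subgroup_def
  proof (intro conjI ballI)
    show "0 \<in> R0" using HR subH add_subgroupD(1) by blast
    fix x assume x: "x \<in> R0"
    then obtain s where s: "s \<in> carrier S" "- f0 s + x \<in> H" by (auto simp: R0_def)
    show "- x \<in> R0"
    proof -
      have "- f0 (inv s) + - x = conjg (f0 s) (- (- f0 s + x))"
        by (simp add: homs0_inv[OF hom s(1)] conjg_unfold del: add_uminus_conv_diff)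
      also have "\<dots> \<in> H" using s subH normalizesD(1)[OF norm] by (metis add_subgroupD(3))
      finally show ?thesis using s unfolding R0_def by blast
    qed
    fix y assume "y \<in> R0"
    then obtain t where t: "t \<in> carrier S" "- f0 t + y \<in> H" by (auto simp: R0_def)
    have "- f0 (s \<otimes> t) + (x + y) = conjg (- f0 t) (- f0 s + x) + (- f0 t + y)"
      by (simp add: homs0_add[OF hom s(1) t(1)] conjg_unfold del: add_uminus_conv_diff)
    also have "\<dots> \<in> H" using s t subH normalizesD(2)[OF norm] by (metis add_subgroupD(2))
    finally show "x + y \<in> R0" using s t unfolding R0_def by blast
  qed
  show "conjg r h \<in> H" if "r \<in> R0" "h \<in> H" for r h
    using that normalizesD(1)[OF normalizes_coset[OF subH norm]] unfolding R0_def by blast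
qed

text \<open>The number of cosets of \<open>K\<close> in \<open>H\<close> is a nontrivial power of
  \<open>p\<close>, and the \<open>p\<close>-groups \<open>H\<close> and \<open>S\<close> act on
  them by conjugation. So the number of fixed cosets is divisible by \<open>p\<close>; as
  \<open>K\<close> is one of them, there is another.\<close>

lemma exists_centralized_coset:
  assumes S: "order S = p ^ l" and K: "normal_pair R0 K" "K \<subseteq> H" "K \<noteq> H"
  shows "\<exists>h\<in>H - K. \<forall>r\<in>R0. coset_rel K h (conjg r h)"
proof -
  interpret p_normal p R0 H by (rule p_normal_R0)
  interpret K: normal_pair R0 K by (rule K(1))
  interpret GH: group "group_on H" by (rule group_group_on) (rule subH)
  let ?X = "(\<lambda>h. (+) h ` K) ` H"
  \<comment> \<open>The fixed cosets are cut out in two stages, first under \<open>H\<close> and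
    then under \<open>S\<close> acting through \<open>f0\<close>; each stage is an action of a group
    of \<open>p\<close>-power order.\<close>
  let ?X1 = "{C \<in> ?X. \<forall>h\<in>carrier (group_on H). conjg h ` C = C}"
  let ?X2 = "{C \<in> ?X1. \<forall>s\<in>carrier S. conjg (f0 s) ` C = C}"
  have finX: "finite ?X" using finite_H by simp
  have psi_R: "f0 s \<in> R0" if "s \<in> carrier S" for s
    using that subH by (auto simp: R0_def add_subgroupD intro!: bexI[of _ s])
  have conjg_coset: "conjg r ` (+) h ` K = (+) (conjg r h) ` K" if "r \<in> R0" for r h
  proof -
    have "conjg r ` (+) h ` K = (+) (conjg r h) ` conjg r ` K" by (simp add: image_image)
    then show ?thesis using K.conjg_image[OF that] by simp
  qed
  have XX: "conjg r ` C \<in> ?X" if "r \<in> R0" "C \<in> ?X" for r C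
    using that conjg_coset norm_H by auto
  have conj_conj: "conjg a ` conjg b ` C = conjg (a + b) ` C" for a b C
    by (simp add: image_image conjg_add)
  obtain k where k: "card H = p ^ k" using p_subgroupD(3)[OF p_sub] by blast
  have A1: "acts_on (group_on H) (\<lambda>h C. conjg h ` C) ?X"
  proof (rule acts_onI)
    fix h C assume "h \<in> carrier (group_on H)" "C \<in> ?X"
    then show "conjg h ` C \<in> ?X" using XX[of h C] HR by auto
  qed (simp_all add: conj_conj)
  have "[card ?X = card ?X1] (mod p)"
    by (rule GH.card_fixed_points_cong[OF prime _ A1 finX]) (simp add: k)
  also have "[card ?X1 = card ?X2] (mod p)"
  proof (rule card_fixed_points_cong[OF prime S])
    show "acts_on S (\<lambda>s C. conjg (f0 s) ` C) ?X1"
    proof (rule acts_onI)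
      fix s C assume s: "s \<in> carrier S" and C: "C \<in> ?X1"
      have "conjg h ` conjg (f0 s) ` C = conjg (f0 s) ` C" if h: "h \<in> H" for h
      proof -
        have e: "h + f0 s = f0 s + conjg (- f0 s) h" by (simp add: conjg_def add.assoc)
        have "conjg (- f0 s) h \<in> H" using norm[OF s] h normalizesD by blast
        then have "conjg (conjg (- f0 s) h) ` C = C" using C by simp
        then show ?thesis unfolding conj_conj e by (simp add: conj_conj[symmetric])
      qed
      then show "conjg (f0 s) ` C \<in> ?X1" using XX[OF psi_R[OF s]] C by simp
    qed (simp_all add: homs0_one[OF hom] homs0_add[OF hom] conj_conj)
    show "finite ?X1" using finX by simp
  qed
  finally have c: "[card ?X = card ?X2] (mod p)" .
  have oc: "card ?X * card K = card H" by (rule card_cosets[OF K.K subH finite_H K(2)])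
  have "p dvd card ?X"
  proof -
    obtain i where i: "card ?X = p ^ i" using oc k prime by (metis divides_primepow_nat dvd_triv_left)
    have "card ?X \<noteq> 1" using oc card_subset_eq[OF finite_H K(2)] K(3) by auto
    then show ?thesis using i by (cases i) auto
  qed
  then have p2: "p dvd card ?X2" using c by (simp only: cong_def dvd_eq_mod_eq_0)
  have K2: "K \<in> ?X2"
  proof -
    have "(+) 0 ` K = K" by simp
    then have "K \<in> ?X" using subH add_subgroupD(1) by (metis image_eqI)
    then show ?thesis by (simp add: K.conjg_image psi_R subsetD[OF HR])
  qed
  have "finite ?X2" using finX by simp
  have "?X2 \<noteq> {K}"
  proof
    assume "?X2 = {K}"
    then have "card ?X2 = 1" by simp
    then show False using p2 prime by simp
  qed
  from exists_other[OF K2 this] obtain C where C: "C \<in> ?X2" "C \<noteq> K" by (elim bexE)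
  then have "C \<in> ?X" by simp
  then obtain h where h: "h \<in> H" "C = (+) h ` K" by (rule imageE)
  have "h \<notin> K"
  proof
    assume hK: "h \<in> K"
    have "C = K" unfolding h(2) by (rule coset_self[OF K.K hK])
    then show False using C(2) by simp
  qed
  moreover have "coset_rel K h (conjg r h)" if r: "r \<in> R0" for r
  proof -
    obtain s where s: "s \<in> carrier S" "- f0 s + r \<in> H" using r by (auto simp: R0_def)
    have "conjg (- f0 s + r) ` C = C" "conjg (f0 s) ` C = C" using C(1) s by simp_all
    then have "conjg (f0 s + (- f0 s + r)) ` C = C" unfolding conj_conj[symmetric] by (simp only:)
    then have "conjg r ` C = C" by (simp only: add_minus_cancel)
    moreover have "h + 0 \<in> C" using h(2) K.K add_subgroupD(1) by blast
    ultimately have "conjg r h \<in> C" by (metis add_0_right image_eqI)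
    then show ?thesis using h(2) by (auto simp: coset_rel_def)
  qed
  ultimately show ?thesis using h(1) by blast
qed

text \<open>As long as a term is not all of \<open>H\<close>, a coset from
  \<open>exists_centralized_coset\<close> makes the next term strictly larger, and all orders are
  powers of \<open>p\<close>.\<close>

lemma p_series_grows:
  assumes S: "order S = p ^ l"
  shows "p_series p R0 H i = H \<or> p ^ i dvd card (p_series p R0 H i)"
proof (induction i)
  case (Suc i)
  interpret p_normal p R0 H by (rule p_normal_R0)
  let ?K = "series i" and ?L = "series (Suc i)"
  interpret K: normal_pair R0 ?K by (rule p_series_normal(1))
  interpret L: normal_pair R0 ?L by (rule p_series_normal(1))
  show ?case
  proof (cases "?K = H")
    case True
    then show ?thesis using p_series_normal(2)[of "Suc i"] p_series_normal(3)[of i] by blast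
  next
    case False
    then obtain h where h: "h \<in> H" "h \<notin> ?K" "\<forall>r\<in>R0. coset_rel ?K h (conjg r h)"
      using exists_centralized_coset[OF S p_series_normal(1) p_series_normal(2)] by blast
    obtain k where k: "card H = p ^ k" using p_subgroupD(3)[OF p_sub] by blast
    define j where "j = (LEAST j. nmul (p ^ j) h \<in> ?K)"
    have "nmul (p ^ k) h \<in> ?K"
      using nmul_card_eq_0[OF subH finite_H h(1)] k add_subgroupD(1)[OF K.K] by simp
    then have j: "nmul (p ^ j) h \<in> ?K" unfolding j_def by (rule LeastI)
    have j0: "j \<noteq> 0" using j h(2) by (metis nmul_1(1) power_0)
    \<comment> \<open>The last \<open>p\<close>-power multiple of \<open>h\<close> outside
      \<open>?K\<close>: modulo \<open>?K\<close> it is killed by \<open>p\<close>, and it is still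
      centralized by \<open>R0\<close>.\<close>
    define h' where "h' = nmul (p ^ (j - 1)) h"
    have nh': "h' \<notin> ?K" unfolding h'_def j_def
      by (rule not_less_Least) (use j0 in \<open>simp add: j_def\<close>)
    have ph': "nmul p h' \<in> ?K"
      using j j0 by (simp add: h'_def flip: nmul_mult power_Suc)
    have hH: "h' \<in> H" using h(1) subH nmul_mem by (auto simp: h'_def)
    have mult: "coset_rel ?K (nmul n h) (conjg r (nmul n h))" if r: "r \<in> R0" for n r
    proof (induction n)
      case (Suc n)
      have "nmul n h \<in> R0" using nmul_mem[OF subH h(1)] HR by blast
      then show ?case using K.coset_rel_add[of h "conjg r h" "nmul n h"] h(3) r Suc by simp
    qed simp
    have hL: "h' \<in> ?L" using hH ph' mult by (simp add: h'_def)
    then have lt: "card ?K < card ?L"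
      using nh' p_series_normal(3)[of i] finite_subset[OF p_series_normal(2) finite_H, of "Suc i"]
      by (intro psubset_card_mono) blast+
    have pK: "\<exists>a. card ?K = p ^ a" and pL: "\<exists>b. card ?L = p ^ b"
      using p_subgroupD(3)[OF p_subgroup_subset[OF p_sub prime]] K.K L.K p_series_normal(2) by metis+
    then obtain a b where ab: "card ?K = p ^ a" "card ?L = p ^ b" by blast
    have "i \<le> a" using Suc.IH False ab prime by (metis power_dvd_imp_le prime_gt_1_nat)
    moreover have "a < b" using lt ab prime by (metis power_less_imp_less_exp prime_gt_1_nat)
    ultimately show ?thesis using ab by (metis Suc_leI le_imp_power_dvd le_less_trans)
  qed
qed simp

text \<open>By \<open>nmul_shift\<close> the \<open>n\<close>-th term of the series permutes the
  roots freely by translation, and by \<open>p_series_grows\<close> its order is a multiple of the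
  \<open>gcd\<close>.\<close>

lemma gcd_dvd_card_roots_zero:
  assumes S: "order S = p ^ l" and b: "b \<in> carrier S"
  shows "gcd (p ^ n) (card H) dvd card (roots H (f0 b) (p ^ n) 0)"
proof -
  interpret p_normal p R0 H by (rule p_normal_R0)
  let ?K = "series n" and ?Y = "roots H (f0 b) (p ^ n) 0"
  interpret K: normal_pair R0 ?K by (rule p_series_normal(1))
  interpret GK: group "group_on ?K" by (rule group_group_on) (rule K.K)
  have finY: "finite ?Y"
    by (rule finite_subset[OF _ finite_coset[of "f0 b"]]) (auto simp: roots_def)
  have "order (group_on ?K) dvd card ?Y"
  \<comment> \<open>The sign turns translation on the right into a left action.\<close>
  proof (rule GK.dvd_card_free[where act = "\<lambda>k y. y + - k"])
    show "acts_on (group_on ?K) (\<lambda>k y. y + - k) ?Y"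
    proof (rule acts_onI)
      fix k y assume k: "k \<in> carrier (group_on ?K)" and y: "y \<in> ?Y"
      have kH: "- k \<in> H" "- k \<in> ?K" using k p_series_normal(2) K.K add_subgroupD(3) by auto
      have "y \<in> R0" using y b by (auto simp: R0_def roots_def)
      then have "nmul (p ^ n) (y + - k) = 0" using nmul_shift[of y "- k" n] kH y by (simp add: roots_def)
      moreover have "- f0 b + (y + - k) \<in> H"
        using y kH subH by (simp add: roots_def add_subgroupD flip: add.assoc del: add_uminus_conv_diff)
      ultimately show "y + - k \<in> ?Y" by (simp add: roots_def)
    qed (auto simp: add.assoc minus_add diff_conv_add_uminus simp del: add_uminus_conv_diff)
    show "finite ?Y" by (rule finY)
  qed (auto simp: inj_on_def simp del: add_uminus_conv_diff)
  then have "card ?K dvd card ?Y" by simp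
  then show ?thesis
    using p_series_grows[OF S, of n] by (metis dvd_trans gcd_dvd1 gcd_dvd2)
qed

end

section \<open>Adjoining a cyclic factor\<close>

text \<open>By \<open>indep\<close> the order of \<open>b\<close> is \<open>q\<close> even modulo
  \<open>S\<close>, so with \<open>bq\<close> the subgroup \<open>T\<close> is the internal direct
  product of \<open>S\<close> and the cyclic group of \<open>b\<close>.\<close>

locale cyclic_extension = comm_group G for G :: "('s, 'm) monoid_scheme" (structure) +
  fixes S :: "'s set" and b :: 's and q :: nat
  assumes S: "subgroup S G" and b: "b \<in> carrier G" and q0: "q > 0" and bq: "b [^] q = \<one>"
    and indep: "\<And>i :: nat. b [^] i \<in> S \<Longrightarrow> q dvd i"
begin

definition T :: "'s set" where
  "T = {t. \<exists>s i. s \<in> S \<and> t = s \<otimes> b [^] (i :: nat)}"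

lemma S_mem: "s \<in> S \<Longrightarrow> s \<in> carrier G"
  using subgroup.subset[OF S] by blast

lemma S_T: "s \<in> S \<Longrightarrow> s \<in> T"
  unfolding T_def using S_mem by (intro CollectI exI[of _ s] exI[of _ 0]) simp

lemma T_memI: "s \<in> S \<Longrightarrow> s \<otimes> b [^] (i :: nat) \<in> T"
  unfolding T_def by blast

lemma b_T: "b \<in> T"
  using T_memI[OF subgroup.one_closed[OF S], of 1] b by simp

lemma T_carrier: "T \<subseteq> carrier G"
  using S_mem b by (auto simp: T_def)

lemma mult_rep:
  assumes "s \<in> S" "t \<in> S"
  shows "(s \<otimes> b [^] (i :: nat)) \<otimes> (t \<otimes> b [^] (j :: nat)) = (s \<otimes> t) \<otimes> b [^] (i + j)"
proof -
  have c: "s \<in> carrier G" "t \<in> carrier G" using assms S_mem by auto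
  have "(s \<otimes> b [^] i) \<otimes> (t \<otimes> b [^] j) = (s \<otimes> t) \<otimes> (b [^] i \<otimes> b [^] j)"
    using c b by (simp add: m_ac)
  then show ?thesis using b by (simp add: nat_pow_mult)
qed

lemma pow_mult_q: "b [^] (q * i) = \<one>"
  using b bq by (metis nat_pow_one nat_pow_pow)

lemma rep_eq:
  assumes "s \<in> S" "s' \<in> S" "s \<otimes> b [^] (i :: nat) = s' \<otimes> b [^] (j :: nat)" "i \<le> j"
  shows "s = s'" "q dvd j - i"
proof -
  have c: "s \<in> carrier G" "s' \<in> carrier G" using assms S_mem by auto
  have "b [^] j = b [^] (j - i) \<otimes> b [^] i" using b assms(4) by (simp add: nat_pow_mult)
  then have "s \<otimes> b [^] i = (s' \<otimes> b [^] (j - i)) \<otimes> b [^] i"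
    using assms(3) c b by (simp add: m_assoc)
  then have e: "s = s' \<otimes> b [^] (j - i)" using c b by simp
  then have "b [^] (j - i) = inv s' \<otimes> s" using c b by (simp add: m_assoc[symmetric])
  moreover have "inv s' \<otimes> s \<in> S"
    using assms S by (simp add: subgroup.m_closed subgroup.m_inv_closed)
  ultimately show d: "q dvd j - i" using indep by simp
  then have "b [^] (j - i) = \<one>" using pow_mult_q by (elim dvdE) simp
  then show "s = s'" using e c by simp
qed

lemma subgroup_T: "subgroup T G"
proof (rule subgroupI[OF T_carrier])
  show "T \<noteq> {}" using b_T by blast
  fix a assume "a \<in> T"
  then obtain s i where a: "s \<in> S" "a = s \<otimes> b [^] (i :: nat)" by (auto simp: T_def)
  \<comment> \<open>The natural number \<open>q * i - i\<close> stands in for the exponent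
    \<open>- i\<close>.\<close>
  have "a \<otimes> (inv s \<otimes> b [^] (q * i - i)) = (s \<otimes> inv s) \<otimes> b [^] (i + (q * i - i))"
    unfolding a(2) by (rule mult_rep) (use a S in \<open>auto simp: subgroup.m_inv_closed\<close>)
  moreover have "i + (q * i - i) = q * i" using q0 by (simp add: Suc_leI)
  ultimately have "a \<otimes> (inv s \<otimes> b [^] (q * i - i)) = \<one>"
    using pow_mult_q a S_mem by simp
  then have "inv a = inv s \<otimes> b [^] (q * i - i)"
    using a S_mem b by (intro inv_unique'[THEN sym]) (auto simp: m_comm)
  then show "inv a \<in> T" using T_memI a S subgroup.m_inv_closed by metis
  fix c assume "c \<in> T"
  then obtain t j where "t \<in> S" "c = t \<otimes> b [^] (j :: nat)" by (auto simp: T_def)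
  then show "a \<otimes> c \<in> T" using a mult_rep T_memI S subgroup.m_closed by metis
qed

lemma card_T: "card T = q * card S"
proof -
  have "bij_betw (\<lambda>(s, i). s \<otimes> b [^] i) (S \<times> {..<q}) T"
    unfolding bij_betw_def
  proof
    have *: "s = s' \<and> i = j"
      if "s \<in> S" "s' \<in> S" "s \<otimes> b [^] (i :: nat) = s' \<otimes> b [^] (j :: nat)" "i \<le> j" "j < q" for s s' i j
      using rep_eq[OF that(1-4)] that(4,5) by (auto dest!: dvd_imp_le)
    show "inj_on (\<lambda>(s, i). s \<otimes> b [^] i) (S \<times> {..<q})"
    proof (rule inj_onI, clarsimp)
      fix s s' i j assume "s \<in> S" "s' \<in> S" "i < q" "j < q" "s \<otimes> b [^] (i :: nat) = s' \<otimes> b [^] (j :: nat)"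
      then show "s = s' \<and> i = j" using *[of s s' i j] *[of s' s j i] by (metis nat_le_linear)
    qed
    show "(\<lambda>(s, i). s \<otimes> b [^] i) ` (S \<times> {..<q}) = T"
    proof (intro equalityI subsetI)
      fix t assume "t \<in> T"
      then obtain s i where t: "s \<in> S" "t = s \<otimes> b [^] (i :: nat)" by (auto simp: T_def)
      have "b [^] i = b [^] (q * (i div q)) \<otimes> b [^] (i mod q)" using b by (simp add: nat_pow_mult)
      then have "b [^] i = b [^] (i mod q)" using pow_mult_q b by simp
      then show "t \<in> (\<lambda>(s, i). s \<otimes> b [^] i) ` (S \<times> {..<q})"
        using t q0 by (intro image_eqI[of _ _ "(s, i mod q)"]) auto
    qed (auto intro: T_memI)
  qed
  then have "card T = card (S \<times> {..<q})" by (simp add: bij_betw_same_card)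
  then show ?thesis by (simp add: card_cartesian_product)
qed

abbreviation "GS \<equiv> G\<lparr>carrier := S\<rparr>"
abbreviation "GT \<equiv> G\<lparr>carrier := T\<rparr>"

text \<open>When \<open>f\<close> is a homomorphism on \<open>S\<close> that commutes with
  \<open>y\<close> and \<open>nmul q y = 0\<close>, this is the homomorphism on \<open>T\<close>
  with \<open>b\<close> mapped to \<open>y\<close>; the choice is harmless by
  \<open>extend_rep\<close>.\<close>

definition extend :: "('s \<Rightarrow> 'e::group_add) \<Rightarrow> 'e \<Rightarrow> 's \<Rightarrow> 'e" where
  "extend f y t = (if t \<in> T then (SOME v. \<exists>s i. s \<in> S \<and> t = s \<otimes> b [^] (i :: nat) \<and> v = f s + nmul i y) else 0)"

lemma extend_rep:
  assumes y: "nmul q y = 0" and s: "s \<in> S"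
  shows "extend f y (s \<otimes> b [^] (i :: nat)) = f s + nmul i y"
proof -
  have nm: "nmul i y = nmul j y" if d: "q dvd j - i" and "i \<le> j" for i j
  proof -
    obtain k where k: "j - i = q * k" using d by (elim dvdE)
    have "nmul (j - i) y = 0" unfolding k by (simp add: mult.commute[of q] nmul_mult y)
    moreover have "nmul j y = nmul (j - i) y + nmul i y"
      using \<open>i \<le> j\<close> by (simp flip: nmul_add)
    ultimately show ?thesis by simp
  qed
  have u: "f s + nmul i y = f s' + nmul j y"
    if "s \<in> S" "s' \<in> S" "s \<otimes> b [^] (i :: nat) = s' \<otimes> b [^] (j :: nat)" "i \<le> j" for s s' i j
    using rep_eq[OF that] nm[of j i] that(4) by simp
  have u: "f s + nmul i y = f s' + nmul j y"
    if "s \<in> S" "s' \<in> S" "s \<otimes> b [^] (i :: nat) = s' \<otimes> b [^] (j :: nat)" for s s' i j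
    using u[of s s' i j] u[of s' s j i] that by (metis nat_le_linear)
  have "(SOME v. \<exists>s' j. s' \<in> S \<and> s \<otimes> b [^] i = s' \<otimes> b [^] (j :: nat) \<and> v = f s' + nmul j y) = f s + nmul i y"
  proof (rule some_equality)
    fix v assume "\<exists>s' j. s' \<in> S \<and> s \<otimes> b [^] i = s' \<otimes> b [^] (j :: nat) \<and> v = f s' + nmul j y"
    then obtain s' j where "s' \<in> S" "s \<otimes> b [^] i = s' \<otimes> b [^] (j :: nat)" "v = f s' + nmul j y" by blast
    then show "v = f s + nmul i y" using u[OF s] by simp
  qed (use s in blast)
  then show ?thesis using T_memI[OF s] by (simp add: extend_def)
qed

lemma extend_homs0:
  assumes f: "f \<in> homs0 GS" and y: "nmul q y = 0" and c: "\<And>s. s \<in> S \<Longrightarrow> commutes (f s) y"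
  shows "extend f y \<in> homs0 GT"
proof -
  have "extend f y (t \<otimes> u) = extend f y t + extend f y u" if "t \<in> T" "u \<in> T" for t u
  proof -
    obtain s i where t: "s \<in> S" "t = s \<otimes> b [^] (i :: nat)" using \<open>t \<in> T\<close> by (auto simp: T_def)
    obtain r j where u: "r \<in> S" "u = r \<otimes> b [^] (j :: nat)" using \<open>u \<in> T\<close> by (auto simp: T_def)
    have sr: "s \<otimes> r \<in> S" using t u S subgroup.m_closed by metis
    have "commutes (f r) (nmul i y)" using c[OF u(1)] by (rule commutes_nmul)
    then have "f s + (f r + nmul i y) + nmul j y = f s + (nmul i y + f r) + nmul j y"
      by (simp only: commutes_def)
    then have "f (s \<otimes> r) + nmul (i + j) y = (f s + nmul i y) + (f r + nmul j y)"
      using homs0_add[OF f] t u by (simp add: nmul_add add.assoc)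
    then show ?thesis
      unfolding t(2) u(2) mult_rep[OF t(1) u(1)] using extend_rep[OF y] sr t u by simp
  qed
  moreover have "extend f y t = 0" if "t \<notin> T" for t using that by (simp add: extend_def)
  ultimately show ?thesis by (simp add: homs0_def)
qed

definition res :: "('s \<Rightarrow> 'e::group_add) \<Rightarrow> 's \<Rightarrow> 'e" where
  "res f s = (if s \<in> S then f s else 0)"

lemma res_homs0: "f \<in> homs0 GT \<Longrightarrow> res f \<in> homs0 GS"
  using S_T subgroup.m_closed[OF S] by (auto simp: homs0_def res_def)

lemma group_GT: "group GT" and group_GS: "group GS"
  using subgroup.subgroup_is_group[OF _ is_group] subgroup_T S by auto

lemma homs0_pow:
  assumes f: "f \<in> homs0 GT" and t: "t \<in> T"
  shows "f (t [^] (i :: nat)) = nmul i (f t)"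
proof (induction i)
  case 0
  show ?case using group.homs0_one[OF group_GT f] by simp
next
  case (Suc i)
  have ti: "t [^] i \<in> T" using t subgroup_T by (induction i) (auto simp: subgroup.one_closed subgroup.m_closed)
  have "f (t [^] Suc i) = nmul i (f t) + f t" using homs0_add[OF f, of "t [^] i" t] t ti Suc by simp
  moreover have "commutes (nmul i (f t)) (f t)" by (rule commutes_nmul_left) simp
  ultimately show ?case by (simp add: commutes_def)
qed

lemma homs0_rep:
  assumes "f \<in> homs0 GT" "s \<in> S"
  shows "f (s \<otimes> b [^] (i :: nat)) = f s + nmul i (f b)"
proof -
  have "b [^] i \<in> T" using T_memI[OF subgroup.one_closed[OF S], of i] b by simp
  then show ?thesis
    using homs0_add[OF assms(1), of s "b [^] i"] S_T[OF assms(2)] homs0_pow[OF assms(1) b_T] by simp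
qed

text \<open>A homomorphism on \<open>T\<close> amounts to its restriction to \<open>S\<close> and
  its value \<open>y\<close> at \<open>b\<close>; the relations involving \<open>b\<close> become
  \<open>nmul q y = 0\<close> and commutation of \<open>y\<close> with the restriction.\<close>

lemma card_sections_GT:
  assumes fin: "finite S" "finite H" and H: "add_subgroup H" and f0: "f0 \<in> homs0 GT"
    and norm: "\<And>t. t \<in> T \<Longrightarrow> normalizes (f0 t) H"
  shows "card (sections GT H f0) = pair_count GS H (res f0) (f0 b) q 0"
proof -
  let ?F = "\<lambda>y. fixing GS H (res f0) y" and ?R = "roots H (f0 b) q 0"
  have finR: "finite ?R"
  proof (rule finite_subset)
    show "?R \<subseteq> (\<lambda>h. f0 b + h) ` H"
    proof
      fix y assume "y \<in> ?R"
      then have "y = f0 b + (- f0 b + y)" "- f0 b + y \<in> H" by (simp_all add: roots_def)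
      then show "y \<in> (\<lambda>h. f0 b + h) ` H" by (rule image_eqI)
    qed
  qed (use fin in simp)
  have finF: "finite (?F y)" for y
    using finite_sections[of GS H "res f0"] fin by (simp add: fixing_def)
  have "bij_betw (\<lambda>\<Psi>. (\<Psi> b, res \<Psi>)) (sections GT H f0) (SIGMA y:?R. ?F y)"
  proof (rule bij_betwI[where g = "\<lambda>(y, f). extend f y"])
    show "(\<lambda>\<Psi>. (\<Psi> b, res \<Psi>)) \<in> sections GT H f0 \<rightarrow> (SIGMA y:?R. ?F y)"
    proof
      fix \<Psi> assume \<Psi>: "\<Psi> \<in> sections GT H f0"
      then have h: "\<Psi> \<in> homs0 GT" by (simp add: sections_def)
      have "nmul q (\<Psi> b) = 0"
        using homs0_pow[OF h b_T, of q] bq group.homs0_one[OF group_GT h] by simp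
      then have "\<Psi> b \<in> ?R" using \<Psi> b_T by (simp add: roots_def sections_def)
      moreover have "commutes (\<Psi> s) (\<Psi> b)" if "s \<in> S" for s
        using homs0_add[OF h, of s b] homs0_add[OF h, of b s] S_T[OF that] b_T m_comm[of s b] S_mem[OF that] b
        by (simp add: commutes_def)
      ultimately show "(\<Psi> b, res \<Psi>) \<in> (SIGMA y:?R. ?F y)"
        using \<Psi> res_homs0[OF h] S_T by (auto simp: fixing_def sections_def) (auto simp: res_def)
    qed
    show "(\<lambda>(y, f). extend f y) \<in> (SIGMA y:?R. ?F y) \<rightarrow> sections GT H f0"
    proof (clarsimp)
      fix y f assume y: "y \<in> ?R" and f: "f \<in> ?F y"
      have y0: "nmul q y = 0" using y by (simp add: roots_def)
      have e: "extend f y \<in> homs0 GT"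
        by (rule extend_homs0[OF _ y0]) (use f in \<open>auto simp: fixing_def sections_def\<close>)
      moreover have "- f0 t + extend f y t \<in> H" if tT: "t \<in> T" for t
      proof -
        obtain s i where t: "s \<in> S" "t = s \<otimes> b [^] (i :: nat)" using tT by (auto simp: T_def)
        let ?g = "nmul i (f0 b)"
        have "- f0 t + extend f y t = - (f0 s + ?g) + (f s + nmul i y)"
          unfolding t(2) by (simp only: homs0_rep[OF f0 t(1)] extend_rep[OF y0 t(1)])
        also have "\<dots> = conjg (- ?g) (- f0 s + f s) + (- ?g + nmul i y)"
          by (simp add: conjg_unfold del: add_uminus_conv_diff)
        also have "\<dots> \<in> H"
        proof (rule add_subgroupD(2)[OF H])
          have "- f0 s + f s \<in> H" using f t(1) by (auto simp: fixing_def sections_def res_def)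
          then show "conjg (- ?g) (- f0 s + f s) \<in> H"
            by (rule normalizesD(2)[OF normalizes_nmul[OF norm[OF b_T]]])
          show "- ?g + nmul i y \<in> H"
            by (rule coset_nmul[OF H norm[OF b_T]]) (use y in \<open>simp add: roots_def\<close>)
        qed
        finally show ?thesis .
      qed
      ultimately show "extend f y \<in> sections GT H f0" by (simp add: sections_def)
    qed
  next
    fix \<Psi> assume \<Psi>: "\<Psi> \<in> sections GT H f0"
    then have h: "\<Psi> \<in> homs0 GT" by (simp add: sections_def)
    have y0: "nmul q (\<Psi> b) = 0"
      using homs0_pow[OF h b_T, of q] bq group.homs0_one[OF group_GT h] by simp
    have "extend (res \<Psi>) (\<Psi> b) t = \<Psi> t" for t
    proof (cases "t \<in> T")
      case True
      then obtain s i where t: "s \<in> S" "t = s \<otimes> b [^] (i :: nat)" by (auto simp: T_def)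
      show ?thesis unfolding t(2) extend_rep[OF y0 t(1)] homs0_rep[OF h t(1)] using t(1) by (simp add: res_def)
    next
      case False
      then show ?thesis using h by (simp add: extend_def homs0_def)
    qed
    then show "(\<lambda>(y, f). extend f y) (\<Psi> b, res \<Psi>) = \<Psi>" by auto
  next
    fix v assume "v \<in> (SIGMA y:?R. ?F y)"
    then obtain y f where v: "v = (y, f)" "y \<in> ?R" "f \<in> ?F y" by blast
    have y0: "nmul q y = 0" using v by (simp add: roots_def)
    have f: "f \<in> homs0 GS" using v by (simp add: fixing_def sections_def)
    have "extend f y s = f s" if "s \<in> S" for s
      using extend_rep[OF y0 that, of f 0] S_mem[OF that] by simp
    then have "res (extend f y) = f" using f by (auto simp: res_def fun_eq_iff homs0_def)
    moreover have "extend f y b = y"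
      using extend_rep[OF y0 subgroup.one_closed[OF S], of f 1] b group.homs0_one[OF group_GS f] by simp
    ultimately show "((\<lambda>\<Psi>. (\<Psi> b, res \<Psi>)) ((\<lambda>(y, f). extend f y) v)) = v" using v by simp
  qed
  then have "card (sections GT H f0) = card (SIGMA y:?R. ?F y)" by (rule bij_betw_same_card)
  then show ?thesis using finR finF by (simp add: pair_count_def card_SigmaI)
qed

lemma twisted_GS:
  assumes "finite S" "prime p" "p_subgroup p H" "f0 \<in> homs0 GT" "\<And>t. t \<in> T \<Longrightarrow> normalizes (f0 t) H"
  shows "twisted GS p H (res f0) (f0 b)"
proof -
  interpret GS: group GS by (rule group_GS)
  have "commutes (f0 s) (f0 b)" if "s \<in> S" for s
    using homs0_add[OF assms(4), of s b] homs0_add[OF assms(4), of b s] S_T[OF that] b_T m_comm[of s b] S_mem[OF that] b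
    by (simp add: commutes_def)
  then show ?thesis
    using assms res_homs0[OF assms(4)] S_T b_T by unfold_locales (auto simp: res_def)
qed

text \<open>The base homomorphism gives \<open>nmul q (f0 b) = 0\<close>. So the value 0 has the
  form required by \<open>dvd_pair_count\<close>, and it commutes with all of
  \<open>H\<close>.\<close>

lemma good_extension:
  assumes good: "good TYPE('e::group_add) p GS Q" and Q: "Q = p ^ \<kappa>" and p: "prime p"
    and q: "q = p \<or> q = p * p" and fin: "finite S"
  shows "good TYPE('e) p GT (q * Q)"
  unfolding good_def
proof (intro allI impI)
  fix H :: "'e set" and f0
  assume H: "p_subgroup p H" and f0: "f0 \<in> homs0 GT"
    and norm: "\<forall>s\<in>carrier GT. normalizes (f0 s) H"
  have tw: "twisted GS p H (res f0) (f0 b)"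
    by (rule twisted_GS[OF fin p H f0]) (use norm in simp)
  have z: "nmul q (f0 b) = 0"
    using homs0_pow[OF f0 b_T, of q] bq group.homs0_one[OF group_GT f0] by simp
  have "card (sections GT H f0) = pair_count GS H (res f0) (f0 b) q 0"
    by (rule card_sections_GT[OF fin p_subgroupD(2,1)[OF H] f0]) (use norm in simp)
  then show "gcd (q * Q) (card H) dvd card (sections GT H f0)"
    using dvd_pair_count[OF tw good Q q] z by simp
qed

text \<open>As \<open>S\<close> is trivial, exactly one section commutes with each \<open>y\<close>,
  and only the roots in the coset of \<open>f0 b\<close> are counted. The bound for these holds for
  every \<open>p ^ n\<close>, so the cyclic factor may have any exponent.\<close>

lemma good_cyclic:
  assumes S1: "S = {\<one>}" and q: "q = p ^ n" and p: "prime p"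
  shows "good TYPE('e::group_add) p GT q"
  unfolding good_def
proof (intro allI impI)
  fix H :: "'e set" and f0
  assume H: "p_subgroup p H" and f0: "f0 \<in> homs0 GT"
    and norm: "\<forall>s\<in>carrier GT. normalizes (f0 s) H"
  have cT: "card T = p ^ n" using card_T S1 q by simp
  then have finT: "finite T" using p by (metis card.infinite not_prime_0 power_eq_0_iff)
  have n0: "normalizes 0 H" using p_subgroupD(1)[OF H] by (simp add: normalizes_def)
  interpret GT: group GT by (rule group_GT)
  \<comment> \<open>The cyclic group itself plays the role of \<open>S\<close>, with
    \<open>g = 0\<close>: the series has to be centralized by the extension that contains
    \<open>f0 b\<close>.\<close>
  interpret tw: twisted GT p H f0 0
    by (rule twisted.intro[OF GT.is_group], rule twisted_axioms.intro)
      (use finT p H f0 norm n0 in simp_all)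
  have "gcd (p ^ n) (card H) dvd card (roots H (f0 b) (p ^ n) 0)"
    by (rule tw.gcd_dvd_card_roots_zero[where l = n]) (simp_all add: order_def cT b_T)
  moreover have "fixing GS H (res f0) y = {\<lambda>_. 0}" for y
  proof -
    interpret GS: group GS by (rule group_GS)
    have z: "f = (\<lambda>_. 0)" if "f \<in> homs0 GS" for f :: "'s \<Rightarrow> 'e"
    proof
      fix s show "f s = 0" using GS.homs0_one[OF that] that S1 by (cases "s = \<one>") (auto simp: homs0_def)
    qed
    have one: "f0 \<one> = 0" using GT.homs0_one[OF f0] by simp
    have "0 \<in> H" using p_subgroupD(1)[OF H] add_subgroupD(1) by blast
    moreover have "res f0 s = 0" for s unfolding res_def using one S1 by auto
    ultimately have "(\<lambda>_. 0) \<in> fixing GS H (res f0) y"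
      by (simp add: fixing_def sections_def homs0_def)
    moreover have "fixing GS H (res f0) y \<subseteq> {\<lambda>_. 0}"
    proof
      fix f assume "f \<in> fixing GS H (res f0) y"
      then have "f \<in> homs0 GS" by (simp add: fixing_def sections_def)
      then have "f = (\<lambda>_. 0)" by (rule z)
      then show "f \<in> {\<lambda>_. 0}" by blast
    qed
    ultimately have "fixing GS H (res f0) y = {\<lambda>_. 0}" by blast
    then show ?thesis .
  qed
  moreover have "card (sections GT H f0) = pair_count GS H (res f0) (f0 b) q 0"
    by (rule card_sections_GT[OF _ p_subgroupD(2,1)[OF H] f0]) (use norm S1 in auto)
  ultimately show "gcd q (card H) dvd card (sections GT H f0)"
    using q by (simp add: pair_count_def)
qed

end

section \<open>Reduction to $p$-subgroups\<close>

text \<open>\<open>H\<close> is no longer a \<open>p\<close>-group. Instead it acts on a finite set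
  with point stabilizers of \<open>p\<close>-power order, and sections are counted through the
  points they fix.\<close>

locale section_action = group S for S :: "('s, 'm) monoid_scheme" (structure) +
  fixes p Q :: nat and H :: "'e::group_add set" and f0 :: "'s \<Rightarrow> 'e"
    and act :: "'e \<Rightarrow> 'x \<Rightarrow> 'x" and \<Omega> :: "'x set"
  assumes finite_S: "finite (carrier S)" and H: "add_subgroup H" and finite_H: "finite H"
    and hom: "f0 \<in> homs0 S" and norm: "\<And>s. s \<in> carrier S \<Longrightarrow> normalizes (f0 s) H"
    and good: "good TYPE('e) p S Q"
    and finite_\<Omega>: "finite \<Omega>"
    and act_zero: "\<And>x. x \<in> \<Omega> \<Longrightarrow> act 0 x = x"
    and act_add: "\<And>a b x. x \<in> \<Omega> \<Longrightarrow> act (a + b) x = act a (act b x)"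
    and act_H: "\<And>h x. h \<in> H \<Longrightarrow> x \<in> \<Omega> \<Longrightarrow> act h x \<in> \<Omega>"
    and act_S: "\<And>s x. s \<in> carrier S \<Longrightarrow> x \<in> \<Omega> \<Longrightarrow> act (f0 s) x \<in> \<Omega>"
    and stab: "\<And>K x. add_subgroup K \<Longrightarrow> K \<subseteq> H \<Longrightarrow> x \<in> \<Omega> \<Longrightarrow> (\<And>k. k \<in> K \<Longrightarrow> act k x = x) \<Longrightarrow> \<exists>i. card K = p ^ i"
begin

abbreviation "Sections \<equiv> sections S H f0"

definition fix_by :: "('s \<Rightarrow> 'e) \<Rightarrow> 'x set" where
  "fix_by f = {x \<in> \<Omega>. \<forall>s\<in>carrier S. act (f s) x = x}"

lemma act_section:
  assumes "f \<in> Sections" "s \<in> carrier S" "x \<in> \<Omega>"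
  shows "act (f s) x \<in> \<Omega>"
proof -
  have "act (f0 s + (- f0 s + f s)) x \<in> \<Omega>"
    unfolding act_add[OF assms(3), of "f0 s" "- f0 s + f s"]
    using assms by (intro act_S[OF assms(2)] act_H) (auto simp: sections_def)
  then show ?thesis by simp
qed

lemma act_minus_fixed:
  assumes "act a x = x" "x \<in> \<Omega>" shows "act (- a) x = x"
  using act_add[of x "- a" a] act_zero[of x] assms by simp

lemma conjg_sections: "h \<in> H \<Longrightarrow> f \<in> Sections \<Longrightarrow> (\<lambda>s. conjg h (f s)) \<in> Sections"
  by (rule sections_conjg[OF H norm])

text \<open>As in \<open>fixing_eq_sections\<close>, one section fixing \<open>x\<close> is a base
  point for the others, now with the stabilizer of \<open>x\<close> in place of
  \<open>H\<close>.\<close>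

lemma sections_fixing_point:
  assumes x: "x \<in> \<Omega>" and f1: "f1 \<in> Sections" "x \<in> fix_by f1"
  shows "{f \<in> Sections. x \<in> fix_by f} = sections S {h \<in> H. act h x = x} f1"
proof (intro equalityI subsetI)
  fix f assume f: "f \<in> {f \<in> Sections. x \<in> fix_by f}"
  have "- f1 s + f s \<in> H \<and> act (- f1 s + f s) x = x" if s: "s \<in> carrier S" for s
  proof
    show "- f1 s + f s \<in> H"
      by (rule coset_diff[OF H, of "f0 s"]) (use f f1 s in \<open>auto simp: sections_def\<close>)
    have "act (f s) x = x" "act (f1 s) x = x" using f f1 s by (auto simp: fix_by_def)
    then show "act (- f1 s + f s) x = x" using act_add[OF x] act_minus_fixed[OF _ x] by simp
  qed
  then show "f \<in> sections S {h \<in> H. act h x = x} f1" using f by (auto simp: sections_def)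
next
  fix f assume f: "f \<in> sections S {h \<in> H. act h x = x} f1"
  have "- f0 s + f s \<in> H" if "s \<in> carrier S" for s
    by (rule coset_trans[OF H, of _ "f1 s"]) (use f f1 that in \<open>auto simp: sections_def\<close>)
  moreover have "act (f s) x = x" if s: "s \<in> carrier S" for s
  proof -
    have "act (f1 s + (- f1 s + f s)) x = x"
      unfolding act_add[OF x, of "f1 s" "- f1 s + f s"] using f f1 s by (simp add: sections_def fix_by_def)
    then show ?thesis by simp
  qed
  ultimately show "f \<in> {f \<in> Sections. x \<in> fix_by f}"
    using f x by (auto simp: sections_def fix_by_def)
qed

lemma card_sections_fixing_conjg:
  assumes h: "h \<in> H" and x: "x \<in> \<Omega>"
  shows "card {f \<in> Sections. act h x \<in> fix_by f} = card {f \<in> Sections. x \<in> fix_by f}"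
proof -
  have fixd: "act k y \<in> fix_by (\<lambda>s. conjg k (f s))" if k: "k \<in> H" and y: "y \<in> fix_by f" for k y f
  proof -
    have yO: "y \<in> \<Omega>" using y by (simp add: fix_by_def)
    have "act (conjg k (f s)) (act k y) = act k y" if "s \<in> carrier S" for s
    proof -
      have "conjg k (f s) + k = k + f s" by (simp add: conjg_def add.assoc)
      then show ?thesis
        using y that act_add[OF yO, of "conjg k (f s)" k] act_add[OF yO, of k "f s"] by (simp add: fix_by_def)
    qed
    then show ?thesis using act_H[OF k yO] by (simp add: fix_by_def)
  qed
  have mh: "- h \<in> H" using h H by (simp add: add_subgroupD)
  have hx: "act (- h) (act h x) = x" using act_add[OF x, of "- h" h] act_zero[OF x] by simp
  have "bij_betw (\<lambda>f s. conjg h (f s)) {f \<in> Sections. x \<in> fix_by f}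
      {f \<in> Sections. act h x \<in> fix_by f}"
  proof (rule bij_betwI[where g = "\<lambda>f s. conjg (- h) (f s)"])
    show "(\<lambda>f s. conjg h (f s)) \<in> {f \<in> Sections. x \<in> fix_by f} \<rightarrow>
        {f \<in> Sections. act h x \<in> fix_by f}"
      using conjg_sections[OF h] fixd[OF h] by blast
    show "(\<lambda>f s. conjg (- h) (f s)) \<in> {f \<in> Sections. act h x \<in> fix_by f} \<rightarrow>
        {f \<in> Sections. x \<in> fix_by f}"
      using conjg_sections[OF mh] fixd[OF mh, of "act h x"] unfolding hx by blast
  qed simp_all
  then show ?thesis by (simp add: bij_betw_same_card)
qed

text \<open>The pairs of a section and a fixed point are counted by points. The stabilizer of
  \<open>x\<close> is a \<open>p\<close>-group, so \<open>good\<close> applies to the sections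
  fixing \<open>x\<close>, and the orbit of \<open>x\<close> supplies the missing part of
  \<open>card H\<close>.\<close>

lemma dvd_sum_fix_by:
  assumes prime: "prime p"
  shows "gcd Q (card H) dvd (\<Sum>f\<in>Sections. card (fix_by f))"
proof -
  have finA: "finite Sections" by (rule finite_sections[OF finite_S finite_H])
  have "card (fix_by f) = (\<Sum>x\<in>\<Omega>. if x \<in> fix_by f then 1 else 0)" for f
  proof -
    have "\<Omega> \<inter> fix_by f = fix_by f" by (auto simp: fix_by_def)
    then show ?thesis using finite_\<Omega> by (simp add: sum.If_cases)
  qed
  then have "(\<Sum>f\<in>Sections. card (fix_by f)) = (\<Sum>f\<in>Sections. \<Sum>x\<in>\<Omega>. if x \<in> fix_by f then 1 else 0)" by simp
  also have "\<dots> = (\<Sum>x\<in>\<Omega>. \<Sum>f\<in>Sections. if x \<in> fix_by f then 1 else 0)" by (rule sum.swap)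
  also have "\<dots> = (\<Sum>x\<in>\<Omega>. card {f \<in> Sections. x \<in> fix_by f})"
    using finA by (simp add: sum.If_cases Int_def)
  finally have eq: "(\<Sum>f\<in>Sections. card (fix_by f)) = (\<Sum>x\<in>\<Omega>. card {f \<in> Sections. x \<in> fix_by f})" .
  interpret G: group "group_on H" by (rule group_group_on) (rule H)
  have A: "acts_on (group_on H) act \<Omega>"
    using act_zero act_add act_H by (auto intro!: acts_onI)
  have "gcd Q (card H) dvd (\<Sum>x\<in>\<Omega>. card {f \<in> Sections. x \<in> fix_by f})"
  proof (rule G.dvd_sum_orbits[OF A finite_\<Omega>])
    show "card {f \<in> Sections. act h x \<in> fix_by f} = card {f \<in> Sections. x \<in> fix_by f}"
      if "h \<in> carrier (group_on H)" "x \<in> \<Omega>" for h x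
      using card_sections_fixing_conjg that by simp
  next
    fix x assume x: "x \<in> \<Omega>"
    let ?K = "{h \<in> H. act h x = x}" and ?o = "card ((\<lambda>g. act g x) ` carrier (group_on H))"
    have o: "?o * card ?K = card H" using G.orbit_stabilizer[OF _ A x] finite_H by simp
    have K: "add_subgroup ?K"
      unfolding add_subgroup_def
    proof (intro conjI ballI)
      show "0 \<in> ?K" using H act_zero[OF x] by (simp add: add_subgroupD)
      fix a assume a: "a \<in> ?K"
      show "- a \<in> ?K" using a H act_minus_fixed[of a x] x by (simp add: add_subgroupD)
      fix c assume "c \<in> ?K"
      then show "a + c \<in> ?K" using a H act_add[OF x, of a c] by (simp add: add_subgroupD)
    qed
    have "gcd Q (card ?K) dvd card {f \<in> Sections. x \<in> fix_by f}"
    proof (cases "{f \<in> Sections. x \<in> fix_by f} = {}")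
      case False
      then obtain f1 where f1: "f1 \<in> Sections" "x \<in> fix_by f1" by blast
      have "p_subgroup p ?K"
        unfolding p_subgroup_def
      proof (intro conjI)
        show "\<exists>k. card ?K = p ^ k" by (rule stab[OF K _ x]) auto
      qed (use K finite_H in simp_all)
      moreover have "f1 \<in> homs0 S" using f1 by (simp add: sections_def)
      moreover have "\<forall>s\<in>carrier S. normalizes (f1 s) ?K"
      proof
        fix s assume s: "s \<in> carrier S"
        have n: "normalizes (f1 s) H"
          using f1(1) s by (intro normalizes_coset[OF H norm[OF s]]) (simp add: sections_def)
        have fx: "act (f1 s) x = x" using f1(2) s by (simp add: fix_by_def)
        have c: "act (conjg a h) x = x" if "act a x = x" "act h x = x" for a h
          using that act_add[OF x, of "a + h" "- a"] act_add[OF x, of a h] act_minus_fixed[OF that(1) x]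
          by (simp add: conjg_def)
        show "normalizes (f1 s) ?K"
          using n c fx act_minus_fixed[OF fx x] by (auto simp: normalizes_def)
      qed
      ultimately show ?thesis
        using good unfolding good_def sections_fixing_point[OF x f1] by blast
    qed (simp only: card.empty dvd_0_right)
    then have "?o * gcd Q (card ?K) dvd ?o * card {f \<in> Sections. x \<in> fix_by f}" by (rule mult_dvd_mono[OF dvd_refl])
    then show "gcd Q (card H) dvd ?o * card {f \<in> Sections. x \<in> fix_by f}"
      by (rule dvd_trans[OF gcd_dvd_index_mult_gcd[OF o]])
  qed
  then show ?thesis using eq by simp
qed

theorem prime_power_dvd_card_sections:
  assumes prime: "prime p" and S: "order S = p ^ l" and \<Omega>: "\<not> p dvd card \<Omega>"
    and j: "p ^ j dvd Q" "p ^ j dvd card H"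
  shows "p ^ j dvd card (Sections)"
proof -
  \<comment> \<open>By Euler's theorem the \<open>r\<close>-th power of a number prime to
    \<open>p\<close> is 1 modulo \<open>p ^ j\<close>, so the sum weighted by these powers is
    congruent to the number of sections.\<close>
  define r where "r = totient (p ^ j)"
  have r0: "r > 0" using prime by (simp add: r_def prime_gt_0_nat)
  have "[card (fix_by f) ^ r = 1] (mod p ^ j)" if f: "f \<in> Sections" for f
  proof -
    have h: "f \<in> homs0 S" using f by (simp add: sections_def)
    have "[card \<Omega> = card {x \<in> \<Omega>. \<forall>s\<in>carrier S. act (f s) x = x}] (mod p)"
    proof (rule card_fixed_points_cong[OF prime S _ finite_\<Omega>])
      show "acts_on S (\<lambda>s. act (f s)) \<Omega>"
        using act_zero act_add act_section[OF f] homs0_add[OF h] homs0_one[OF h] by (intro acts_onI) simp_all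
    qed
    then have "\<not> p dvd card (fix_by f)"
      using \<Omega> unfolding fix_by_def by (simp add: cong_def dvd_eq_mod_eq_0)
    then have "coprime (card (fix_by f)) (p ^ j)"
      using prime by (simp add: prime_imp_coprime coprime_commute)
    then show ?thesis unfolding r_def by (rule euler_theorem)
  qed
  then have "[(\<Sum>f\<in>Sections. card (fix_by f) ^ r) = (\<Sum>f\<in>Sections. 1)] (mod p ^ j)" by (rule cong_sum)
  moreover have "p ^ j dvd (\<Sum>f\<in>Sections. card (fix_by f) ^ r)"
  proof -
    \<comment> \<open>The \<open>r\<close>-th power of the number of fixed points is the number of
      fixed \<open>r\<close>-tuples, so \<open>dvd_sum_fix_by\<close> is applied to the diagonal
      action on tuples.\<close>
    let ?O = "{..<r} \<rightarrow>\<^sub>E \<Omega>" and ?act = "\<lambda>a \<omega>. \<lambda>i\<in>{..<r}. act a (\<omega> i)"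
    interpret P: section_action S p Q H f0 ?act ?O
    proof (unfold_locales)
      show "finite ?O" using finite_\<Omega> by (simp add: finite_PiE)
      show "?act 0 \<omega> = \<omega>" if "\<omega> \<in> ?O" for \<omega>
      proof
        fix i show "?act 0 \<omega> i = \<omega> i"
          using that act_zero[of "\<omega> i"] by (cases "i < r") (auto simp: PiE_iff extensional_def)
      qed
      show "?act (a + b) \<omega> = ?act a (?act b \<omega>)" if "\<omega> \<in> ?O" for a b \<omega>
        by (rule restrict_ext) (use that act_add in \<open>auto simp: PiE_iff\<close>)
      show "?act h \<omega> \<in> ?O" if "h \<in> H" "\<omega> \<in> ?O" for h \<omega>
        using that act_H by (auto simp: PiE_iff)
      show "?act (f0 s) \<omega> \<in> ?O" if "s \<in> carrier S" "\<omega> \<in> ?O" for s \<omega>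
        using that act_S by (auto simp: PiE_iff)
      show "\<exists>i. card K = p ^ i"
        if K: "add_subgroup K" "K \<subseteq> H" and \<omega>: "\<omega> \<in> ?O" and fx: "\<And>k. k \<in> K \<Longrightarrow> ?act k \<omega> = \<omega>" for K \<omega>
      proof (rule stab[OF K])
        \<comment> \<open>A subgroup fixing a tuple fixes its entry at 0, which exists because
          \<open>r\<close> is positive.\<close>
        show "\<omega> 0 \<in> \<Omega>" using \<omega> r0 by (auto simp: PiE_iff)
        fix k assume "k \<in> K"
        from fx[OF this] have "?act k \<omega> 0 = \<omega> 0" by (rule fun_cong)
        then show "act k (\<omega> 0) = \<omega> 0" using r0 by simp
      qed
    qed (use finite_S H finite_H hom norm good in auto)
    have "card (P.fix_by f) = card (fix_by f) ^ r" for f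
    proof -
      have iff: "?act a \<omega> = \<omega> \<longleftrightarrow> (\<forall>i<r. act a (\<omega> i) = \<omega> i)" if "\<omega> \<in> ?O" for a \<omega>
      proof
        assume e: "?act a \<omega> = \<omega>"
        show "\<forall>i<r. act a (\<omega> i) = \<omega> i"
        proof (intro allI impI)
          fix i assume "i < r"
          then show "act a (\<omega> i) = \<omega> i" using fun_cong[OF e, of i] by simp
        qed
      next
        assume e: "\<forall>i<r. act a (\<omega> i) = \<omega> i"
        show "?act a \<omega> = \<omega>"
        proof
          fix i show "?act a \<omega> i = \<omega> i"
            using e that by (cases "i < r") (auto simp: PiE_iff extensional_def)
        qed
      qed
      have "P.fix_by f = {..<r} \<rightarrow>\<^sub>E fix_by f"
      proof (intro equalityI subsetI)
        fix \<omega> assume "\<omega> \<in> P.fix_by f"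
        then have "\<omega> \<in> ?O" "\<forall>s\<in>carrier S. \<forall>i<r. act (f s) (\<omega> i) = \<omega> i"
          using iff unfolding P.fix_by_def by blast+
        then show "\<omega> \<in> {..<r} \<rightarrow>\<^sub>E fix_by f" by (simp add: PiE_iff fix_by_def)
      next
        fix \<omega> assume \<omega>: "\<omega> \<in> {..<r} \<rightarrow>\<^sub>E fix_by f"
        then have wO: "\<omega> \<in> ?O" by (simp add: PiE_iff fix_by_def)
        have "?act (f s) \<omega> = \<omega>" if "s \<in> carrier S" for s
          unfolding iff[OF wO] using \<omega> that by (simp add: PiE_iff fix_by_def)
        then show "\<omega> \<in> P.fix_by f" using wO unfolding P.fix_by_def by blast
      qed
      then show ?thesis by (simp add: card_PiE)
    qed
    then have "gcd Q (card H) dvd (\<Sum>f\<in>Sections. card (fix_by f) ^ r)"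
      using P.dvd_sum_fix_by[OF prime] by simp
    moreover have "p ^ j dvd gcd Q (card H)" using j by simp
    ultimately show ?thesis by (rule dvd_trans[rotated])
  qed
  ultimately show ?thesis by (simp add: cong_dvd_iff)
qed

end

section \<open>Homomorphisms with a prescribed restriction\<close>

text \<open>The permutations of a type serve as ambient additive group, in which the extension of
  \<open>B\<close> by \<open>L\<close> is realized by affine maps.\<close>

typedef 'b sym = "{f :: 'b \<Rightarrow> 'b. bij f}"
  by (rule exI[of _ id]) simp

instantiation sym :: (type) group_add
begin

definition "0 = Abs_sym id"
definition "f + g = Abs_sym (Rep_sym f \<circ> Rep_sym g)"
definition "- f = Abs_sym (Hilbert_Choice.inv (Rep_sym f))"
definition "f - g = f + - (g :: 'a sym)"

lemma bij_Rep_sym: "bij (Rep_sym f)"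
  using Rep_sym[of f] by simp

lemma Rep_sym_simps:
  "Rep_sym 0 = id" "Rep_sym (f + g) = Rep_sym f \<circ> Rep_sym g"
  "Rep_sym (- f) = Hilbert_Choice.inv (Rep_sym f)"
  by (simp_all add: zero_sym_def plus_sym_def uminus_sym_def Abs_sym_inverse bij_Rep_sym bij_comp bij_imp_bij_inv)

instance
proof
  fix a b c :: "'a sym"
  show "a + b + c = a + (b + c)" "0 + a = a" "a + 0 = a" "a + - b = a - b"
    by (simp_all add: Rep_sym_inject[symmetric] Rep_sym_simps minus_sym_def comp_assoc)
  show "- a + a = 0"
    using bij_is_inj[OF bij_Rep_sym[of a]] by (simp add: Rep_sym_inject[symmetric] Rep_sym_simps)
qed

end

text \<open>\<open>h0\<close> is the chosen base point of the set of homomorphisms that agree with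
  it on the kernel of \<open>\<pi>\<close>.\<close>

locale hom_fibre = group G for G :: "('b, 'n) monoid_scheme" (structure) +
  fixes F :: "('a, 'm) monoid_scheme" and B :: "('s, 'k) monoid_scheme"
    and \<pi> :: "'a \<Rightarrow> 's" and h0 :: "'a \<Rightarrow> 'b"
  assumes F: "group F" and B: "group B" and finite_G: "finite (carrier G)"
    and \<pi>: "\<pi> \<in> hom F B" and surj: "\<pi> ` carrier F = carrier B" and h0: "h0 \<in> hom F G"
begin

sublocale F: group F by (rule F)
sublocale B: group B by (rule B)
sublocale p: group_hom F B \<pi> using \<pi> by unfold_locales
sublocale h: group_hom F G h0 using h0 by unfold_locales

definition "K = {f \<in> carrier F. \<pi> f = \<one>\<^bsub>B\<^esub>}"
definition "L = {g \<in> carrier G. \<forall>k\<in>K. g \<otimes> h0 k = h0 k \<otimes> g}"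
definition "fibre = {\<phi> \<in> Homs F G. \<forall>k\<in>K. \<phi> k = h0 k}"

lemma K_carrier: "k \<in> K \<Longrightarrow> k \<in> carrier F"
  by (simp add: K_def)

lemma L_carrier: "l \<in> L \<Longrightarrow> l \<in> carrier G"
  by (simp add: L_def)

lemma L_comm: "l \<in> L \<Longrightarrow> k \<in> K \<Longrightarrow> l \<otimes> h0 k = h0 k \<otimes> l"
  by (simp add: L_def)

lemma L_memI: "g \<in> carrier G \<Longrightarrow> (\<And>k. k \<in> K \<Longrightarrow> g \<otimes> h0 k = h0 k \<otimes> g) \<Longrightarrow> g \<in> L"
  by (simp add: L_def)

lemma K_conj: "f \<in> carrier F \<Longrightarrow> k \<in> K \<Longrightarrow> inv\<^bsub>F\<^esub> f \<otimes>\<^bsub>F\<^esub> k \<otimes>\<^bsub>F\<^esub> f \<in> K"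
  by (simp add: K_def)

lemma subgroup_L: "subgroup L G"
proof (rule subgroupI)
  show "L \<subseteq> carrier G" using L_carrier by blast
  have "\<one> \<in> L" using K_carrier by (simp add: L_def)
  then show "L \<noteq> {}" by blast
  fix a assume a: "a \<in> L"
  show "inv a \<in> L"
  proof (rule L_memI)
    fix k assume k: "k \<in> K"
    have c: "a \<in> carrier G" "h0 k \<in> carrier G" using a k L_carrier K_carrier by auto
    have "inv a \<otimes> h0 k = inv a \<otimes> (h0 k \<otimes> a) \<otimes> inv a" using c by (simp add: m_assoc)
    also have "\<dots> = inv a \<otimes> (a \<otimes> h0 k) \<otimes> inv a" using L_comm[OF a k] by simp
    also have "\<dots> = h0 k \<otimes> inv a" using c by (simp add: m_assoc[symmetric])
    finally show "inv a \<otimes> h0 k = h0 k \<otimes> inv a" .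
  qed (simp add: L_carrier[OF a])
  fix c assume c: "c \<in> L"
  show "a \<otimes> c \<in> L"
  proof (rule L_memI)
    fix k assume k: "k \<in> K"
    have m: "a \<in> carrier G" "c \<in> carrier G" "h0 k \<in> carrier G" using a c k L_carrier K_carrier by auto
    have "a \<otimes> c \<otimes> h0 k = a \<otimes> (h0 k \<otimes> c)" using m L_comm[OF c k] by (simp add: m_assoc)
    also have "\<dots> = (h0 k \<otimes> a) \<otimes> c" using m L_comm[OF a k] by (simp add: m_assoc[symmetric])
    finally show "a \<otimes> c \<otimes> h0 k = h0 k \<otimes> (a \<otimes> c)" using m by (simp add: m_assoc)
  qed (simp add: L_carrier a c)
qed

lemma L_mult: "a \<in> L \<Longrightarrow> c \<in> L \<Longrightarrow> a \<otimes> c \<in> L"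
  and L_inv: "a \<in> L \<Longrightarrow> inv a \<in> L"
  and L_one: "\<one> \<in> L"
  using subgroup_L subgroup.m_closed subgroup.m_inv_closed subgroup.one_closed by metis+

lemma finite_L: "finite L"
  using finite_G L_carrier by (meson finite_subset subsetI)

text \<open>\<open>K\<close> is normal in \<open>F\<close>, so \<open>h0 f\<close> normalizes the
  image of \<open>K\<close> and hence its centralizer.\<close>

lemma L_conj:
  assumes f: "f \<in> carrier F" and l: "l \<in> L" shows "h0 f \<otimes> l \<otimes> inv h0 f \<in> L"
proof (rule L_memI)
  fix k assume k: "k \<in> K"
  let ?k = "inv\<^bsub>F\<^esub> f \<otimes>\<^bsub>F\<^esub> k \<otimes>\<^bsub>F\<^esub> f"
  have c: "h0 f \<in> carrier G" "l \<in> carrier G" "h0 k \<in> carrier G" "k \<in> carrier F"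
    using f l k L_carrier K_carrier by auto
  have e: "h0 ?k = inv h0 f \<otimes> h0 k \<otimes> h0 f" using f c by simp
  have "h0 f \<otimes> l \<otimes> inv h0 f \<otimes> h0 k = h0 f \<otimes> (l \<otimes> h0 ?k) \<otimes> inv h0 f"
    unfolding e using c by (simp add: m_assoc)
  also have "\<dots> = h0 f \<otimes> (h0 ?k \<otimes> l) \<otimes> inv h0 f"
    using L_comm[OF l K_conj[OF f k]] by simp
  also have "\<dots> = h0 k \<otimes> (h0 f \<otimes> l \<otimes> inv h0 f)"
    unfolding e using c by (simp add: m_assoc[symmetric])
  finally show "h0 f \<otimes> l \<otimes> inv h0 f \<otimes> h0 k = h0 k \<otimes> (h0 f \<otimes> l \<otimes> inv h0 f)" .
qed (simp add: f L_carrier[OF l])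

lemma L_conj':
  assumes "f \<in> carrier F" "l \<in> L" shows "inv h0 f \<otimes> l \<otimes> h0 f \<in> L"
  using L_conj[of "inv\<^bsub>F\<^esub> f" l] assms by simp

text \<open>On \<open>L\<close>, multiplication by \<open>h0 f \<otimes> l\<close> followed by right
  division by \<open>h0 f\<close>, which leads back into \<open>L\<close>. It is the identity
  elsewhere, so as to be a permutation of the whole type.\<close>

definition aff :: "'a \<Rightarrow> 'b \<Rightarrow> 'b \<Rightarrow> 'b" where
  "aff f l x = (if x \<in> L then h0 f \<otimes> l \<otimes> x \<otimes> inv h0 f else x)"

lemma aff_L: "f \<in> carrier F \<Longrightarrow> l \<in> L \<Longrightarrow> x \<in> L \<Longrightarrow> aff f l x \<in> L"
  using L_conj[of f "l \<otimes> x"] L_mult by (simp add: aff_def m_assoc L_carrier)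

lemma aff_comp:
  assumes "f \<in> carrier F" "f' \<in> carrier F" "l \<in> L" "l' \<in> L"
  shows "aff f l \<circ> aff f' l' = aff (f \<otimes>\<^bsub>F\<^esub> f') (inv h0 f' \<otimes> l \<otimes> h0 f' \<otimes> l')"
proof
  fix x
  show "(aff f l \<circ> aff f' l') x = aff (f \<otimes>\<^bsub>F\<^esub> f') (inv h0 f' \<otimes> l \<otimes> h0 f' \<otimes> l') x"
  proof (cases "x \<in> L")
    case True
    have "aff f' l' x \<in> L" using aff_L assms True by blast
    moreover have c: "h0 f \<in> carrier G" "h0 f' \<in> carrier G" "l \<in> carrier G" "l' \<in> carrier G" "x \<in> carrier G"
      using assms True L_carrier by auto
    have "h0 f' \<otimes> (inv h0 f' \<otimes> (l \<otimes> y)) = l \<otimes> y" if "y \<in> carrier G" for y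
      using c that by (simp add: m_assoc[symmetric])
    ultimately show ?thesis using True assms c by (simp add: aff_def m_assoc inv_mult_group)
  qed (simp add: aff_def)
qed

lemma aff_one: "aff \<one>\<^bsub>F\<^esub> \<one> = id"
  by (auto simp: aff_def fun_eq_iff L_carrier)

lemma bij_aff:
  assumes f: "f \<in> carrier F" and l: "l \<in> L" shows "bij (aff f l)"
proof (rule o_bij)
  let ?l = "h0 f \<otimes> inv l \<otimes> inv h0 f"
  have l': "?l \<in> L" using L_conj L_inv f l by blast
  have c: "h0 f \<in> carrier G" "l \<in> carrier G" using f l L_carrier by auto
  have "inv h0 f \<otimes> ?l \<otimes> h0 f \<otimes> l = inv h0 f \<otimes> h0 f \<otimes> inv l \<otimes> (inv h0 f \<otimes> h0 f) \<otimes> l"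
    using c by (simp only: m_assoc inv_closed m_closed)
  then have "inv h0 f \<otimes> ?l \<otimes> h0 f \<otimes> l = \<one>" using c by simp
  then show "aff (inv\<^bsub>F\<^esub> f) ?l \<circ> aff f l = id"
    using aff_comp[of "inv\<^bsub>F\<^esub> f" f ?l l] f l l' aff_one by simp
  have "inv h0 (inv\<^bsub>F\<^esub> f) \<otimes> l \<otimes> h0 (inv\<^bsub>F\<^esub> f) \<otimes> ?l = h0 f \<otimes> l \<otimes> (inv h0 f \<otimes> h0 f) \<otimes> inv l \<otimes> inv h0 f"
    using c f by (simp only: h.hom_inv inv_inv m_assoc inv_closed m_closed)
  also have "\<dots> = h0 f \<otimes> (l \<otimes> inv l) \<otimes> inv h0 f" using c by (simp only: l_inv m_assoc inv_closed m_closed l_one one_closed)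
  finally have "inv h0 (inv\<^bsub>F\<^esub> f) \<otimes> l \<otimes> h0 (inv\<^bsub>F\<^esub> f) \<otimes> ?l = \<one>" using c by simp
  then show "aff f l \<circ> aff (inv\<^bsub>F\<^esub> f) ?l = id"
    using aff_comp[of f "inv\<^bsub>F\<^esub> f" l ?l] f l l' aff_one by simp
qed

definition affs :: "'a \<Rightarrow> 'b \<Rightarrow> 'b sym" where
  "affs f l = Abs_sym (aff f l)"

lemma Rep_affs: "f \<in> carrier F \<Longrightarrow> l \<in> L \<Longrightarrow> Rep_sym (affs f l) = aff f l"
  using bij_aff by (simp add: affs_def Abs_sym_inverse)

lemma affs_add:
  assumes "f \<in> carrier F" "f' \<in> carrier F" "l \<in> L" "l' \<in> L"
  shows "affs f l + affs f' l' = affs (f \<otimes>\<^bsub>F\<^esub> f') (inv h0 f' \<otimes> l \<otimes> h0 f' \<otimes> l')"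
proof -
  have "affs f l + affs f' l' = Abs_sym (aff f l \<circ> aff f' l')"
    by (simp only: plus_sym_def Rep_affs[OF assms(1,3)] Rep_affs[OF assms(2,4)])
  then show ?thesis by (simp only: aff_comp[OF assms] affs_def)
qed

lemma affs_one: "affs \<one>\<^bsub>F\<^esub> \<one> = 0"
  by (simp add: affs_def zero_sym_def aff_one)

lemma affs_inject:
  assumes "f \<in> carrier F" "l \<in> L" "l' \<in> L" "affs f l = affs f l'" shows "l = l'"
proof -
  have "aff f l = aff f l'" using Rep_affs assms by metis
  then have "aff f l \<one> = aff f l' \<one>" by simp
  then show ?thesis using assms L_one L_carrier by (simp add: aff_def)
qed

lemma conj_mult_commuting:
  assumes "a \<in> carrier G" "u \<in> carrier G" "y \<in> carrier G" "y \<otimes> u = u \<otimes> y"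
  shows "(a \<otimes> u) \<otimes> y \<otimes> inv (a \<otimes> u) = a \<otimes> y \<otimes> inv a"
proof -
  have "(a \<otimes> u) \<otimes> y \<otimes> inv (a \<otimes> u) = a \<otimes> (u \<otimes> y) \<otimes> inv u \<otimes> inv a"
    using assms by (simp add: m_assoc inv_mult_group)
  also have "\<dots> = a \<otimes> y \<otimes> inv a"
    unfolding assms(4)[symmetric] using assms(1-3) by (simp add: m_assoc)
  finally show ?thesis .
qed

text \<open>\<open>f\<close> and \<open>f'\<close> differ by some \<open>k \<in> K\<close> whose
  image commutes with \<open>L\<close>, so it cancels. Hence the affine maps depend on
  \<open>f\<close> only through \<open>\<pi> f\<close>, and homomorphisms on \<open>B\<close> can be
  built from them.\<close>

lemma aff_cong:
  assumes f: "f \<in> carrier F" "f' \<in> carrier F" "\<pi> f = \<pi> f'" and l: "l \<in> L"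
  shows "aff f l = aff f' l"
proof
  fix x
  let ?k = "inv\<^bsub>F\<^esub> f \<otimes>\<^bsub>F\<^esub> f'"
  have k: "?k \<in> K" using f by (simp add: K_def)
  have e: "h0 f' = h0 f \<otimes> h0 ?k" using f by (simp add: m_assoc[symmetric])
  show "aff f l x = aff f' l x"
  proof (cases "x \<in> L")
    case True
    have c: "h0 f \<in> carrier G" "h0 ?k \<in> carrier G" "l \<otimes> x \<in> carrier G"
      using f k K_carrier L_carrier l True by auto
    have "h0 f' \<otimes> (l \<otimes> x) \<otimes> inv h0 f' = h0 f \<otimes> (l \<otimes> x) \<otimes> inv h0 f"
      unfolding e by (rule conj_mult_commuting[OF c L_comm[OF L_mult[OF l True] k]])
    then show ?thesis using True f l L_carrier by (simp add: aff_def m_assoc)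
  qed (simp add: aff_def)
qed

lemma affs_cong:
  "f \<in> carrier F \<Longrightarrow> f' \<in> carrier F \<Longrightarrow> \<pi> f = \<pi> f' \<Longrightarrow> l \<in> L \<Longrightarrow> affs f l = affs f' l"
  unfolding affs_def by (rule arg_cong[OF aff_cong])

abbreviation "transl \<equiv> affs \<one>\<^bsub>F\<^esub>"

definition "H = transl ` L"

lemma transl_add: "l \<in> L \<Longrightarrow> l' \<in> L \<Longrightarrow> transl l + transl l' = transl (l \<otimes> l')"
  using affs_add[of "\<one>\<^bsub>F\<^esub>" "\<one>\<^bsub>F\<^esub>" l l'] L_carrier by simp

lemma add_subgroup_H: "add_subgroup H"
  unfolding add_subgroup_def
proof (intro conjI ballI)
  show "0 \<in> H" using affs_one L_one by (metis H_def image_eqI)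
  fix x assume "x \<in> H"
  then obtain l where l: "l \<in> L" "x = transl l" by (auto simp: H_def)
  have "x + transl (inv l) = 0"
    unfolding l(2) transl_add[OF l(1) L_inv[OF l(1)]] using l L_carrier affs_one by simp
  then have "- x = transl (inv l)" by (rule minus_unique)
  then show "- x \<in> H" using L_inv[OF l(1)] by (simp add: H_def)
  fix y assume "y \<in> H"
  then obtain l' where "l' \<in> L" "y = transl l'" by (auto simp: H_def)
  then show "x + y \<in> H" using transl_add l L_mult by (auto simp: H_def)
qed

lemma card_H: "card H = card L"
  unfolding H_def by (rule card_image) (use affs_inject in \<open>auto intro!: inj_onI\<close>)

lemma finite_H: "finite H"
  using finite_L by (simp add: H_def)

section \<open>Homomorphisms in a fibre as sections\<close>

definition rep :: "'s \<Rightarrow> 'a" where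
  "rep a = (SOME f. f \<in> carrier F \<and> \<pi> f = a)"

lemma rep: "a \<in> carrier B \<Longrightarrow> rep a \<in> carrier F" "a \<in> carrier B \<Longrightarrow> \<pi> (rep a) = a"
proof -
  have "rep a \<in> carrier F \<and> \<pi> (rep a) = a" if "a \<in> carrier B"
    unfolding rep_def
  proof (rule someI_ex)
    have "a \<in> \<pi> ` carrier F" using that surj by simp
    then show "\<exists>f. f \<in> carrier F \<and> \<pi> f = a" by blast
  qed
  then show "a \<in> carrier B \<Longrightarrow> rep a \<in> carrier F" "a \<in> carrier B \<Longrightarrow> \<pi> (rep a) = a" by auto
qed

lemma surjE:
  assumes "a \<in> carrier B" obtains f where "f \<in> carrier F" "a = \<pi> f"
  using rep[OF assms] by metis

text \<open>By \<open>diff_L\<close> a member of the fibre sends \<open>f\<close> to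
  \<open>h0 f \<otimes> l\<close> with \<open>l \<in> L\<close>; the section sends
  \<open>\<pi> f\<close> to the corresponding affine map. The choice of representative does not
  matter, by \<open>encode_\<pi>\<close>.\<close>

definition encode :: "('a \<Rightarrow> 'b) \<Rightarrow> 's \<Rightarrow> 'b sym" where
  "encode \<phi> a = (if a \<in> carrier B then affs (rep a) (inv h0 (rep a) \<otimes> \<phi> (rep a)) else 0)"

lemma fibreD:
  assumes "\<phi> \<in> fibre"
  shows "\<phi> \<in> hom F G" "\<And>k. k \<in> K \<Longrightarrow> \<phi> k = h0 k"
  using assms by (auto simp: fibre_def Homs_def)

text \<open>\<open>\<phi>\<close> and \<open>h0\<close> agree on \<open>k\<close> and on its
  conjugate by \<open>f\<close>; comparing the two expressions for the image of the conjugate shows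
  that \<open>inv h0 f \<otimes> \<phi> f\<close> commutes with \<open>h0 k\<close>.\<close>

lemma diff_L:
  assumes \<phi>: "\<phi> \<in> fibre" and f: "f \<in> carrier F"
  shows "inv h0 f \<otimes> \<phi> f \<in> L"
proof -
  interpret g: group_hom F G \<phi> using fibreD(1)[OF \<phi>] by unfold_locales
  show ?thesis
  proof (rule L_memI)
    fix k assume k: "k \<in> K"
    let ?k = "f \<otimes>\<^bsub>F\<^esub> k \<otimes>\<^bsub>F\<^esub> inv\<^bsub>F\<^esub> f"
    have kF: "k \<in> carrier F" using k K_carrier by blast
    have k': "?k \<in> K" using K_conj[of "inv\<^bsub>F\<^esub> f" k] f k by simp
    have "\<phi> ?k = h0 ?k" by (rule fibreD(2)[OF \<phi> k'])
    then have e: "\<phi> f \<otimes> \<phi> k \<otimes> inv \<phi> f = h0 f \<otimes> h0 k \<otimes> inv h0 f" using f kF by simp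
    have "\<phi> f \<otimes> \<phi> k = \<phi> f \<otimes> \<phi> k \<otimes> inv \<phi> f \<otimes> \<phi> f" using f kF by (simp add: m_assoc)
    also have "\<dots> = h0 f \<otimes> h0 k \<otimes> inv h0 f \<otimes> \<phi> f" unfolding e ..
    finally have "inv h0 f \<otimes> (\<phi> f \<otimes> \<phi> k) = inv h0 f \<otimes> (h0 f \<otimes> h0 k \<otimes> inv h0 f \<otimes> \<phi> f)" by simp
    also have "\<dots> = (inv h0 f \<otimes> h0 f) \<otimes> h0 k \<otimes> (inv h0 f \<otimes> \<phi> f)"
      using f kF by (simp only: m_assoc h.hom_closed g.hom_closed inv_closed m_closed)
    finally show "inv h0 f \<otimes> \<phi> f \<otimes> h0 k = h0 k \<otimes> (inv h0 f \<otimes> \<phi> f)"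
      using f kF fibreD(2)[OF \<phi> k] by (simp add: m_assoc)
  qed (simp add: f)
qed

lemma encode_\<pi>:
  assumes \<phi>: "\<phi> \<in> fibre" and f: "f \<in> carrier F"
  shows "encode \<phi> (\<pi> f) = affs f (inv h0 f \<otimes> \<phi> f)"
proof -
  interpret g: group_hom F G \<phi> using fibreD(1)[OF \<phi>] by unfold_locales
  let ?f = "rep (\<pi> f)" and ?k = "inv\<^bsub>F\<^esub> f \<otimes>\<^bsub>F\<^esub> rep (\<pi> f)"
  have r: "?f \<in> carrier F" "\<pi> ?f = \<pi> f" using rep f by auto
  have k: "?k \<in> K" using f r by (simp add: K_def)
  have kF: "?k \<in> carrier F" using f r by simp
  have e: "?f = f \<otimes>\<^bsub>F\<^esub> ?k" using f r by (simp add: F.m_assoc[symmetric])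
  have "inv h0 ?f \<otimes> \<phi> ?f = inv (h0 f \<otimes> h0 ?k) \<otimes> (\<phi> f \<otimes> \<phi> ?k)"
    by (subst e, subst e) (use f kF in \<open>simp only: h.hom_mult g.hom_mult\<close>)
  also have "\<dots> = inv h0 ?k \<otimes> ((inv h0 f \<otimes> \<phi> f) \<otimes> h0 ?k)"
    using f kF fibreD(2)[OF \<phi> k] by (simp only: inv_mult_group m_assoc h.hom_closed g.hom_closed inv_closed m_closed)
  also have "\<dots> = inv h0 ?k \<otimes> (h0 ?k \<otimes> (inv h0 f \<otimes> \<phi> f))"
    using L_comm[OF diff_L[OF \<phi> f] k] by simp
  also have "\<dots> = (inv h0 ?k \<otimes> h0 ?k) \<otimes> (inv h0 f \<otimes> \<phi> f)"
    using f kF by (simp only: m_assoc h.hom_closed g.hom_closed inv_closed m_closed)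
  also have "\<dots> = inv h0 f \<otimes> \<phi> f" using h.hom_closed[OF kF] f by (simp only: l_inv l_one h.hom_closed g.hom_closed inv_closed m_closed)
  finally have "inv h0 ?f \<otimes> \<phi> ?f = inv h0 f \<otimes> \<phi> f" .
  then show ?thesis
    using affs_cong[OF r(1) f r(2)] diff_L[OF \<phi> f] f by (simp add: encode_def)
qed

lemma encode_homs0:
  assumes \<phi>: "\<phi> \<in> fibre" shows "encode \<phi> \<in> homs0 B"
proof -
  interpret g: group_hom F G \<phi> using fibreD(1)[OF \<phi>] by unfold_locales
  have "encode \<phi> (a \<otimes>\<^bsub>B\<^esub> c) = encode \<phi> a + encode \<phi> c"
    if ac: "a \<in> carrier B" "c \<in> carrier B" for a c
  proof -
    obtain f f' where f: "f \<in> carrier F" "a = \<pi> f" "f' \<in> carrier F" "c = \<pi> f'"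
      using surjE[OF ac(1)] surjE[OF ac(2)] by metis
    have m: "a \<otimes>\<^bsub>B\<^esub> c = \<pi> (f \<otimes>\<^bsub>F\<^esub> f')" using f by simp
    have c: "h0 f \<in> carrier G" "h0 f' \<in> carrier G" "\<phi> f \<in> carrier G" "\<phi> f' \<in> carrier G" using f by auto
    have "inv h0 f' \<otimes> (inv h0 f \<otimes> \<phi> f) \<otimes> h0 f' \<otimes> (inv h0 f' \<otimes> \<phi> f')
        = inv h0 f' \<otimes> (inv h0 f \<otimes> \<phi> f) \<otimes> (h0 f' \<otimes> inv h0 f') \<otimes> \<phi> f'"
      using c by (simp only: m_assoc inv_closed m_closed)
    also have "\<dots> = inv (h0 f \<otimes> h0 f') \<otimes> (\<phi> f \<otimes> \<phi> f')"
      using c by (simp add: m_assoc inv_mult_group)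
    finally have e: "inv h0 f' \<otimes> (inv h0 f \<otimes> \<phi> f) \<otimes> h0 f' \<otimes> (inv h0 f' \<otimes> \<phi> f') = inv (h0 f \<otimes> h0 f') \<otimes> (\<phi> f \<otimes> \<phi> f')" .
    show ?thesis
      unfolding m encode_\<pi>[OF \<phi> F.m_closed[OF f(1,3)]] unfolding f(2,4) encode_\<pi>[OF \<phi> f(1)] encode_\<pi>[OF \<phi> f(3)]
        affs_add[OF f(1,3) diff_L[OF \<phi> f(1)] diff_L[OF \<phi> f(3)]] e
      using f by simp
  qed
  then show ?thesis by (simp add: homs0_def encode_def)
qed

lemma h0_restrict_fibre: "restrict h0 (carrier F) \<in> fibre"
  using h0 K_carrier by (auto simp: fibre_def Homs_def hom_def)

text \<open>The section that belongs to \<open>h0\<close>: its value at \<open>\<pi> f\<close>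
  conjugates \<open>L\<close> by \<open>h0 f\<close>.\<close>

definition "base = encode (restrict h0 (carrier F))"

lemma base_\<pi>: "f \<in> carrier F \<Longrightarrow> base (\<pi> f) = affs f \<one>"
  using encode_\<pi>[OF h0_restrict_fibre] by (simp add: base_def)

lemma base_homs0: "base \<in> homs0 B"
  unfolding base_def by (rule encode_homs0[OF h0_restrict_fibre])

lemma affs_split:
  assumes "f \<in> carrier F" "l \<in> L" shows "affs f l = affs f \<one> + transl l"
  using affs_add[of f "\<one>\<^bsub>F\<^esub>" \<one> l] assms L_one L_carrier by simp

lemma encode_sections:
  assumes \<phi>: "\<phi> \<in> fibre" shows "encode \<phi> \<in> sections B H base"
proof -
  have "- base a + encode \<phi> a \<in> H" if aB: "a \<in> carrier B" for a
  proof -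
    obtain f where f: "f \<in> carrier F" "a = \<pi> f" using surjE[OF aB] .
    show ?thesis
      unfolding f(2) encode_\<pi>[OF \<phi> f(1)] affs_split[OF f(1) diff_L[OF \<phi> f(1)]] base_\<pi>[OF f(1)]
      using diff_L[OF \<phi> f(1)] by (simp add: H_def)
  qed
  then show ?thesis using encode_homs0[OF \<phi>] by (simp add: sections_def)
qed

lemma section_affs:
  assumes \<Psi>: "\<Psi> \<in> sections B H base" and f: "f \<in> carrier F"
  obtains l where "l \<in> L" "\<Psi> (\<pi> f) = affs f l"
proof -
  have "- base (\<pi> f) + \<Psi> (\<pi> f) \<in> H" using \<Psi> f by (simp add: sections_def)
  then obtain l where l: "l \<in> L" "- base (\<pi> f) + \<Psi> (\<pi> f) = transl l" by (auto simp: H_def)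
  have "\<Psi> (\<pi> f) = base (\<pi> f) + (- base (\<pi> f) + \<Psi> (\<pi> f))" by simp
  also have "\<dots> = affs f l" by (simp only: l(2)) (simp only: base_\<pi>[OF f] affs_split[OF f l(1)])
  finally have "\<Psi> (\<pi> f) = affs f l" .
  then show ?thesis using that l(1) by blast
qed

text \<open>The affine map of \<open>f\<close> and \<open>l\<close> sends the identity to
  \<open>h0 f \<otimes> l \<otimes> inv h0 f\<close>; multiplying by \<open>h0 f\<close> recovers
  \<open>h0 f \<otimes> l\<close>.\<close>

definition decode :: "('s \<Rightarrow> 'b sym) \<Rightarrow> 'a \<Rightarrow> 'b" where
  "decode \<Psi> = (\<lambda>f\<in>carrier F. Rep_sym (\<Psi> (\<pi> f)) \<one> \<otimes> h0 f)"

lemma decode_affs: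
  assumes "f \<in> carrier F" "l \<in> L" "\<Psi> (\<pi> f) = affs f l"
  shows "decode \<Psi> f = h0 f \<otimes> l"
  using assms L_one L_carrier by (simp add: decode_def Rep_affs aff_def m_assoc)

lemma decode_fibre:
  assumes \<Psi>: "\<Psi> \<in> sections B H base" shows "decode \<Psi> \<in> fibre"
proof -
  have hom: "\<Psi> \<in> homs0 B" using \<Psi> by (simp add: sections_def)
  have "decode \<Psi> \<in> hom F G"
  proof (rule homI)
    fix f assume f: "f \<in> carrier F"
    obtain l where l: "l \<in> L" "\<Psi> (\<pi> f) = affs f l" using section_affs[OF \<Psi> f] .
    show "decode \<Psi> f \<in> carrier G" using decode_affs[of f l \<Psi>, OF f l] f L_carrier[OF l(1)] by simp
    fix f' assume f': "f' \<in> carrier F"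
    obtain l' where l': "l' \<in> L" "\<Psi> (\<pi> f') = affs f' l'" using section_affs[OF \<Psi> f'] .
    have "\<Psi> (\<pi> (f \<otimes>\<^bsub>F\<^esub> f')) = affs f l + affs f' l'"
      using homs0_add[OF hom] f f' l l' by simp
    then have e: "\<Psi> (\<pi> (f \<otimes>\<^bsub>F\<^esub> f')) = affs (f \<otimes>\<^bsub>F\<^esub> f') (inv h0 f' \<otimes> l \<otimes> h0 f' \<otimes> l')"
      unfolding affs_add[OF f f' l(1) l'(1)] .
    have m: "inv h0 f' \<otimes> l \<otimes> h0 f' \<otimes> l' \<in> L" using L_mult L_conj' f' l l' by blast
    have c: "h0 f \<in> carrier G" "h0 f' \<in> carrier G" "l \<in> carrier G" "l' \<in> carrier G"
      using f f' l l' L_carrier by auto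
    have "h0 f \<otimes> h0 f' \<otimes> (inv h0 f' \<otimes> l \<otimes> h0 f' \<otimes> l') = h0 f \<otimes> (h0 f' \<otimes> inv h0 f') \<otimes> l \<otimes> h0 f' \<otimes> l'"
      using c by (simp only: m_assoc inv_closed m_closed)
    also have "\<dots> = (h0 f \<otimes> l) \<otimes> (h0 f' \<otimes> l')" using c by (simp add: m_assoc)
    finally show "decode \<Psi> (f \<otimes>\<^bsub>F\<^esub> f') = decode \<Psi> f \<otimes> decode \<Psi> f'"
      using decode_affs[of "f \<otimes>\<^bsub>F\<^esub> f'" _ \<Psi>, OF F.m_closed[OF f f'] m e] decode_affs[of f l \<Psi>, OF f l] decode_affs[of f' l' \<Psi>, OF f' l'] f f' by simp
  qed
  moreover have "decode \<Psi> k = h0 k" if "k \<in> K" for k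
  proof -
    have k: "k \<in> carrier F" "\<pi> k = \<one>\<^bsub>B\<^esub>" using that by (auto simp: K_def)
    then show ?thesis using B.homs0_one[OF hom] by (simp add: decode_def Rep_sym_simps)
  qed
  ultimately show ?thesis by (simp add: fibre_def Homs_def decode_def)
qed

lemma card_fibre: "card fibre = card (sections B H base)"
proof -
  have "bij_betw encode fibre (sections B H base)"
  proof (rule bij_betwI[where g = decode])
    show "encode \<in> fibre \<rightarrow> sections B H base" by (rule Pi_I) (rule encode_sections)
    show "decode \<in> sections B H base \<rightarrow> fibre" by (rule Pi_I) (rule decode_fibre)
    fix \<phi> assume \<phi>: "\<phi> \<in> fibre"
    show "decode (encode \<phi>) = \<phi>"
    proof
      fix f show "decode (encode \<phi>) f = \<phi> f"
      proof (cases "f \<in> carrier F")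
        case True
        have "\<phi> f \<in> carrier G" using fibreD(1)[OF \<phi>] True by (rule hom_in_carrier)
        moreover have "decode (encode \<phi>) f = h0 f \<otimes> (inv h0 f \<otimes> \<phi> f)"
          by (rule decode_affs[OF True diff_L[OF \<phi> True]]) (rule encode_\<pi>[OF \<phi> True])
        ultimately show ?thesis using True by (simp flip: m_assoc)
      next
        case False
        have "\<phi> \<in> extensional (carrier F)" using \<phi> by (simp add: fibre_def Homs_def)
        then show ?thesis using False by (simp add: decode_def extensional_def)
      qed
    qed
  next
    fix \<Psi> assume \<Psi>: "\<Psi> \<in> sections B H base"
    show "encode (decode \<Psi>) = \<Psi>"
    proof
      fix a show "encode (decode \<Psi>) a = \<Psi> a"
      proof (cases "a \<in> carrier B")
        case True
        then obtain f where f: "f \<in> carrier F" "a = \<pi> f" by (rule surjE)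
        obtain l where l: "l \<in> L" "\<Psi> (\<pi> f) = affs f l" using section_affs[OF \<Psi> f(1)] .
        have d: "decode \<Psi> f = h0 f \<otimes> l" by (rule decode_affs[OF f(1) l(1)]) (rule l(2))
        have "inv h0 f \<otimes> decode \<Psi> f = l"
          unfolding d using f(1) L_carrier[OF l(1)] by (simp flip: m_assoc)
        then show ?thesis unfolding f(2) encode_\<pi>[OF decode_fibre[OF \<Psi>] f(1)] l(2) by simp
      next
        case False
        then show ?thesis using \<Psi> by (simp add: encode_def sections_def homs0_def)
      qed
    qed
  qed
  then show ?thesis by (rule bij_betw_same_card)
qed

lemma conjg_affs:
  assumes f: "f \<in> carrier F" and l: "l \<in> L"
  shows "conjg (affs f \<one>) (transl l) = transl (h0 f \<otimes> l \<otimes> inv h0 f)"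
proof -
  have c: "h0 f \<in> carrier G" "l \<in> carrier G" using f l L_carrier by auto
  have "transl (h0 f \<otimes> l \<otimes> inv h0 f) + affs f \<one>
      = affs (\<one>\<^bsub>F\<^esub> \<otimes>\<^bsub>F\<^esub> f) (inv h0 f \<otimes> (h0 f \<otimes> l \<otimes> inv h0 f) \<otimes> h0 f \<otimes> \<one>)"
    by (rule affs_add[OF _ f L_conj[OF f l] L_one]) simp
  also have "inv h0 f \<otimes> (h0 f \<otimes> l \<otimes> inv h0 f) \<otimes> h0 f \<otimes> \<one> = l"
  proof -
    have "inv h0 f \<otimes> (h0 f \<otimes> l \<otimes> inv h0 f) \<otimes> h0 f \<otimes> \<one> = (inv h0 f \<otimes> h0 f) \<otimes> l \<otimes> (inv h0 f \<otimes> h0 f)"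
      using c by (simp only: m_assoc inv_closed m_closed one_closed r_one)
    then show ?thesis using c by simp
  qed
  also have "\<one>\<^bsub>F\<^esub> \<otimes>\<^bsub>F\<^esub> f = f" using f by simp
  also have "affs f l = affs f \<one> + transl l" by (rule affs_split[OF f l])
  finally show ?thesis by (simp add: conjg_def diff_eq_eq)
qed

lemma normalizes_base:
  assumes "a \<in> carrier B" shows "normalizes (base a) H"
proof -
  have H: "conjg (base c) h \<in> H" if c: "c \<in> carrier B" and h: "h \<in> H" for c h
  proof -
    obtain f where f: "f \<in> carrier F" "c = \<pi> f" using surjE[OF c] .
    obtain l where l: "l \<in> L" "h = transl l" using h by (auto simp: H_def)
    have "conjg (base c) h = transl (h0 f \<otimes> l \<otimes> inv h0 f)"
      unfolding f(2) l(2) base_\<pi>[OF f(1)] by (rule conjg_affs[OF f(1) l(1)])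
    then show ?thesis using L_conj[OF f(1) l(1)] by (simp add: H_def)
  qed
  have "- base a = base (inv\<^bsub>B\<^esub> a)" using B.homs0_inv[OF base_homs0 assms] by simp
  then show ?thesis using H[OF assms] H[of "inv\<^bsub>B\<^esub> a"] assms by (simp add: normalizes_def)
qed

text \<open>\<open>L\<close> need not be a \<open>p\<close>-group. So \<open>section_action\<close>
  is used with the subsets of \<open>L\<close> whose size is the full power of \<open>p\<close> in
  \<open>card L\<close>, as in Wielandt's proof of the Sylow theorem.\<close>

lemma prime_power_dvd_card_fibre:
  assumes prime: "prime p" and ord: "order B = p ^ l" and good: "good TYPE('b sym) p B Q"
    and j: "p ^ j dvd Q" "p ^ j dvd card L"
  shows "p ^ j dvd card fibre"
proof -
  define a where "a = multiplicity p (card L)"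
  have L0: "card L \<noteq> 0" using finite_L L_one by auto
  obtain m where m: "card L = p ^ a * m" "\<not> p dvd m"
    using multiplicity_decompose'[of "card L" p] L0 prime unfolding a_def
    by (metis not_prime_unit)
  let ?\<Omega> = "{M. M \<subseteq> L \<and> card M = p ^ a}" and ?act = "\<lambda>s M. Rep_sym s ` M"
  have pa: "p ^ a > 0" using prime by (simp add: prime_gt_0_nat)
  have maps: "Rep_sym (affs f l) ` M \<in> ?\<Omega>" if "f \<in> carrier F" "l \<in> L" "M \<in> ?\<Omega>" for f l M
  proof -
    have "inj_on (aff f l) M" using bij_aff[OF that(1,2)] by (meson bij_is_inj inj_on_subset subset_UNIV)
    then show ?thesis using that aff_L by (auto simp: Rep_affs card_image)
  qed
  interpret A: section_action B p Q H base ?act ?\<Omega>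
  proof unfold_locales
    show "finite (carrier B)" using ord pa prime by (metis card.infinite not_prime_0 order_def power_eq_0_iff)
    show "finite ?\<Omega>" using finite_L by simp
    show "?act 0 M = M" for M by (simp add: Rep_sym_simps)
    show "?act (s + t) M = ?act s (?act t M)" for s t M by (simp add: Rep_sym_simps image_comp)
    show "?act h M \<in> ?\<Omega>" if h: "h \<in> H" and M: "M \<in> ?\<Omega>" for h M
    proof -
      obtain l where l: "l \<in> L" "h = transl l" using h by (auto simp: H_def)
      show ?thesis unfolding l(2) by (rule maps[OF _ l(1) M]) simp
    qed
    show "?act (base a) M \<in> ?\<Omega>" if "a \<in> carrier B" "M \<in> ?\<Omega>" for a M
    proof -
      obtain f where f: "f \<in> carrier F" "a = \<pi> f" using surjE[OF \<open>a \<in> carrier B\<close>] .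
      show ?thesis unfolding f(2) base_\<pi>[OF f(1)] by (rule maps[OF f(1) L_one that(2)])
    qed
    show "\<exists>i. card K = p ^ i"
      if K: "add_subgroup K" "K \<subseteq> H" and M: "M \<in> ?\<Omega>" and fx: "\<And>k. k \<in> K \<Longrightarrow> ?act k M = M" for K M
    proof -
      interpret GK: group "group_on K" by (rule group_group_on) (rule K(1))
      \<comment> \<open>A nontrivial translation has no fixed point in \<open>L\<close>, so a group
        of translations preserving \<open>M\<close> acts freely on it and its order divides
        \<open>p ^ a\<close>.\<close>
      have "order (group_on K) dvd card M"
      proof (rule GK.dvd_card_free[where act = "\<lambda>k. Rep_sym k"])
        show "acts_on (group_on K) (\<lambda>k. Rep_sym k) M"
        proof (rule acts_onI)
          fix k x assume "k \<in> carrier (group_on K)" "x \<in> M"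
          then show "Rep_sym k x \<in> M" using fx[of k] by auto
        qed (simp_all add: Rep_sym_simps)
        show "finite M" using M finite_L finite_subset by blast
        fix x assume x: "x \<in> M"
        show "inj_on (\<lambda>k. Rep_sym k x) (carrier (group_on K))"
        proof (rule inj_onI)
          fix k k' assume kk: "k \<in> carrier (group_on K)" "k' \<in> carrier (group_on K)" "Rep_sym k x = Rep_sym k' x"
          obtain l l' where l: "l \<in> L" "k = transl l" "l' \<in> L" "k' = transl l'"
          proof -
            have "k \<in> transl ` L" "k' \<in> transl ` L" using kk K(2) by (auto simp: H_def)
            then show thesis using that by (elim imageE)
          qed
          have "x \<in> L" using x M by blast
          then have "l \<otimes> x = l' \<otimes> x" using kk(3) l by (simp add: Rep_affs aff_def L_carrier)
          then show "k = k'" using l L_carrier \<open>x \<in> L\<close> by simp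
        qed
      qed
      then show ?thesis using M prime by (simp add: divides_primepow_nat) blast
    qed
  qed (use add_subgroup_H finite_H base_homs0 normalizes_base good in auto)
  have "card ?\<Omega> = (p ^ a * m choose p ^ a)" using n_subsets[OF finite_L, of "p ^ a"] m by simp
  moreover have "multiplicity p (p ^ a * m choose p ^ a) = 0"
    using const_p_fac[of m p a] m L0 prime not_dvd_imp_multiplicity_0 by simp
  moreover have "(p ^ a * m choose p ^ a) \<noteq> 0" using m L0 by (simp add: binomial_eq_0_iff)
  ultimately have "\<not> p dvd card ?\<Omega>"
    using prime by (metis multiplicity_eq_zero_iff not_prime_unit)
  then show ?thesis
    unfolding card_fibre using A.prime_power_dvd_card_sections[OF prime ord _ j(1)] j(2) card_H by simp
qed

end

section \<open>Summation over the restrictions to the kernel\<close>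

lemma finite_Homs:
  assumes "finite (carrier F)" "finite (carrier G)" shows "finite (Homs F G)"
proof (rule finite_subset)
  show "Homs F G \<subseteq> carrier F \<rightarrow>\<^sub>E carrier G" by (auto simp: Homs_def hom_def PiE_def)
qed (use assms in \<open>simp add: finite_PiE\<close>)

text \<open>Restrictions conjugate under \<open>G\<close> have equally large fibres, and the
  stabilizer of a restriction is the group \<open>L\<close> of \<open>hom_fibre\<close>; orbit
  counting turns the bound in terms of \<open>card L\<close> into one in terms of
  \<open>order G\<close>.\<close>

theorem (in group) prime_power_dvd_card_Homs:
  fixes F :: "('f, 'n) monoid_scheme"
  assumes F: "group F" "finite (carrier F)" and finite_G: "finite (carrier G)" and B: "group B"
    and \<pi>: "\<pi> \<in> hom F B" "\<pi> ` carrier F = carrier B"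
    and prime: "prime p" and ord: "order B = p ^ l" and good: "good TYPE('a sym) p B Q"
    and j: "p ^ j dvd Q" "p ^ j dvd order G"
  shows "p ^ j dvd card (Homs F G)"
proof -
  let ?K = "{f \<in> carrier F. \<pi> f = \<one>\<^bsub>B\<^esub>}" and ?X = "Homs F G"
  let ?R = "(\<lambda>\<phi>. restrict \<phi> ?K) ` ?X"
  let ?act = "\<lambda>g \<rho>. \<lambda>k\<in>?K. g \<otimes> \<rho> k \<otimes> inv g"
  let ?cj = "\<lambda>g \<phi>. \<lambda>f\<in>carrier F. g \<otimes> \<phi> f \<otimes> inv g"
  let ?E = "\<lambda>\<rho>. {\<phi> \<in> ?X. restrict \<phi> ?K = \<rho>}"
  have val: "\<phi> f \<in> carrier G" if "\<phi> \<in> ?X" "f \<in> carrier F" for \<phi> f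
    using that by (auto simp: Homs_def hom_def)
  have finX: "finite ?X" using F(2) finite_G by (rule finite_Homs)
  have cj: "?cj g \<phi> \<in> ?X" if g: "g \<in> carrier G" and \<phi>: "\<phi> \<in> ?X" for g \<phi>
  proof -
    have "?cj g \<phi> (f \<otimes>\<^bsub>F\<^esub> f') = ?cj g \<phi> f \<otimes> ?cj g \<phi> f'" if f: "f \<in> carrier F" "f' \<in> carrier F" for f f'
    proof -
      have "\<phi> (f \<otimes>\<^bsub>F\<^esub> f') = \<phi> f \<otimes> \<phi> f'" using \<phi> f by (auto simp: Homs_def hom_def)
      then have "?cj g \<phi> (f \<otimes>\<^bsub>F\<^esub> f') = g \<otimes> (\<phi> f \<otimes> \<phi> f') \<otimes> inv g"
        using f group.is_monoid[OF F(1)] monoid.m_closed by fastforce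
      also have "\<dots> = g \<otimes> \<phi> f \<otimes> (inv g \<otimes> g) \<otimes> \<phi> f' \<otimes> inv g"
        using g val[OF \<phi>] f by (simp add: m_assoc)
      also have "\<dots> = ?cj g \<phi> f \<otimes> ?cj g \<phi> f'"
        using g val[OF \<phi>] f by (simp only: m_assoc inv_closed m_closed restrict_apply' if_True)
      finally show ?thesis .
    qed
    moreover have "?cj g \<phi> f \<in> carrier G" if "f \<in> carrier F" for f using that g val[OF \<phi>] by simp
    ultimately show ?thesis by (simp add: Homs_def hom_def)
  qed
  have cjK: "restrict (?cj g \<phi>) ?K = ?act g (restrict \<phi> ?K)" for g \<phi>
    by (rule restrict_ext) simp
  have mult: "(a \<otimes> b) \<otimes> x \<otimes> inv (a \<otimes> b) = a \<otimes> (b \<otimes> x \<otimes> inv b) \<otimes> inv a"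
    if "a \<in> carrier G" "b \<in> carrier G" "x \<in> carrier G" for a b x
    using that by (simp add: m_assoc inv_mult_group)
  have A: "acts_on G ?act ?R"
  proof (rule acts_onI)
    fix \<rho> assume "\<rho> \<in> ?R"
    then obtain \<phi> where \<phi>: "\<phi> \<in> ?X" "\<rho> = restrict \<phi> ?K" by blast
    show "?act \<one> \<rho> = \<rho>"
      unfolding \<phi>(2) by (rule restrict_ext) (use val[OF \<phi>(1)] in simp)
    fix g assume g: "g \<in> carrier G"
    show "?act g \<rho> \<in> ?R"
      unfolding \<phi>(2) cjK[symmetric] using cj[OF g \<phi>(1)] by (rule imageI)
    fix h assume h: "h \<in> carrier G"
    show "?act (g \<otimes> h) \<rho> = ?act g (?act h \<rho>)"
      unfolding \<phi>(2) by (rule restrict_ext) (use val[OF \<phi>(1)] g h mult in simp)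
  qed
  have "p ^ j dvd (\<Sum>\<rho>\<in>?R. card (?E \<rho>))"
  proof (rule dvd_sum_orbits[OF A])
    show "finite ?R" using finX by simp
    \<comment> \<open>An inequality is enough: applied to \<open>inv g\<close> it gives the reverse
      one.\<close>
    have le: "card (?E \<rho>) \<le> card (?E (?act g \<rho>))"
      if g: "g \<in> carrier G" for g \<rho>
    proof (rule card_inj_on_le)
      show "?cj g ` ?E \<rho> \<subseteq> ?E (?act g \<rho>)"
        using cj[OF g] cjK[of g] by auto
      show "inj_on (?cj g) (?E \<rho>)"
      proof (rule inj_onI)
        fix \<phi> \<phi>' assume a: "\<phi> \<in> ?E \<rho>" "\<phi>' \<in> ?E \<rho>"
          and e: "?cj g \<phi> = ?cj g \<phi>'"
        have "\<phi> f = \<phi>' f" if f: "f \<in> carrier F" for f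
        proof -
          have "?cj g \<phi> f = ?cj g \<phi>' f" by (rule fun_cong[OF e])
          then show ?thesis using f g val a by simp
        qed
        then show "\<phi> = \<phi>'"
          using a by (intro extensionalityI[of _ "carrier F"]) (auto simp: Homs_def)
      qed
      show "finite (?E (?act g \<rho>))" using finX by simp
    qed
    fix g \<rho> assume g: "g \<in> carrier G" and \<rho>: "\<rho> \<in> ?R"
    have "?act (inv g) (?act g \<rho>) = \<rho>" by (rule acts_on_inv(1)[OF A g \<rho>])
    then show "card (?E (?act g \<rho>)) = card (?E \<rho>)"
      using le[OF g, of \<rho>] le[OF inv_closed[OF g], of "?act g \<rho>"] by simp
  next
    fix \<rho> assume \<rho>: "\<rho> \<in> ?R"
    then obtain h0 where h0: "h0 \<in> ?X" "\<rho> = restrict h0 ?K" by blast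
    interpret h: hom_fibre G F B \<pi> h0
      by (intro hom_fibre.intro hom_fibre_axioms.intro is_group) (use F finite_G B \<pi> h0(1) in \<open>simp_all add: Homs_def\<close>)
    have KK: "h.K = ?K" by (simp add: h.K_def)
    have fib: "?E \<rho> = h.fibre"
    proof -
      have "restrict \<phi> ?K = \<rho> \<longleftrightarrow> (\<forall>k\<in>?K. \<phi> k = h0 k)" for \<phi>
        unfolding h0(2) by (metis (no_types, lifting) restrict_apply' restrict_ext)
      then show ?thesis unfolding h.fibre_def KK by simp
    qed
    have stab: "{g \<in> carrier G. ?act g \<rho> = \<rho>} = h.L"
    proof -
      have "?act g \<rho> = \<rho> \<longleftrightarrow> (\<forall>k\<in>?K. g \<otimes> h0 k = h0 k \<otimes> g)" if g: "g \<in> carrier G" for g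
      proof -
        have "?act g \<rho> = \<rho> \<longleftrightarrow> (\<forall>k\<in>?K. g \<otimes> h0 k \<otimes> inv g = h0 k)"
          unfolding h0(2) by (auto simp: fun_eq_iff restrict_def)
        also have "\<dots> \<longleftrightarrow> (\<forall>k\<in>?K. g \<otimes> h0 k = h0 k \<otimes> g)"
        proof (rule ball_cong[OF refl])
          fix k assume "k \<in> ?K"
          then have k: "h0 k \<in> carrier G" using val[OF h0(1)] by simp
          show "(g \<otimes> h0 k \<otimes> inv g = h0 k) = (g \<otimes> h0 k = h0 k \<otimes> g)"
            using g k by (metis inv_solve_right' m_closed)
        qed
        finally show ?thesis .
      qed
      then show ?thesis unfolding h.L_def KK by blast
    qed
    let ?o = "card ((\<lambda>g. ?act g \<rho>) ` carrier G)"
    have o: "?o * card h.L = order G"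
      using orbit_stabilizer[OF finite_G A \<rho>] unfolding stab .
    \<comment> \<open>The bound for a single fibre is stated for powers of \<open>p\<close>, and
      this \<open>gcd\<close> is one.\<close>
    obtain i where i: "gcd (p ^ j) (card h.L) = p ^ i"
      using prime by (metis divides_primepow_nat gcd_dvd1)
    have "p ^ i dvd card h.fibre"
      by (rule h.prime_power_dvd_card_fibre[OF prime ord good])
        (metis i dvd_trans[OF gcd_dvd1 j(1)], metis i gcd_dvd2)
    then have "?o * gcd (p ^ j) (card h.L) dvd ?o * card h.fibre"
      unfolding i by (rule mult_dvd_mono[OF dvd_refl])
    then have "gcd (p ^ j) (order G) dvd ?o * card h.fibre"
      by (rule dvd_trans[OF gcd_dvd_index_mult_gcd[OF o]])
    then show "p ^ j dvd ?o * card (?E \<rho>)"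
      unfolding fib using j(2) by (simp add: gcd_nat.absorb1)
  qed
  moreover have "(\<Sum>\<rho>\<in>?R. card (?E \<rho>)) = card ?X"
    using sum.image_gen[OF finX, of "\<lambda>_. 1 :: nat" "\<lambda>\<phi>. restrict \<phi> ?K"] by simp
  ultimately show ?thesis by simp
qed

section \<open>Abelian groups with a cyclic and a cube-free factor\<close>

context group
begin

lemma pow_mem_subgroup: "subgroup S G \<Longrightarrow> x \<in> S \<Longrightarrow> x [^] (n :: nat) \<in> S"
  by (induction n) (auto simp: subgroup.one_closed subgroup.m_closed)

lemma pow_mod:
  assumes "x \<in> carrier G" "x [^] q = \<one>" shows "x [^] (n :: nat) = x [^] (n mod q)"
proof -
  have "x [^] (q * (n div q)) = \<one>" using assms by (metis nat_pow_one nat_pow_pow)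
  moreover have "x [^] n = x [^] (q * (n div q)) \<otimes> x [^] (n mod q)" using assms by (simp add: nat_pow_mult)
  ultimately show ?thesis using assms by simp
qed

text \<open>Exponents of \<open>x\<close> matter only modulo \<open>q\<close>, where the
  \<open>gcd\<close> is a natural multiple of \<open>i\<close>; this avoids negative Bezout
  coefficients.\<close>

lemma pow_gcd_mem_subgroup:
  fixes i q :: nat
  assumes S: "subgroup S G" and x: "x \<in> carrier G" "x [^] q = \<one>" "x [^] i \<in> S"
  shows "x [^] gcd i q \<in> S"
proof -
  obtain u where u: "[i * u = gcd i q] (mod q)" using cong_solve_nat by blast
  note red = pow_mod[OF x(1,2)]
  have "x [^] gcd i q = x [^] (i * u)" using u red[of "gcd i q"] red[of "i * u"] by (simp add: cong_def)
  also have "\<dots> = (x [^] i) [^] u" using x by (simp add: nat_pow_pow)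
  finally show ?thesis using pow_mem_subgroup[OF S x(3)] by simp
qed

end

lemma mem_set_mult: "x \<in> A <#>\<^bsub>G\<^esub> B \<longleftrightarrow> (\<exists>a b. a \<in> A \<and> b \<in> B \<and> x = a \<otimes>\<^bsub>G\<^esub> b)"
  by (auto simp: set_mult_def)

lemma finite_exists_maximal:
  assumes fin: "finite (X :: 's set)" and ex: "P S0" and sub: "\<And>S. P S \<Longrightarrow> S \<subseteq> X"
  shows "\<exists>S. P S \<and> (\<forall>T. P T \<longrightarrow> \<not> S \<subset> T)"
proof -
  have "finite {S. P S}" by (rule finite_subset[of _ "Pow X"]) (use fin sub in auto)
  from finite_has_maximal[OF this] ex obtain S
    where S: "S \<in> {S. P S}" "\<forall>T\<in>{S. P S}. S \<le> T \<longrightarrow> S = T" by fastforce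
  then show ?thesis by (intro exI[of _ S]) auto
qed

locale cyclic_times_square = comm_group G for G :: "('s, 'm) monoid_scheme" (structure) +
  fixes p :: nat and D B :: "'s set"
  assumes finite_G: "finite (carrier G)" and prime: "prime p"
    and D: "subgroup D G" and B: "subgroup B G" and disj: "D \<inter> B = {\<one>}"
    and exponent: "\<And>b. b \<in> B \<Longrightarrow> b [^] (p * p) = \<one>"
begin

text \<open>\<open>S\<close> is the portion of \<open>B\<close> already built up; its product with
  \<open>D\<close> is required to be good for its own full order.\<close>

definition chain :: "'e::group_add itself \<Rightarrow> 's set \<Rightarrow> bool" where
  "chain ty S \<longleftrightarrow> subgroup S G \<and> S \<subseteq> B \<and>
     (\<exists>l. card (D <#> S) = p ^ l \<and> good ty p (G\<lparr>carrier := D <#> S\<rparr>) (p ^ l))"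

text \<open>
  Every element of order \<open>p\<close> in \<open>S\<close> is a \<open>p\<close>-th power, so in exponent \<open>p\<^sup>2\<close> the group \<open>S\<close> is a sum of copies of \<open>Z/p\<^sup>2\<close>.
  A maximal such \<open>S\<close> is reached by adjoining factors of order \<open>p\<^sup>2\<close>, and it then contains all \<open>p\<close>-th powers
  of \<open>B\<close>, so that the rest of \<open>B\<close> is obtained by adjoining factors of order \<open>p\<close>.
\<close>

definition homocyclic :: "'s set \<Rightarrow> bool" where
  "homocyclic S \<longleftrightarrow> (\<forall>s\<in>S. s [^] p = \<one> \<longrightarrow> (\<exists>t\<in>S. s = t [^] p))"

lemma B_carrier: "b \<in> B \<Longrightarrow> b \<in> carrier G"
  using subgroup.subset[OF B] by blast

lemma mem_of_mem_DS:
  assumes S: "subgroup S G" "S \<subseteq> B" and x: "x \<in> B" "x \<in> D <#> S" shows "x \<in> S"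
proof -
  obtain d s where ds: "d \<in> D" "s \<in> S" "x = d \<otimes> s" using x by (auto simp: set_mult_def)
  have c: "d \<in> carrier G" "s \<in> carrier G" using ds subgroup.subset[OF D] subgroup.subset[OF S(1)] by auto
  have "d = x \<otimes> inv s" unfolding ds(3) using c by (simp add: m_assoc)
  moreover have "x \<otimes> inv s \<in> B"
    using x ds S B by (metis subgroup.m_closed subgroup.m_inv_closed subsetD)
  ultimately have "d = \<one>" using ds(1) disj by blast
  then show ?thesis using ds c by simp
qed

text \<open>By \<open>mem_of_mem_DS\<close>, independence of \<open>b\<close> from \<open>S\<close>
  implies independence from \<open>D <#> S\<close>, so \<open>good_extension\<close> can adjoin
  \<open>b\<close> to the latter.\<close>

lemma chain_extend:
  assumes ch: "chain TYPE('e::group_add) S" and b: "b \<in> B" and q: "q = p \<or> q = p * p" and bq: "b [^] q = \<one>"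
    and indep: "\<And>i :: nat. b [^] i \<in> S \<Longrightarrow> q dvd i"
  shows "cyclic_extension G S b q" and "chain TYPE('e) (cyclic_extension.T G S b)"
    and "S \<subset> cyclic_extension.T G S b"
proof -
  have S: "subgroup S G" "S \<subseteq> B" using ch by (auto simp: chain_def)
  have q1: "q > 1" using q prime_gt_1_nat[OF prime] less_1_mult[of p p] by auto
  show E: "cyclic_extension G S b q"
  proof (intro cyclic_extension.intro cyclic_extension_axioms.intro)
    show "comm_group G" by (rule comm_group_axioms)
    show "q dvd i" if "b [^] i \<in> S" for i :: nat using that by (rule indep)
  qed (use S b bq B_carrier q1 in simp_all)
  interpret E: cyclic_extension G S b q by (rule E)
  interpret E2: cyclic_extension G "D <#> S" b q
  proof (intro cyclic_extension.intro cyclic_extension_axioms.intro)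
    show "comm_group G" by (rule comm_group_axioms)
    show "subgroup (D <#> S) G" by (rule mult_subgroups[OF D S(1)])
    fix i :: nat assume "b [^] i \<in> D <#> S"
    then show "q dvd i" using mem_of_mem_DS[OF S] pow_mem_subgroup[OF B b] indep by blast
  qed (use b bq q1 B_carrier in simp_all)
  have T: "E2.T = D <#> E.T"
  proof (intro equalityI subsetI)
    fix x assume "x \<in> E2.T"
    then obtain d s i where x: "d \<in> D" "s \<in> S" "x = d \<otimes> s \<otimes> b [^] (i :: nat)"
      unfolding E2.T_def mem_set_mult by blast
    then have "x = d \<otimes> (s \<otimes> b [^] i)"
      using subsetD[OF subgroup.subset[OF D]] E.S_mem E.b by (simp add: m_assoc)
    then show "x \<in> D <#> E.T" using x E.T_memI unfolding mem_set_mult by blast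
  next
    fix x assume "x \<in> D <#> E.T"
    then obtain d s i where x: "d \<in> D" "s \<in> S" "x = d \<otimes> (s \<otimes> b [^] (i :: nat))"
      unfolding E.T_def mem_set_mult by blast
    then have "x = d \<otimes> s \<otimes> b [^] i"
      using subsetD[OF subgroup.subset[OF D]] E.S_mem E.b by (simp add: m_assoc)
    then show "x \<in> E2.T" using x unfolding E2.T_def mem_set_mult by blast
  qed
  obtain l where l: "card (D <#> S) = p ^ l" "good TYPE('e) p (G\<lparr>carrier := D <#> S\<rparr>) (p ^ l)"
    using ch by (auto simp: chain_def)
  have fin: "finite (D <#> S)" using finite_G subgroup.subset[OF E2.S] finite_subset by blast
  have "good TYPE('e) p E2.GT (q * p ^ l)" by (rule E2.good_extension[OF l(2) refl prime q fin])
  moreover obtain e where e: "q = p ^ e" using q by (metis power_one_right power2_eq_square)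
  moreover have "card E2.T = q * p ^ l" using E2.card_T l(1) by simp
  ultimately have "\<exists>l. card (D <#> E.T) = p ^ l \<and> good TYPE('e) p (G\<lparr>carrier := D <#> E.T\<rparr>) (p ^ l)"
    unfolding T by (metis power_add)
  moreover have "E.T \<subseteq> B"
  proof
    fix x assume "x \<in> E.T"
    then show "x \<in> B"
      using S(2) pow_mem_subgroup[OF B b] subgroup.m_closed[OF B] by (auto simp: E.T_def)
  qed
  ultimately show "chain TYPE('e) E.T" using E.subgroup_T by (simp add: chain_def)
  have "b \<notin> S" using indep[of 1] b B_carrier q1 by auto
  then show "S \<subset> E.T" using E.S_T E.b_T by blast
qed

theorem chain_all:
  assumes ch: "chain TYPE('e::group_add) {\<one>}"
  shows "chain TYPE('e) B"
proof -
  let ?ch = "chain TYPE('e)"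
  have finB: "finite B" by (rule finite_subset[OF subgroup.subset[OF B] finite_G])
  have subB: "S \<subseteq> B" if "?ch S" for S using that by (simp add: chain_def)
  \<comment> \<open>The exponent \<open>i\<close> may be replaced by its \<open>gcd\<close> with
    \<open>p * p\<close>, which is 1, \<open>p\<close> or \<open>p * p\<close>; the first two would
    put \<open>b [^] p\<close> into \<open>S\<close>.\<close>
  have p2: "b [^] i \<in> S \<Longrightarrow> p * p dvd i" if S: "subgroup S G" and b: "b \<in> B" "b [^] p \<notin> S" for S b and i :: nat
  proof -
    assume "b [^] i \<in> S"
    then have g: "b [^] gcd i (p * p) \<in> S"
      by (rule pow_gcd_mem_subgroup[OF S B_carrier[OF b(1)] exponent[OF b(1)]])
    have "gcd i (p * p) dvd p ^ 2" by (simp add: power2_eq_square)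
    then obtain e where e: "gcd i (p * p) = p ^ e" "e \<le> 2"
      unfolding divides_primepow_nat[OF prime] by blast
    have "e = 2"
    proof (rule ccontr)
      assume "e \<noteq> 2"
      then have "p ^ e dvd p" using e(2) by (cases e) auto
      then obtain k where k: "p = p ^ e * k" by (elim dvdE)
      have "(b [^] (p ^ e)) [^] k \<in> S" using pow_mem_subgroup[OF S] g e by simp
      then have "b [^] (p ^ e * k) \<in> S" using B_carrier[OF b(1)] by (simp add: nat_pow_pow)
      then have "b [^] p \<in> S" by (simp only: k[symmetric])
      then show False using b by simp
    qed
    then show "p * p dvd i" using e by (metis gcd_dvd1 power2_eq_square)
  qed
  have h1: "homocyclic {\<one>}" by (simp add: homocyclic_def)
  have "\<exists>S. (?ch S \<and> homocyclic S) \<and> (\<forall>T. ?ch T \<and> homocyclic T \<longrightarrow> \<not> S \<subset> T)"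
    by (rule finite_exists_maximal[OF finB, of _ "{\<one>}"]) (simp_all add: ch h1 subB)
  then obtain S0 where S0: "?ch S0" "homocyclic S0" and max0: "\<And>T. ?ch T \<and> homocyclic T \<Longrightarrow> \<not> S0 \<subset> T"
    by (elim exE conjE) metis
  have sg0: "subgroup S0 G" using S0 by (simp add: chain_def)
  have pow0: "b [^] p \<in> S0" if b: "b \<in> B" for b
  proof (rule ccontr)
    assume nb: "b [^] p \<notin> S0"
    note ind = p2[OF sg0 b nb]
    note ext = chain_extend[OF S0(1) b disjI2[OF refl] exponent[OF b] ind]
    interpret E: cyclic_extension G S0 b "p * p" by (rule ext(1))
    \<comment> \<open>This contradicts maximality of \<open>S0\<close>. If
      \<open>s \<otimes> b [^] i\<close> is killed by \<open>p\<close>, independence of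
      \<open>b\<close> makes \<open>i\<close> a multiple of \<open>p\<close>, so \<open>s\<close> is
      killed by \<open>p\<close> and is a \<open>p\<close>-th power.\<close>
    have "homocyclic E.T"
      unfolding homocyclic_def
    proof (intro ballI impI)
      fix x assume x: "x \<in> E.T" "x [^] p = \<one>"
      then obtain s i where si: "s \<in> S0" "x = s \<otimes> b [^] (i :: nat)" by (auto simp: E.T_def)
      have c: "s \<in> carrier G" "b \<in> carrier G" using si E.S_mem E.b by auto
      have e: "s [^] p \<otimes> b [^] (i * p) = \<one>"
        using x(2) c unfolding si(2) by (simp add: nat_pow_distrib nat_pow_pow)
      then have "b [^] (i * p) = inv (s [^] p)" using c by (metis inv_equality m_comm nat_pow_closed)
      then have "b [^] (i * p) \<in> S0"
        using si(1) sg0 pow_mem_subgroup subgroup.m_inv_closed by metis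
      then have "p * p dvd i * p" by (rule ind)
      then have "p dvd i" using prime by simp
      then obtain i' where i': "i = p * i'" by (elim dvdE)
      have "b [^] (i * p) = \<one>"
        using E.pow_mult_q[of i'] by (simp add: i' mult.commute mult.left_commute)
      then have "s [^] p = \<one>" using e c by simp
      then obtain t where t: "t \<in> S0" "s = t [^] p" using S0(2) si(1) by (auto simp: homocyclic_def)
      have "x = (t \<otimes> b [^] i') [^] p"
        using t E.S_mem c unfolding si(2) by (simp add: nat_pow_distrib nat_pow_pow i' mult.commute)
      then show "\<exists>t\<in>E.T. x = t [^] p" using E.T_memI[OF t(1)] by blast
    qed
    then show False using max0 ext(2,3) by blast
  qed
  have "\<exists>S. (?ch S \<and> S0 \<subseteq> S) \<and> (\<forall>T. ?ch T \<and> S0 \<subseteq> T \<longrightarrow> \<not> S \<subset> T)"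
    by (rule finite_exists_maximal[OF finB, of _ S0]) (simp_all add: S0 subB)
  then obtain S1 where S1: "?ch S1" "S0 \<subseteq> S1" and max1: "\<And>T. ?ch T \<and> S0 \<subseteq> T \<Longrightarrow> \<not> S1 \<subset> T"
    by (elim exE conjE) metis
  have sg1: "subgroup S1 G" using S1 by (simp add: chain_def)
  have "S1 = B"
  proof (rule ccontr)
    assume "S1 \<noteq> B"
    then obtain b where b: "b \<in> B" "b \<notin> S1" using subB[OF S1(1)] by blast
    have bc: "b \<in> carrier G" by (rule B_carrier[OF b(1)])
    \<comment> \<open>\<open>b [^] p\<close> lies in \<open>S0\<close> and is killed by
      \<open>p\<close>, hence is the \<open>p\<close>-th power of some \<open>t \<in> S0\<close>.
      Dividing \<open>b\<close> by \<open>t\<close> gives an element killed by \<open>p\<close> and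
      still outside \<open>S1\<close>, which can be adjoined.\<close>
    have "(b [^] p) [^] p = \<one>" using exponent[OF b(1)] bc by (simp add: nat_pow_pow)
    then obtain t where t: "t \<in> S0" "b [^] p = t [^] p"
      using S0(2) pow0[OF b(1)] by (auto simp: homocyclic_def)
    have tB: "t \<in> B" and tS: "t \<in> S1" and tc: "t \<in> carrier G" using subsetD[OF S1(2) t(1)] subsetD[OF subB[OF S1(1)]] B_carrier by auto
    let ?b = "b \<otimes> inv t"
    have b': "?b \<in> B" using b(1) tB B by (simp add: subgroup.m_closed subgroup.m_inv_closed)
    have nb: "?b \<notin> S1"
    proof
      assume "?b \<in> S1"
      then have "?b \<otimes> t \<in> S1" using tS sg1 subgroup.m_closed by metis
      then show False using b(2) bc tc by (simp add: m_assoc)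
    qed
    have "?b [^] p \<otimes> t [^] p = (?b \<otimes> t) [^] p" using bc tc by (simp add: nat_pow_distrib)
    also have "?b \<otimes> t = b" using bc tc by (simp add: m_assoc)
    finally have "?b [^] p \<otimes> t [^] p = \<one> \<otimes> t [^] p" using t(2) tc by simp
    then have bp: "?b [^] p = \<one>" by (subst (asm) right_cancel) (use bc tc in auto)
    have ind: "p dvd i" if "?b [^] i \<in> S1" for i :: nat
    proof (rule ccontr)
      assume "\<not> p dvd i"
      then have "gcd i p = 1" using prime by (metis coprime_commute coprime_imp_gcd_eq_1 prime_imp_coprime)
      then have "?b [^] (1 :: nat) \<in> S1"
        using pow_gcd_mem_subgroup[OF sg1 B_carrier[OF b'] bp that] by simp
      then show False using nb B_carrier[OF b'] by simp
    qed
    show False using max1 chain_extend(2,3)[OF S1(1) b' disjI1[OF refl] bp ind] S1(2) by blast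
  qed
  then show ?thesis using S1(1) by simp
qed

end

section \<open>The \<open>p\<close>-part of a finite abelian group as image of a power map\<close>

lemma (in comm_group) pow_hom_img:
  fixes m :: nat
  assumes "subgroup S G"
  shows "subgroup ((\<lambda>x. x [^] m) ` S) G"
proof -
  interpret group_hom G G "\<lambda>x. x [^] m"
    by unfold_locales (auto simp: hom_def nat_pow_distrib)
  show ?thesis using subgroup_img_is_subgroup[OF assms] .
qed

text \<open>Raising to a power prime to \<open>p\<close> permutes a Sylow \<open>p\<close>-subgroup,
  which therefore lies in the image.\<close>

lemma (in comm_group) prime_power_le_card_power_image:
  assumes fin: "finite (carrier G)" and p: "prime p" and ord: "order G = p ^ k * m" "\<not> p dvd m"
  shows "p ^ k \<le> card ((\<lambda>x. x [^] m) ` carrier G)"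
proof -
  obtain R where R: "subgroup R G" "card R = p ^ k"
    using sylow_thm[OF p is_group ord(1) fin] by blast
  have "coprime p m" using p ord(2) by (rule prime_imp_coprime)
  then have "coprime m (p ^ k)" by (simp add: coprime_commute)
  then obtain u where u: "[m * u = 1] (mod p ^ k)"
    using cong_solve_coprime_nat[of m "p ^ k"] by (auto simp del: coprime_power_right_iff)
  have "R \<subseteq> (\<lambda>x. x [^] m) ` carrier G"
  proof
    fix x assume x: "x \<in> R"
    then have xc: "x \<in> carrier G" using subgroup.subset[OF R(1)] by blast
    interpret R: group "G\<lparr>carrier := R\<rparr>" using subgroup.subgroup_is_group[OF R(1) is_group] .
    have pk: "x [^] (p ^ k) = \<one>"
      using R.pow_order_eq_1[of x] x R(2) by (simp add: order_def nat_pow_consistent[symmetric])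
    note red = pow_mod[OF xc pk]
    have "x = x [^] (1 :: nat)" using xc by simp
    also have "\<dots> = x [^] (m * u)" using u red[of 1] red[of "m * u"] by (simp only: cong_def)
    also have "\<dots> = (x [^] u) [^] m" using xc by (simp add: nat_pow_pow mult.commute)
    finally show "x \<in> (\<lambda>x. x [^] m) ` carrier G"
      by (rule image_eqI) (rule nat_pow_closed[OF xc])
  qed
  then show ?thesis using R(2) fin card_mono by (metis finite_imageI)
qed

lemma DirProd_pow: "(x, y) [^]\<^bsub>G \<times>\<times> H\<^esub> (n :: nat) = (x [^]\<^bsub>G\<^esub> n, y [^]\<^bsub>H\<^esub> n)"
  by (induction n) auto

lemma cube_free_exponent_pow:
  assumes A: "group A" and cf: "cube_free (group_exponent A)" and p: "prime p"
    and x: "x \<in> carrier A" "x [^]\<^bsub>A\<^esub> (p ^ k :: nat) = \<one>\<^bsub>A\<^esub>"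
  shows "x [^]\<^bsub>A\<^esub> (p * p) = \<one>\<^bsub>A\<^esub>"
proof -
  interpret A: group A by (rule A)
  let ?P = "\<lambda>n::nat. n > 0 \<and> (\<forall>x\<in>carrier A. x [^]\<^bsub>A\<^esub> n = \<one>\<^bsub>A\<^esub>)"
  \<comment> \<open>Without a positive exponent, \<open>group_exponent\<close> would be 0, which
    every prime cube divides.\<close>
  have ex: "\<exists>n. ?P n"
  proof (rule ccontr)
    assume "\<not> ?thesis"
    then have "group_exponent A = 0" unfolding group_exponent_def by (rule if_not_P)
    then show False using cf p by (auto simp: cube_free_def)
  qed
  then have "group_exponent A = (LEAST n. ?P n)" unfolding group_exponent_def by (rule if_P)
  then have "?P (group_exponent A)" using LeastI_ex[OF ex] by simp
  then have e: "A.ord x dvd group_exponent A" using x by (simp add: A.pow_eq_id)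
  have "A.ord x dvd p ^ k" using x by (simp add: A.pow_eq_id)
  then obtain t where t: "A.ord x = p ^ t" using p by (auto simp: divides_primepow_nat)
  have "\<not> 3 \<le> t"
  proof
    assume "3 \<le> t"
    then have "p ^ 3 dvd group_exponent A" using e t by (metis dvd_trans le_imp_power_dvd)
    then show False using cf p by (simp add: cube_free_def)
  qed
  then have "A.ord x dvd p ^ 2" unfolding t by (intro le_imp_power_dvd) simp
  then show ?thesis using x by (simp add: A.pow_eq_id power2_eq_square)
qed

text \<open>The \<open>m\<close>-th powers are all killed by \<open>p ^ k\<close>. They form the
  product of the cyclic group of \<open>d0\<close>, which starts the chain by
  \<open>good_cyclic\<close>, and of the \<open>m\<close>-th powers \<open>B\<close> from
  \<open>A\<close>, whose exponent divides \<open>p * p\<close>; \<open>chain_all\<close> adds the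
  latter.\<close>

lemma good_power_image:
  fixes C :: "'c monoid" and A :: "('d, 'k) monoid_scheme"
  assumes C: "group C" "cyclic_group C" and A: "group A" "cube_free (group_exponent A)"
    and comm: "comm_group (C \<times>\<times> A)" and fin: "finite (carrier (C \<times>\<times> A))" and p: "prime p"
    and ord: "order (C \<times>\<times> A) = p ^ k * m"
  shows "\<exists>l. card ((\<lambda>x. x [^]\<^bsub>C \<times>\<times> A\<^esub> m) ` carrier (C \<times>\<times> A)) = p ^ l \<and>
    good TYPE('e::group_add) p ((C \<times>\<times> A)\<lparr>carrier := (\<lambda>x. x [^]\<^bsub>C \<times>\<times> A\<^esub> m) ` carrier (C \<times>\<times> A)\<rparr>) (p ^ l)"
proof -
  interpret C: group C by (rule C(1))
  interpret A: group A by (rule A(1))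
  define Q where "Q = C \<times>\<times> A"
  interpret Q: comm_group Q unfolding Q_def by (rule comm)
  have cQ: "carrier Q = carrier C \<times> carrier A" by (simp add: Q_def)
  have oneQ: "\<one>\<^bsub>Q\<^esub> = (\<one>\<^bsub>C\<^esub>, \<one>\<^bsub>A\<^esub>)" by (simp add: Q_def)
  have multQ: "(c, a) \<otimes>\<^bsub>Q\<^esub> (c', a') = (c \<otimes>\<^bsub>C\<^esub> c', a \<otimes>\<^bsub>A\<^esub> a')" for c a c' a' by (simp add: Q_def)
  have powQ: "(c, a) [^]\<^bsub>Q\<^esub> (n :: nat) = (c [^]\<^bsub>C\<^esub> n, a [^]\<^bsub>A\<^esub> n)" for c a n
    unfolding Q_def by (rule DirProd_pow)
  have finQ: "finite (carrier Q)" using fin by (simp add: Q_def)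
  have finC: "finite (carrier C)"
    using finQ finite_cartesian_productD1[of "carrier C" "carrier A"] cQ A.one_closed by auto
  have pow_pk: "(x [^]\<^bsub>Q\<^esub> m) [^]\<^bsub>Q\<^esub> (p ^ k) = \<one>\<^bsub>Q\<^esub>" if "x \<in> carrier Q" for x
    using Q.pow_order_eq_1[OF that] that ord by (simp add: Q_def Q.nat_pow_pow[unfolded Q_def] mult.commute)
  obtain c0 where c0: "c0 \<in> carrier C" "carrier C = range (\<lambda>n::int. c0 [^]\<^bsub>C\<^esub> n)"
    using C(2) C.cyclic_group by blast
  have cgen: "\<exists>n::nat. c = c0 [^]\<^bsub>C\<^esub> n" if "c \<in> carrier C" for c
  proof -
    have "c \<in> generate C {c0}" using that c0 C.generate_pow[OF c0(1)] by auto
    then show ?thesis using C.generate_pow_on_finite_carrier[OF finC c0(1)] by auto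
  qed
  define d0 where "d0 = (c0 [^]\<^bsub>C\<^esub> m, \<one>\<^bsub>A\<^esub>)"
  have d0c: "d0 \<in> carrier Q" using c0(1) by (simp add: d0_def cQ)
  have d0x: "d0 = (c0, \<one>\<^bsub>A\<^esub>) [^]\<^bsub>Q\<^esub> m" by (simp add: d0_def powQ)
  have "d0 [^]\<^bsub>Q\<^esub> (p ^ k) = \<one>\<^bsub>Q\<^esub>" unfolding d0x by (rule pow_pk) (use c0(1) in \<open>simp add: cQ\<close>)
  then have "Q.ord d0 dvd p ^ k" using Q.pow_eq_id[OF d0c] by simp
  then obtain n where n: "Q.ord d0 = p ^ n" using p by (auto simp: divides_primepow_nat)
  \<comment> \<open>The cyclic group of \<open>d0\<close> is presented as an extension of the
    trivial subgroup, the form in which \<open>good_cyclic\<close> treats it.\<close>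
  interpret E: cyclic_extension Q "{\<one>\<^bsub>Q\<^esub>}" d0 "p ^ n"
  proof (intro cyclic_extension.intro cyclic_extension_axioms.intro)
    show "comm_group Q" by (rule Q.comm_group_axioms)
    show "subgroup {\<one>\<^bsub>Q\<^esub>} Q" by (rule Q.triv_subgroup)
    show "p ^ n dvd i" if "d0 [^]\<^bsub>Q\<^esub> i \<in> {\<one>\<^bsub>Q\<^esub>}" for i :: nat
      using that Q.pow_eq_id[OF d0c] n by simp
    show "d0 [^]\<^bsub>Q\<^esub> (p ^ n) = \<one>\<^bsub>Q\<^esub>" using Q.pow_ord_eq_1[OF d0c] n by simp
  qed (use d0c p in \<open>simp_all add: prime_gt_0_nat\<close>)
  define B where "B = (\<lambda>x. x [^]\<^bsub>Q\<^esub> m) ` ({\<one>\<^bsub>C\<^esub>} \<times> carrier A)"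
  have sA: "subgroup ({\<one>\<^bsub>C\<^esub>} \<times> carrier A) Q"
    unfolding Q_def by (rule DirProd_subgroups[OF C(1) C.triv_subgroup A(1) A.subgroup_self])
  have D_eq: "d \<in> E.T \<longleftrightarrow> (\<exists>i::nat. d = (c0 [^]\<^bsub>C\<^esub> (m * i), \<one>\<^bsub>A\<^esub>))" for d
  proof -
    have "\<one>\<^bsub>Q\<^esub> \<otimes>\<^bsub>Q\<^esub> d0 [^]\<^bsub>Q\<^esub> i = (c0 [^]\<^bsub>C\<^esub> (m * i), \<one>\<^bsub>A\<^esub>)" for i :: nat
      using d0c c0(1) by (simp add: d0_def powQ C.nat_pow_pow oneQ multQ)
    then show ?thesis by (simp add: E.T_def)
  qed
  have B_eq: "b \<in> B \<longleftrightarrow> (\<exists>a\<in>carrier A. b = (\<one>\<^bsub>C\<^esub>, a [^]\<^bsub>A\<^esub> m))" for b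
    by (auto simp: B_def powQ image_iff)
  interpret X: cyclic_times_square Q p E.T B
  proof (intro cyclic_times_square.intro cyclic_times_square_axioms.intro)
    show "comm_group Q" by (rule Q.comm_group_axioms)
    show "subgroup E.T Q" by (rule E.subgroup_T)
    show "subgroup B Q" unfolding B_def by (rule Q.pow_hom_img[OF sA])
    show "E.T \<inter> B = {\<one>\<^bsub>Q\<^esub>}"
    proof (intro equalityI subsetI)
      fix x assume "x \<in> E.T \<inter> B"
      then show "x \<in> {\<one>\<^bsub>Q\<^esub>}" using D_eq[of x] B_eq[of x] by (auto simp: oneQ)
    next
      fix x assume "x \<in> {\<one>\<^bsub>Q\<^esub>}"
      moreover have "\<one>\<^bsub>Q\<^esub> \<in> E.T" using subgroup.one_closed[OF E.subgroup_T] .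
      moreover have "\<one>\<^bsub>Q\<^esub> \<in> B" unfolding B_def by (rule subgroup.one_closed[OF Q.pow_hom_img[OF sA]])
      ultimately show "x \<in> E.T \<inter> B" by simp
    qed
    fix b assume "b \<in> B"
    then obtain a where a: "a \<in> carrier A" "b = (\<one>\<^bsub>C\<^esub>, a [^]\<^bsub>A\<^esub> m)" using B_eq by blast
    have "(a [^]\<^bsub>A\<^esub> m) [^]\<^bsub>A\<^esub> (p ^ k) = \<one>\<^bsub>A\<^esub>"
      using pow_pk[of "(\<one>\<^bsub>C\<^esub>, a)"] a by (simp add: cQ powQ oneQ)
    then have "(a [^]\<^bsub>A\<^esub> m) [^]\<^bsub>A\<^esub> (p * p) = \<one>\<^bsub>A\<^esub>"
      using cube_free_exponent_pow[OF A p] a by simp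
    then show "b [^]\<^bsub>Q\<^esub> (p * p) = \<one>\<^bsub>Q\<^esub>" using a by (simp add: powQ oneQ)
  qed (use finQ p in simp_all)
  have "E.T <#>\<^bsub>Q\<^esub> {\<one>\<^bsub>Q\<^esub>} = E.T"
  proof (intro equalityI subsetI)
    fix x assume "x \<in> E.T <#>\<^bsub>Q\<^esub> {\<one>\<^bsub>Q\<^esub>}"
    then show "x \<in> E.T" using subsetD[OF E.T_carrier] by (auto simp: mem_set_mult)
  next
    fix x assume "x \<in> E.T"
    moreover from this have "x = x \<otimes>\<^bsub>Q\<^esub> \<one>\<^bsub>Q\<^esub>" using subsetD[OF E.T_carrier] by simp
    ultimately show "x \<in> E.T <#>\<^bsub>Q\<^esub> {\<one>\<^bsub>Q\<^esub>}" unfolding mem_set_mult by blast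
  qed
  moreover have "card E.T = p ^ n" using E.card_T by simp
  moreover have "good TYPE('e) p E.GT (p ^ n)" by (rule E.good_cyclic[OF refl refl p])
  ultimately have "X.chain TYPE('e) {\<one>\<^bsub>Q\<^esub>}"
    using subgroup.one_closed[OF X.B] Q.triv_subgroup by (auto simp: X.chain_def)
  then have "X.chain TYPE('e) B" by (rule X.chain_all)
  then have "\<exists>l. card (E.T <#>\<^bsub>Q\<^esub> B) = p ^ l \<and> good TYPE('e) p (Q\<lparr>carrier := E.T <#>\<^bsub>Q\<^esub> B\<rparr>) (p ^ l)"
    by (simp add: X.chain_def)
  moreover have "E.T <#>\<^bsub>Q\<^esub> B = (\<lambda>x. x [^]\<^bsub>Q\<^esub> m) ` carrier Q"
  proof (intro equalityI subsetI)
    fix x assume "x \<in> E.T <#>\<^bsub>Q\<^esub> B"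
    then obtain d b where "d \<in> E.T" "b \<in> B" "x = d \<otimes>\<^bsub>Q\<^esub> b" unfolding mem_set_mult by blast
    then obtain i a where ia: "a \<in> carrier A" "x = (c0 [^]\<^bsub>C\<^esub> (m * i), \<one>\<^bsub>A\<^esub>) \<otimes>\<^bsub>Q\<^esub> (\<one>\<^bsub>C\<^esub>, a [^]\<^bsub>A\<^esub> m)"
      unfolding D_eq B_eq by blast
    have "x = (c0 [^]\<^bsub>C\<^esub> i, a) [^]\<^bsub>Q\<^esub> m"
      using ia c0(1) by (simp add: multQ powQ C.nat_pow_pow mult.commute)
    then show "x \<in> (\<lambda>x. x [^]\<^bsub>Q\<^esub> m) ` carrier Q" using ia(1) c0(1) by (intro image_eqI) (auto simp: cQ)
  next
    fix x assume "x \<in> (\<lambda>x. x [^]\<^bsub>Q\<^esub> m) ` carrier Q"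
    then obtain c a where ca: "c \<in> carrier C" "a \<in> carrier A" "x = (c [^]\<^bsub>C\<^esub> m, a [^]\<^bsub>A\<^esub> m)"
      by (auto simp: cQ powQ)
    obtain i :: nat where i: "c = c0 [^]\<^bsub>C\<^esub> i" using cgen[OF ca(1)] by blast
    have "x = (c0 [^]\<^bsub>C\<^esub> (m * i), \<one>\<^bsub>A\<^esub>) \<otimes>\<^bsub>Q\<^esub> (\<one>\<^bsub>C\<^esub>, a [^]\<^bsub>A\<^esub> m)"
      using ca c0(1) by (simp add: i multQ C.nat_pow_pow mult.commute)
    then show "x \<in> E.T <#>\<^bsub>Q\<^esub> B" unfolding mem_set_mult D_eq B_eq using ca(2) by blast
  qed
  ultimately show ?thesis unfolding Q_def by simp
qed

theorem theorem5p1: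
  fixes F :: "('a, 'm) monoid_scheme" and G :: "('b, 'n) monoid_scheme"
    and C :: "'c monoid" and A :: "('d, 'k) monoid_scheme"
  assumes "group F" and "finite (carrier F)"
    and "group G" and "finite (carrier G)"
    and "group C" and "cyclic_group C"
    and "group A" and "cube_free (group_exponent A)"
    and "F Mod derived F (carrier F) \<cong> C \<times>\<times> A"
  shows "gcd (order G) (card (rcosets\<^bsub>F\<^esub> (derived F (carrier F)))) dvd card (Homs F G)"
proof -
  interpret F: group F by (rule assms(1))
  interpret G: group G by (rule assms(3))
  let ?N = "derived F (carrier F)" and ?Q = "C \<times>\<times> A"
  interpret N: normal ?N F by (rule F.derived_self_is_normal)
  interpret FN: comm_group "F Mod ?N" by (rule F.derived_quot_is_comm_group)
  have gQ: "group ?Q" by (rule DirProd_group[OF assms(5,7)])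
  interpret Q: comm_group ?Q
    by (rule FN.iso_imp_comm_group[OF assms(9) group.is_monoid[OF gQ]])
  obtain \<theta> where \<theta>: "\<theta> \<in> iso (F Mod ?N) ?Q" using assms(9) by (auto simp: is_iso_def)
  have carN: "carrier (F Mod ?N) = rcosets\<^bsub>F\<^esub> ?N" by (simp add: FactGroup_def)
  have bij: "bij_betw \<theta> (rcosets\<^bsub>F\<^esub> ?N) (carrier ?Q)" using \<theta> carN by (auto simp: iso_def)
  have ordQ: "order ?Q = card (rcosets\<^bsub>F\<^esub> ?N)" using bij_betw_same_card[OF bij] by (simp add: order_def)
  have finN: "finite (rcosets\<^bsub>F\<^esub> ?N)" using assms(2) by (simp add: RCOSETS_def)
  have finQ: "finite (carrier ?Q)" using bij_betw_finite[OF bij] finN by simp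
  define \<pi>0 where "\<pi>0 = (\<lambda>f. \<theta> (?N #>\<^bsub>F\<^esub> f))"
  have \<pi>0: "\<pi>0 \<in> hom F ?Q"
  proof -
    have "\<theta> \<circ> (\<lambda>a. ?N #>\<^bsub>F\<^esub> a) \<in> hom F ?Q"
      by (rule hom_compose[OF N.r_coset_hom_Mod]) (use \<theta> in \<open>simp add: iso_def\<close>)
    then show ?thesis by (simp add: \<pi>0_def comp_def)
  qed
  have surj0: "\<pi>0 ` carrier F = carrier ?Q"
  proof -
    have "\<pi>0 ` carrier F = \<theta> ` (rcosets\<^bsub>F\<^esub> ?N)" by (auto simp: \<pi>0_def RCOSETS_def image_iff)
    then show ?thesis using bij by (simp add: bij_betw_def)
  qed
  have main: "p ^ j dvd card (Homs F G)"
    if p: "prime p" and j: "p ^ j dvd order G" "p ^ j dvd order ?Q" for p j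
  proof -
    have "order ?Q \<noteq> 0" using finQ Q.order_gt_0_iff_finite by simp
    then obtain m where m: "order ?Q = p ^ multiplicity p (order ?Q) * m" "\<not> p dvd m"
      using multiplicity_decompose'[of "order ?Q" p] p by (metis not_prime_unit)
    let ?k = "multiplicity p (order ?Q)" and ?P = "(\<lambda>x. x [^]\<^bsub>?Q\<^esub> m) ` carrier ?Q"
    obtain l where l: "card ?P = p ^ l" "good TYPE('b sym) p (?Q\<lparr>carrier := ?P\<rparr>) (p ^ l)"
      using good_power_image[OF assms(5-8) Q.comm_group_axioms finQ p m(1)] by blast
    have "p ^ ?k \<le> p ^ l"
      using Q.prime_power_le_card_power_image[OF finQ p m] l(1) by simp
    then have kl: "?k \<le> l" using prime_gt_1_nat[OF p] by simp
    have "j \<le> ?k" using j(2) \<open>order ?Q \<noteq> 0\<close> p by (intro multiplicity_geI) auto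
    then have jl: "p ^ j dvd p ^ l" using kl by (intro le_imp_power_dvd) simp
    have sP: "subgroup ?P ?Q" by (rule Q.pow_hom_img[OF Q.subgroup_self])
    have gP: "group (?Q\<lparr>carrier := ?P\<rparr>)" by (rule subgroup.subgroup_is_group[OF sP gQ])
    \<comment> \<open>The projection of \<open>F\<close> onto the \<open>p\<close>-part of its
      abelianization is the quotient map followed by the \<open>m\<close>-th power.\<close>
    have "(\<lambda>f. \<pi>0 f [^]\<^bsub>?Q\<^esub> m) \<in> hom F (?Q\<lparr>carrier := ?P\<rparr>)"
    proof (rule homI)
      fix f assume f: "f \<in> carrier F"
      have c: "\<pi>0 f \<in> carrier ?Q" using \<pi>0 f by (rule hom_in_carrier)
      show "\<pi>0 f [^]\<^bsub>?Q\<^esub> m \<in> carrier (?Q\<lparr>carrier := ?P\<rparr>)" using c by simp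
      fix f' assume f': "f' \<in> carrier F"
      have c': "\<pi>0 f' \<in> carrier ?Q" using \<pi>0 f' by (rule hom_in_carrier)
      have "\<pi>0 (f \<otimes>\<^bsub>F\<^esub> f') [^]\<^bsub>?Q\<^esub> m = (\<pi>0 f \<otimes>\<^bsub>?Q\<^esub> \<pi>0 f') [^]\<^bsub>?Q\<^esub> m"
        by (simp only: hom_mult[OF \<pi>0 f f'])
      also have "\<dots> = \<pi>0 f [^]\<^bsub>?Q\<^esub> m \<otimes>\<^bsub>?Q\<^esub> \<pi>0 f' [^]\<^bsub>?Q\<^esub> m" by (rule Q.nat_pow_distrib[OF c c'])
      finally show "\<pi>0 (f \<otimes>\<^bsub>F\<^esub> f') [^]\<^bsub>?Q\<^esub> m
          = \<pi>0 f [^]\<^bsub>?Q\<^esub> m \<otimes>\<^bsub>?Q\<lparr>carrier := ?P\<rparr>\<^esub> \<pi>0 f' [^]\<^bsub>?Q\<^esub> m" by simp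
    qed
    moreover have "(\<lambda>f. \<pi>0 f [^]\<^bsub>?Q\<^esub> m) ` carrier F = carrier (?Q\<lparr>carrier := ?P\<rparr>)"
    proof -
      have "(\<lambda>f. \<pi>0 f [^]\<^bsub>?Q\<^esub> m) ` carrier F = (\<lambda>x. x [^]\<^bsub>?Q\<^esub> m) ` (\<pi>0 ` carrier F)"
        by (simp only: image_image)
      then show ?thesis unfolding surj0 by simp
    qed
    ultimately show ?thesis
      using G.prime_power_dvd_card_Homs[OF assms(1,2,4) gP _ _ p _ l(2) jl j(1)] l(1) by (simp add: order_def)
  qed
  have "gcd (order G) (order ?Q) \<noteq> 0" using finQ Q.order_gt_0_iff_finite by simp
  then have "gcd (order G) (order ?Q) dvd card (Homs F G)"
  proof (rule multiplicity_le_imp_dvd)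
    fix p :: nat assume p: "prime p"
    let ?j = "multiplicity p (gcd (order G) (order ?Q))"
    have "p ^ ?j dvd gcd (order G) (order ?Q)" by (rule multiplicity_dvd)
    then have d: "p ^ ?j dvd card (Homs F G)" by (intro main[OF p]) auto
    \<comment> \<open>The trivial homomorphism makes the count nonzero; this is needed because the
      multiplicity of a prime in 0 is 0 by convention.\<close>
    have "(\<lambda>f\<in>carrier F. \<one>\<^bsub>G\<^esub>) \<in> Homs F G" by (simp add: Homs_def hom_def)
    moreover have "finite (Homs F G)" using assms(2,4) by (rule finite_Homs)
    ultimately have "card (Homs F G) \<noteq> 0" by auto
    then show "?j \<le> multiplicity p (card (Homs F G))"
      using d p by (intro multiplicity_geI) auto
  qed
  then show ?thesis unfolding ordQ .
qed

end
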